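(* Let $n$ be a positive integer, $q$ a prime power, $V$ an $n$-dimensional vector space over $\mathbb{F}_q$, and $2 \le k \le n/2$ an integer. Let $\mathcal{F}$ be a family of $k$-dimensional subspaces of $V$ that is covering-triple-free. Then $$|\mathcal{F}| \le \begin{bmatrix} n-1 \\ k-1\end{bmatrix}_q .$$ Moreover, if $2 \le k < n/2$ and $|\mathcal{F}| = \begin{bmatrix} n-1 \\ k-1\end{bmatrix}_q$, then $\mathcal{F}$ is a star.
   Context: For integers $0\le k\le n$, $[n]_q = \frac{q^n-1}{q-1}$, $[n]_q! = [n]_q[n-1]_q\cdots[1]_q$, and the Gaussian binomial coefficient is $\begin{bmatrix} n \\ k\end{bmatrix}_q = \frac{[n]_q!}{[k]_q!\,[n-k]_q!}$; it equals the number of $k$-dimensional subspaces of an $n$-dimensional space over $\mathbb{F}_q$. Three distinct $k$-dimensional subspaces $A,B,C$ of $V$ form a covering triple if $A = (A\cap B)\oplus(A\cap C)$ (i.e. $A=(A\cap B)+(A\cap C)$ and $A\cap B\cap C=\{0\}$). A family of $k$-dimensional subspaces is covering-triple-free if it contains no three distinct members $A,B,C$ forming a covering triple. A family of subspaces is a star if there is a nonzero vector $v\in V$ contained in every member of the family. *)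

theory Defs
  imports Complex_Main "HOL-Library.Cardinality" "HOL-Library.Set_Algebras"
begin

definition q_int :: "nat \<Rightarrow> nat \<Rightarrow> real" where
  "q_int q n = (real q ^ n - 1) / (real q - 1)"

definition q_fact :: "nat \<Rightarrow> nat \<Rightarrow> real" where
  "q_fact q n = (\<Prod>i = 1..n. q_int q i)"

(* Intended for k \<le> n only, since n - k is truncated subtraction. *)
definition gauss_binomial :: "nat \<Rightarrow> nat \<Rightarrow> nat \<Rightarrow> real" where
  "gauss_binomial q n k = q_fact q n / (q_fact q k * q_fact q (n - k))"

definition k_subspaces ::
  "('a::field \<Rightarrow> 'b::ab_group_add \<Rightarrow> 'b) \<Rightarrow> nat \<Rightarrow> 'b set set" where
  "k_subspaces scale k = {A. module.subspace scale A \<and> vector_space.dim scale A = k}"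

(* Here + on sets is the elementwise sum of HOL-Library.Set_Algebras. *)
definition covering_triple ::
  "('a::field \<Rightarrow> 'b::ab_group_add \<Rightarrow> 'b) \<Rightarrow> nat \<Rightarrow> 'b set \<Rightarrow> 'b set \<Rightarrow> 'b set \<Rightarrow> bool" where
  "covering_triple scale k A B C \<longleftrightarrow>
     A \<in> k_subspaces scale k \<and> B \<in> k_subspaces scale k \<and> C \<in> k_subspaces scale k \<and>
     A \<noteq> B \<and> A \<noteq> C \<and> B \<noteq> C \<and>
     A = (A \<inter> B) + (A \<inter> C) \<and> A \<inter> B \<inter> C = {0}"

definition covering_triple_free ::
  "('a::field \<Rightarrow> 'b::ab_group_add \<Rightarrow> 'b) \<Rightarrow> nat \<Rightarrow> 'b set set \<Rightarrow> bool" where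
  "covering_triple_free scale k \<F> \<longleftrightarrow>
     \<not> (\<exists>A\<in>\<F>. \<exists>B\<in>\<F>. \<exists>C\<in>\<F>. covering_triple scale k A B C)"

definition is_star :: "'b::zero set set \<Rightarrow> bool" where
  "is_star \<F> \<longleftrightarrow> (\<exists>v. v \<noteq> 0 \<and> (\<forall>A\<in>\<F>. v \<in> A))"

end

theory Submission
  imports Defs "HOL-Algebra.Algebraic_Closure_Type" "HOL-Library.Product_Plus"
begin

text \<open>
  Write \<open>c(j)\<close> for the number of \<open>k\<close>-spaces containing a fixed \<open>j\<close>-space, and let \<open>i\<close> be \<open>k div 2\<close>.
  A subspace \<open>D\<close> of a member \<open>B\<close> is unsafe if it equals \<open>B \<inter> C\<close> for some member \<open>C\<close>; unsafe
  subspaces of complementary dimensions of the same member meet nontrivially. Each pair \<open>D \<subseteq> B\<close> with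
  \<open>dim D = i\<close> gets a weight that is small for unsafe \<open>D\<close>. Averaging over the translates of a spread,
  which comes from the field with \<open>q ^ i\<close> elements, shows that the weights in \<open>B\<close> add up to at least the
  number of \<open>i\<close>-spaces of \<open>B\<close> that avoid a given point. Conversely, fix a point \<open>x\<close> and an \<open>i\<close>-space \<open>D\<close>
  avoiding it. The members through \<open>D\<close> and \<open>x\<close>, counted once, and the other members through \<open>D\<close>, counted
  by weight, behave like a family that is intersecting modulo \<open>D\<close> and add up to at most \<open>c(i + 1)\<close>.
  Summing over all such \<open>D\<close> gives the bound \<open>c(1)\<close>.

  In the case of equality with \<open>k \<ge> 4\<close> there are many full subspaces of dimension \<open>f < k\<close>, that is,
  subspaces all of whose \<open>k\<close>-dimensional superspaces are members. Two full spaces of the same dimension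
  below \<open>k\<close> always meet, and generic choices show that they all pass through one point. For \<open>k \<le> 3\<close> the unsafe
  hyperplanes of each member pass through a point and a count of hyperplanes is sharp.
\<close>

section \<open>Counting subspaces\<close>

text \<open>In the family of all k-spaces through a point p, a subspace of a member is unsafe
  exactly when it contains p; this is why the number of i-spaces avoiding a point is the target for
  the weights in one member. For k = 2i two unsafe i-spaces of a member have complementary
  dimensions, so indicator weights suffice, and an Erdos-Ko-Rado argument modulo D has just enough
  room: 3i + i = 2k <= n. The odd case k = 2i + 1 shapes the proof. There unsafe i-spaces conflict
  only with unsafe (i+1)-spaces, so the weight of D must also record how much of B / D the unsafe
  (i+1)-spaces above D span (\<open>unsafe_rank\<close>). Moreover, the Erdos-Ko-Rado argument
  modulo D would need n >= 4i + 3, one more than 2k. It is available only one dimension higher,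
  modulo (i+1)-spaces, and its bounds are averaged down to D by an inequality of LYM type
  (\<open>lym_weight\<close>). The weights that suit a member and those that suit D differ;
  reconciling them is the content of \<open>local_bound_odd\<close>.\<close>

lemma sum_card_swap:
  assumes "finite A" "finite B"
  shows "(\<Sum>x\<in>A. card {y\<in>B. R x y}) = (\<Sum>y\<in>B. card {x\<in>A. R x y})"
proof -
  have "(\<Sum>x\<in>A. card {y\<in>B. R x y}) = (\<Sum>x\<in>A. \<Sum>y\<in>B. if R x y then 1 else 0)"
    using assms by (intro sum.cong) (auto simp: sum.If_cases Int_def)
  also have "\<dots> = (\<Sum>y\<in>B. \<Sum>x\<in>A. if R x y then 1 else 0)"
    by (rule sum.swap)
  also have "\<dots> = (\<Sum>y\<in>B. card {x\<in>A. R x y})"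
    using assms by (intro sum.cong) (auto simp: sum.If_cases Int_def)
  finally show ?thesis .
qed

text \<open>Kept apart from the locale of finite spaces because it is also applied to pairs over the
  algebraic closure of the ground field, an infinite space that houses the model of the
  spread.\<close>

locale vector_space_over_finite_field = vector_space scale
  for scale :: "'a::{field,finite} \<Rightarrow> 'b::ab_group_add \<Rightarrow> 'b"
begin

lemma card_span_insert:
  assumes "x \<notin> span B"
  shows "card (span (insert x B)) = CARD('a) * card (span B)"
proof -
  let ?f = "\<lambda>(c, y). scale c x + y"
  have inj: "inj_on ?f (UNIV \<times> span B)"
  proof (rule inj_onI, clarify)
    fix c y c' y' assume y: "y \<in> span B" "y' \<in> span B" and eq: "scale c x + y = scale c' x + y'"
    have *: "scale (c - c') x = y' - y" using eq by (simp add: scale_left_diff_distrib algebra_simps)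
    have "c = c'"
    proof (rule ccontr)
      assume "c \<noteq> c'"
      hence "x = scale (inverse (c - c')) (y' - y)"
        using * by (metis scale_scale left_inverse scale_one right_minus_eq)
      with assms y show False by (metis span_scale span_diff)
    qed
    with eq show "c = c' \<and> y = y'" by simp
  qed
  have "?f ` (UNIV \<times> span B) = span (insert x B)"
  proof (intro equalityI subsetI)
    fix z assume "z \<in> ?f ` (UNIV \<times> span B)"
    thus "z \<in> span (insert x B)"
      by (auto intro!: span_add span_scale intro: span_base span_superset[THEN subsetD] span_mono[THEN subsetD, rotated])
  next
    fix z assume "z \<in> span (insert x B)"
    then obtain k where "z - scale k x \<in> span B" by (auto simp: span_insert)
    thus "z \<in> ?f ` (UNIV \<times> span B)" by (intro image_eqI[of _ _ "(k, z - scale k x)"]) auto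
  qed
  hence "card (span (insert x B)) = card ((UNIV :: 'a set) \<times> span B)"
    using card_image[OF inj] by simp
  thus ?thesis by (simp add: card_cartesian_product)
qed

lemma card_span_independent:
  assumes "finite B" "independent B" shows "card (span B) = CARD('a) ^ card B"
  using assms
proof (induction B rule: finite_induct)
  case (insert x B)
  hence "x \<notin> span B" "independent B" by (auto simp: independent_insert)
  thus ?case using insert by (simp add: card_span_insert)
qed simp

lemma card_subspace:
  assumes "subspace S" "finite S" shows "card S = CARD('a) ^ dim S"
proof -
  obtain B where B: "B \<subseteq> S" "independent B" "S \<subseteq> span B" "card B = dim S"
    using basis_exists by blast
  have "span B = S" using B assms(1) by (simp add: span_minimal subset_antisym)
  moreover have "finite B" using B(1) assms(2) by (rule finite_subset)
  hence "card (span B) = CARD('a) ^ card B" using B(2) by (rule card_span_independent)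
  ultimately show ?thesis using B(4) by simp
qed

text \<open>An infinite basis has cardinality 0, so an infinite-dimensional space has dimension 0 by
  default; positive dimension therefore forces finiteness.\<close>

lemma finite_UNIV_of_dim_pos:
  assumes "0 < dim UNIV" shows "finite (UNIV :: 'b set)"
proof -
  obtain B :: "'b set" where B: "B \<subseteq> UNIV" "independent B" "UNIV \<subseteq> span B" "card B = dim UNIV"
    by (rule basis_exists)
  have "0 < card B" using B(4) assms by (simp only:)
  hence "finite B" by (rule card_ge_0_finite)
  hence "card (span B) = CARD('a) ^ card B" using B(2) by (rule card_span_independent)
  hence "0 < card (span B)" by simp
  hence "finite (span B)" by (rule card_ge_0_finite)
  thus ?thesis using B(3) by (rule finite_subset[rotated])
qed

end

locale finite_vector_space = vector_space_over_finite_field scale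
  for scale :: "'a::{field,finite} \<Rightarrow> 'b::ab_group_add \<Rightarrow> 'b" +
  assumes finite_UNIV [simp]: "finite (UNIV :: 'b set)"
begin

text \<open>A named basis is wanted because \<open>finite_dimensional_vector_space\<close> carries
  one as a parameter.\<close>

definition some_basis :: "'b set" where
  "some_basis = (SOME B. independent B \<and> span B = UNIV)"

end

sublocale finite_vector_space \<subseteq> finite_dimensional_vector_space scale some_basis
proof -
  obtain B where "independent B \<and> span B = UNIV"
    using maximal_independent_subset[of UNIV] by (metis top.extremum_uniqueI)
  hence "independent some_basis \<and> span some_basis = UNIV"
    unfolding some_basis_def by (rule someI)
  thus "finite_dimensional_vector_space scale some_basis"
    by unfold_locales (auto intro: finite_subset[OF subset_UNIV])
qed

context finite_vector_space
begin

lemma finite_vec [simp, intro]: "finite (S :: 'b set)"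
  by (rule finite_subset[OF subset_UNIV]) simp

lemma finite_vecs [simp, intro]: "finite (S :: 'b set set)"
  by (rule finite_subset[OF subset_UNIV]) (simp add: Finite_Set.finite_set)

definition q :: real where "q = real CARD('a)"

lemma q_ge2: "2 \<le> q"
proof -
  have "card {0, 1 :: 'a} \<le> CARD('a)"
    by (intro card_mono) auto
  thus ?thesis unfolding q_def by simp
qed

lemma card_subspace_real: "subspace S \<Longrightarrow> real (card S) = q ^ dim S"
  by (simp add: card_subspace q_def)

lemma subspace_eqI: "subspace S \<Longrightarrow> subspace T \<Longrightarrow> S \<subseteq> T \<Longrightarrow> dim T \<le> dim S \<Longrightarrow> S = T"
  by (simp add: subspace_dim_equal)

lemma set_plus_eq: "S + T = {x + y |x y. x \<in> S \<and> y \<in> T}"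
  by (auto simp: set_plus_def)

lemma subspace_plus: "subspace S \<Longrightarrow> subspace T \<Longrightarrow> subspace (S + T)"
  unfolding set_plus_eq by (rule subspace_sums)

lemma subset_plus1: "subspace T \<Longrightarrow> S \<subseteq> S + T"
  using subspace_0 by (auto intro!: set_plus_intro[of _ S 0 T, simplified])

lemma subset_plus2: "subspace S \<Longrightarrow> T \<subseteq> S + T"
  using subset_plus1[of S T] by (simp add: add.commute)

lemma plus_subsetI: "subspace A \<Longrightarrow> S \<subseteq> A \<Longrightarrow> T \<subseteq> A \<Longrightarrow> S + T \<subseteq> A"
  by (auto elim!: set_plus_elim intro: subspace_add)

lemma dim_plus:
  assumes "subspace S" "subspace T"
  shows "dim (S + T) + dim (S \<inter> T) = dim S + dim T"
  using dim_sums_Int[OF assms] by (simp only: set_plus_eq)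

lemma zero_in_dim: "subspace S \<Longrightarrow> dim S = 0 \<Longrightarrow> S = {0}"
  using subspace_0 by (auto simp: dim_eq_0)

text \<open>D is a hyperplane of E, so the intersection, lying between the two, is D unless it is
  all of E.\<close>

lemma subspace_between_Int:
  assumes "subspace D" "subspace E" "subspace S" "D \<subseteq> E" "D \<subseteq> S" "dim E = Suc (dim D)" "\<not> E \<subseteq> S"
  shows "S \<inter> E = D"
proof -
  have sub: "subspace (S \<inter> E)" using assms by (simp add: subspace_inter)
  have "dim (S \<inter> E) < dim E"
  proof (rule ccontr)
    assume "\<not> dim (S \<inter> E) < dim E"
    hence "S \<inter> E = E" using sub assms by (intro subspace_eqI) auto
    with assms show False by auto
  qed
  hence "D = S \<inter> E" using sub assms by (intro subspace_eqI) auto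
  thus ?thesis by simp
qed

text \<open>\<open>br\<close> and \<open>gb\<close> are the \<open>q\<close>-bracket and the Gaussian binomial coefficient.\<close>

definition br :: "nat \<Rightarrow> real" where "br n = (\<Sum>t<n. q ^ t)"

definition gb :: "nat \<Rightarrow> nat \<Rightarrow> real" where "gb m j = (\<Prod>t<j. br (m - t) / br (j - t))"

lemma br_0 [simp]: "br 0 = 0" by (simp add: br_def)

lemma br_1 [simp]: "br (Suc 0) = 1" by (simp add: br_def)

lemma br_Suc: "br (Suc n) = q * br n + 1"
  by (simp only: br_def sum.lessThan_Suc_shift) (simp add: sum_distrib_left)

lemma br_Suc': "br (Suc n) = br n + q ^ n"
  by (simp add: br_def)

lemma br_mult: "br n * (q - 1) = q ^ n - 1"
  by (induction n) (auto simp: br_Suc' algebra_simps)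

lemma br_closed: "br n = (q ^ n - 1) / (q - 1)"
  using br_mult[of n] q_ge2 by (simp add: field_simps)

lemma br_add: "br (m + n) = q ^ m * br n + br m"
  by (induction m) (auto simp: br_Suc algebra_simps)

lemma br_nonneg [simp]: "0 \<le> br n"
  unfolding br_def using q_ge2 by (intro sum_nonneg) auto

lemma br_pos [simp]: "0 < n \<Longrightarrow> 0 < br n"
  using q_ge2 by (cases n) (auto simp: br_Suc intro!: add_nonneg_pos)

lemma br_ge1: "0 < n \<Longrightarrow> 1 \<le> br n"
  using q_ge2 by (cases n) (auto simp: br_Suc)

lemma br_mono: "m \<le> n \<Longrightarrow> br m \<le> br n"
  unfolding br_def using q_ge2 by (intro sum_mono2) auto

lemma br_eq_0_iff [simp]: "br n = 0 \<longleftrightarrow> n = 0"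
  by (metis br_0 br_pos less_irrefl not_gr_zero)

lemma gb_0 [simp]: "gb m 0 = 1" by (simp add: gb_def)

lemma gb_Suc: "gb m (Suc j) * br (Suc j) = br m * gb (m - 1) j"
  unfolding gb_def by (subst prod.lessThan_Suc_shift) simp

lemma gb_nonneg [simp]: "0 \<le> gb m j"
  unfolding gb_def by (intro prod_nonneg) auto

lemma gb_pos: "j \<le> m \<Longrightarrow> 0 < gb m j"
  unfolding gb_def by (intro prod_pos) auto

lemma gb_self [simp]: "gb m m = 1"
  unfolding gb_def by (intro prod.neutral) auto

lemma gb_pred: "gb (Suc m) m = br (Suc m)"
proof (induction m)
  case (Suc m)
  have "gb (Suc (Suc m)) (Suc m) * br (Suc m) = br (Suc (Suc m)) * br (Suc m)"
    using gb_Suc[of "Suc (Suc m)" m] Suc by simp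
  thus ?case by simp
qed simp

text \<open>Quotient spaces are avoided: \<open>pts D A\<close> plays the role of the points of \<open>A / D\<close>.\<close>

definition between :: "'b set \<Rightarrow> nat \<Rightarrow> 'b set \<Rightarrow> 'b set set" where
  "between S j A = {B. subspace B \<and> S \<subseteq> B \<and> B \<subseteq> A \<and> dim B = j}"

definition pts :: "'b set \<Rightarrow> 'b set \<Rightarrow> 'b set set" where
  "pts D A = between D (Suc (dim D)) A"

lemma pts_iff: "E \<in> pts D A \<longleftrightarrow> subspace E \<and> D \<subseteq> E \<and> E \<subseteq> A \<and> dim E = Suc (dim D)"
  by (simp add: pts_def between_def)

lemma between_iff: "B \<in> between S j A \<longleftrightarrow> subspace B \<and> S \<subseteq> B \<and> B \<subseteq> A \<and> dim B = j"
  by (simp add: between_def)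

lemma span_insert_pts:
  assumes "subspace D" "v \<notin> D"
  shows "span (insert v D) \<in> pts D UNIV"
proof -
  have "span D = D" using assms(1) by (simp add: span_eq_iff)
  hence "v \<notin> span D" using assms(2) by metis
  hence "dim (insert v D) = Suc (dim D)" by (simp add: dim_insert)
  moreover have "D \<subseteq> span (insert v D)" using span_superset[of "insert v D"] by blast
  ultimately show ?thesis by (simp add: pts_iff)
qed

lemma pts_Int:
  assumes "subspace D" "E \<in> pts D A" "E' \<in> pts D B" "E \<noteq> E'"
  shows "E \<inter> E' = D"
proof (rule subspace_between_Int)
  show "\<not> E' \<subseteq> E" using assms subspace_eqI[of E' E] by (auto simp: pts_iff)
qed (use assms in \<open>auto simp: pts_iff\<close>)

lemma ex_pts:
  assumes "subspace D" "subspace A" "D \<subset> A"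
  shows "\<exists>E. E \<in> pts D A"
proof -
  obtain v where v: "v \<in> A" "v \<notin> D" using assms by blast
  have "span (insert v D) \<subseteq> A" using assms v by (intro span_minimal) auto
  thus ?thesis using span_insert_pts[OF assms(1) v(2)] by (auto simp: pts_iff)
qed

text \<open>The vectors of A outside D fall into the disjoint classes \<open>E - D\<close>, each of
  size \<open>q ^ dim D * (q - 1)\<close>.\<close>

lemma card_pts:
  assumes "subspace D" "subspace A" "D \<subseteq> A"
  shows "real (card (pts D A)) = br (dim A - dim D)"
proof -
  have un: "(\<Union>E\<in>pts D A. E - D) = A - D"
  proof (intro equalityI subsetI)
    fix v assume v: "v \<in> A - D"
    have "span (insert v D) \<subseteq> A" using assms v by (intro span_minimal) auto
    hence "span (insert v D) \<in> pts D A" using span_insert_pts[OF assms(1)] v by (auto simp: pts_iff)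
    moreover have "v \<in> span (insert v D)" by (simp add: span_base)
    ultimately show "v \<in> (\<Union>E\<in>pts D A. E - D)" using v by blast
  qed (auto simp: pts_iff)
  have "card (\<Union>E\<in>pts D A. E - D) = (\<Sum>E\<in>pts D A. card (E - D))"
    by (rule card_UN_disjoint) (use pts_Int[OF assms(1)] in auto)
  also have "real \<dots> = (\<Sum>E\<in>pts D A. q ^ dim D * (q - 1))"
  proof (simp only: of_nat_sum, intro sum.cong refl)
    fix E assume "E \<in> pts D A"
    hence E: "subspace E" "D \<subseteq> E" "dim E = Suc (dim D)" by (auto simp: pts_iff)
    have "real (card (E - D)) = real (card E) - real (card D)"
      using E by (simp add: card_Diff_subset card_mono of_nat_diff)
    thus "real (card (E - D)) = q ^ dim D * (q - 1)"
      using E assms by (simp add: card_subspace_real algebra_simps)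
  qed
  finally have "real (card (A - D)) = real (card (pts D A)) * (q ^ dim D * (q - 1))"
    using un by simp
  moreover have "real (card (A - D)) = q ^ dim A - q ^ dim D"
    using assms by (simp add: card_Diff_subset card_mono of_nat_diff card_subspace_real)
  moreover have "q ^ dim A - q ^ dim D = q ^ dim D * (br (dim A - dim D) * (q - 1))"
  proof -
    have "q ^ dim A = q ^ dim D * q ^ (dim A - dim D)"
      using dim_subset[OF assms(3)] by (simp flip: power_add)
    thus ?thesis by (simp only: br_mult) (simp add: algebra_simps)
  qed
  ultimately show ?thesis using q_ge2 by simp
qed

text \<open>Induction on \<open>j - dim S\<close>: counting the pairs of a point E modulo S and a B
  containing it reproduces the recurrence \<open>gb_Suc\<close>.\<close>

lemma card_between:
  assumes "subspace S" "subspace A" "S \<subseteq> A" "dim S \<le> j"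
  shows "real (card (between S j A)) = gb (dim A - dim S) (j - dim S)"
  using assms
proof (induction "j - dim S" arbitrary: S)
  case 0
  hence "j = dim S" by simp
  have "B = S" if "B \<in> between S j A" for B
    by (rule subspace_eqI[symmetric]) (use that \<open>j = dim S\<close> 0(2) in \<open>auto simp: between_iff\<close>)
  moreover have "S \<in> between S j A" using \<open>j = dim S\<close> 0(2,4) by (auto simp: between_iff)
  ultimately have "between S j A = {S}" by blast
  thus ?case using \<open>j = dim S\<close> by simp
next
  case (Suc t)
  have ts: "j - dim S = Suc t" using Suc by simp
  let ?P = "pts S A"
  have "(\<Sum>B\<in>between S j A. card {E\<in>?P. E \<subseteq> B}) = (\<Sum>E\<in>?P. card {B\<in>between S j A. E \<subseteq> B})"
    by (rule sum_card_swap) auto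
  moreover have "real (\<Sum>B\<in>between S j A. card {E\<in>?P. E \<subseteq> B}) = real (card (between S j A)) * br (Suc t)"
  proof -
    have "real (card {E\<in>?P. E \<subseteq> B}) = br (Suc t)" if B: "B \<in> between S j A" for B
    proof -
      have "{E\<in>?P. E \<subseteq> B} = pts S B" using B unfolding pts_def between_def by blast
      thus ?thesis using B Suc(2,3) by (simp add: card_pts between_iff)
    qed
    thus ?thesis by simp
  qed
  moreover have "real (\<Sum>E\<in>?P. card {B\<in>between S j A. E \<subseteq> B}) = br (dim A - dim S) * gb (dim A - dim S - 1) t"
  proof -
    have "real (card {B\<in>between S j A. E \<subseteq> B}) = gb (dim A - dim S - 1) t" if E: "E \<in> ?P" for E
    proof -
      have "{B\<in>between S j A. E \<subseteq> B} = between E j A" using E unfolding pts_def between_def by blast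
      moreover have "real (card (between E j A)) = gb (dim A - dim E) (j - dim E)"
        using E Suc(2) by (intro Suc(1)) (auto simp: pts_iff Suc.prems)
      moreover have "j - dim E = t" "dim A - dim E = dim A - dim S - 1" using E ts by (auto simp: pts_iff)
      ultimately show ?thesis by simp
    qed
    thus ?thesis using Suc.prems by (simp add: card_pts)
  qed
  ultimately have "real (card (between S j A)) * br (Suc t) = gb (dim A - dim S) (Suc t) * br (Suc t)"
    by (simp add: gb_Suc)
  thus ?case using ts by simp
qed

lemma plus_pts:
  assumes "subspace D" "subspace S" "D \<subseteq> S" "E \<in> pts D UNIV" "\<not> E \<subseteq> S"
  shows "S + E \<in> pts S UNIV"
proof -
  have E: "subspace E" "D \<subseteq> E" "dim E = Suc (dim D)" using assms by (auto simp: pts_iff)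
  have "S \<inter> E = D" using assms E by (intro subspace_between_Int)
  hence "dim (S + E) = Suc (dim S)" using dim_plus[of S E] assms E by simp
  thus ?thesis using assms E by (simp add: pts_iff subspace_plus subset_plus1)
qed

end

section \<open>Spreads\<close>

lemma power_card_finite_field: "(x :: 'a::{field,finite}) ^ CARD('a) = x"
proof (cases "x = 0")
  case False
  have "x * (\<Prod>y\<in>UNIV-{0}. x * y) = x * x ^ (CARD('a) - 1) * \<Prod>(UNIV-{0})"
    by (simp add: prod.distrib mult_ac)
  also have "x * x ^ (CARD('a) - 1) = x ^ Suc (CARD('a) - 1)"
    by (subst power_Suc) auto
  also have "Suc (CARD('a) - 1) = CARD('a)"
    using finite_UNIV_card_ge_0[where ?'a = 'a] by simp
  also have "(\<Prod>y\<in>UNIV-{0}. x * y) = (\<Prod>y\<in>UNIV-{0}. y)"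
    by (rule prod.reindex_bij_witness[of _ "\<lambda>y. y / x" "\<lambda>y. x * y"]) (use False in auto)
  finally show ?thesis
    by simp
qed (use finite_UNIV_card_ge_0[where ?'a = 'a] in auto)

lemma card_finite_field_ge2: "2 \<le> CARD('a::{field,finite})"
proof -
  have "card {0, 1 :: 'a} \<le> CARD('a)"
    by (intro card_mono) auto
  thus ?thesis by simp
qed

text \<open>The polynomial $(1+t)^q - 1 - t^q$ has degree less than $q$ and vanishes on the whole field.\<close>

lemma of_nat_binomial_card_eq_0:
  assumes "0 < j" "j < CARD('a::{field,finite})"
  shows "of_nat (CARD('a) choose j) = (0 :: 'a)"
proof -
  let ?q = "CARD('a)"
  define p :: "'a poly" where "p = (\<Sum>i\<in>{0<..<?q}. monom (of_nat (?q choose i)) i)"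
  have "poly p x = 0" for x
  proof -
    have "{..?q} = insert 0 (insert ?q {0<..<?q})" by auto
    hence "(x + 1) ^ ?q = 1 + (x ^ ?q + (\<Sum>i\<in>{0<..<?q}. of_nat (?q choose i) * x ^ i))"
      by (subst binomial_ring) simp
    moreover have "poly p x = (\<Sum>i\<in>{0<..<?q}. of_nat (?q choose i) * x ^ i)"
      by (simp add: p_def poly_sum poly_monom)
    ultimately show ?thesis by (simp add: power_card_finite_field)
  qed
  hence "{x. poly p x = 0} = UNIV" by auto
  moreover have "degree p < ?q"
    unfolding p_def
    by (rule le_less_trans[OF degree_sum_le[where n = "?q - 1"]])
       (use assms in \<open>auto intro!: order_trans[OF degree_monom_le]\<close>)
  ultimately have "p = 0"
    using card_poly_roots_bound[of p] by (metis not_less)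
  hence "coeff p j = 0" by simp
  moreover have "coeff p j = of_nat (?q choose j)"
    unfolding p_def coeff_sum coeff_monom using assms by (simp add: sum.delta)
  ultimately show ?thesis by simp
qed

text \<open>The inner binomial coefficients vanish in the ground field and hence in its closure;
  this gives additivity of the Frobenius map without naming the characteristic.\<close>

lemma add_power_card:
  fixes x y :: "'a::{field,finite} alg_closure"
  shows "(x + y) ^ CARD('a) = x ^ CARD('a) + y ^ CARD('a)"
proof -
  let ?q = "CARD('a)"
  have "{..?q} = insert 0 (insert ?q {0<..<?q})" by auto
  hence "(x + y) ^ ?q = y ^ ?q + (x ^ ?q + (\<Sum>i\<in>{0<..<?q}. of_nat (?q choose i) * x ^ i * y ^ (?q - i)))"
    by (subst binomial_ring) simp
  also have "(\<Sum>i\<in>{0<..<?q}. of_nat (?q choose i) * x ^ i * y ^ (?q - i)) = 0"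
  proof (rule sum.neutral, rule ballI)
    fix i assume i: "i \<in> {0<..<?q}"
    hence "of_nat (?q choose i) = (0 :: 'a)" by (intro of_nat_binomial_card_eq_0) auto
    hence "of_nat (?q choose i) = (0 :: 'a alg_closure)" by (metis to_ac_0 to_ac_of_nat)
    thus "of_nat (?q choose i) * x ^ i * y ^ (?q - i) = 0" by simp
  qed
  finally show ?thesis by simp
qed

text \<open>The subfield with \<open>q ^ i\<close> elements (for \<open>i > 0\<close>).\<close>

definition frobenius_fixed :: "nat \<Rightarrow> 'a::{field,finite} alg_closure set" where
  "frobenius_fixed i = {x. x ^ (CARD('a) ^ i) = x}"

lemma add_power_card_power:
  fixes x y :: "'a::{field,finite} alg_closure"
  shows "(x + y) ^ (CARD('a) ^ i) = x ^ (CARD('a) ^ i) + y ^ (CARD('a) ^ i)"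
  by (induction i) (simp_all add: power_mult mult.commute[of "CARD('a)"] add_power_card)

lemma to_ac_power_card_power:
  "to_ac (c :: 'a::{field,finite}) ^ (CARD('a) ^ i) = to_ac c"
  by (induction i) (simp_all add: power_mult power_card_finite_field flip: to_ac_power)

lemma frobenius_fixed_closed:
  fixes x y :: "'a::{field,finite} alg_closure"
  assumes "x \<in> frobenius_fixed i" "y \<in> frobenius_fixed i"
  shows "x + y \<in> frobenius_fixed i" "x * y \<in> frobenius_fixed i" "to_ac c * x \<in> frobenius_fixed i"
    "x / y \<in> frobenius_fixed i"
  using assms
  by (simp_all add: frobenius_fixed_def add_power_card_power power_mult_distrib to_ac_power_card_power power_divide)

lemma zero_frobenius_fixed [simp]: "0 \<in> frobenius_fixed i"
  by (simp add: frobenius_fixed_def)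

lemma of_nat_card_eq_0: "of_nat CARD('a::{field,finite}) = (0 :: 'a alg_closure)"
proof -
  have "of_nat (CARD('a) choose 1) = (0 :: 'a)"
    using card_finite_field_ge2[where ?'a = 'a] by (intro of_nat_binomial_card_eq_0) auto
  thus ?thesis by (metis choose_one to_ac_0 to_ac_of_nat)
qed

text \<open>The fixed elements are the roots of x^Q - x. Its derivative is the constant -1, so no
  root is repeated and the degree counts them.\<close>

lemma card_frobenius_fixed:
  assumes "0 < i"
  shows "card (frobenius_fixed i :: 'a::{field,finite} alg_closure set) = CARD('a) ^ i"
proof -
  let ?Q = "CARD('a) ^ i"
  have Q: "1 < ?Q" using assms card_finite_field_ge2[where ?'a = 'a] by (intro one_less_power) auto
  define p :: "'a alg_closure poly" where "p = monom 1 ?Q - monom 1 1"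
  have deg: "degree p = ?Q"
    unfolding p_def diff_conv_add_uminus using Q
    by (subst degree_add_eq_left) (simp_all add: degree_monom_eq)
  hence "p \<noteq> 0" using Q by force
  have poly: "poly p x = x ^ ?Q - x" for x by (simp add: p_def poly_monom)
  have "of_nat ?Q = (0 :: 'a alg_closure)"
    using assms of_nat_card_eq_0[where ?'a = 'a] by (simp only: of_nat_power) simp
  hence pd: "poly (pderiv p) x = -1" for x
    by (simp add: p_def pderiv_diff pderiv_monom poly_monom)
  obtain R where R: "size R = degree p" "p = smult (lead_coeff p) (\<Prod>x\<in>#R. [:-x, 1:])"
    using alg_closed_imp_factorization[OF \<open>p \<noteq> 0\<close>] by blast
  have "count R x \<le> 1" for x
  proof (rule ccontr)
    assume "\<not> count R x \<le> 1"
    hence "x \<in># R" "x \<in># R - {#x#}"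
      by (auto simp: count_greater_zero_iff[symmetric] simp del: count_greater_zero_iff)
    then obtain R' where "R = add_mset x (add_mset x R')"
      by (metis insert_DiffM)
    hence "\<exists>r. p = [:-x, 1:] * ([:-x, 1:] * r)"
      using R(2) by (intro exI[of _ "smult (lead_coeff p) (\<Prod>x\<in>#R'. [:-x, 1:])"]) simp
    then obtain r where pr: "p = [:-x, 1:] * ([:-x, 1:] * r)" by blast
    have aux: "poly (pderiv (a * (a * r))) x = 0" if "poly a x = 0" for a
      using that by (simp add: pderiv_mult)
    have "poly (pderiv p) x = 0" unfolding pr by (rule aux) simp
    thus False using pd[of x] by simp
  qed
  hence "card (set_mset R) = size R"
    by (metis count_greater_eq_one_iff le_antisym size_multiset_overloaded_eq sum.cong card_eq_sum)
  moreover have "poly p x = 0 \<longleftrightarrow> x \<in># R" for x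
    using \<open>p \<noteq> 0\<close> by (subst R(2)) (auto simp: poly_prod_mset)
  hence "set_mset R = frobenius_fixed i"
    by (auto simp: frobenius_fixed_def poly)
  ultimately show ?thesis using R deg by simp
qed

lemma card_vimage_eq_sum_fibres:
  assumes "finite A" "finite B"
  shows "card {x\<in>A. f x \<in> B} = (\<Sum>y\<in>B. card {x\<in>A. f x = y})"
proof -
  have "(\<Sum>y\<in>B. card {x\<in>A. f x = y}) = (\<Sum>x\<in>A. card {y\<in>B. f x = y})"
    using assms by (rule sum_card_swap[symmetric])
  also have "\<dots> = (\<Sum>x\<in>A. if f x \<in> B then 1 else 0)"
  proof (intro sum.cong refl)
    fix x
    have "{y\<in>B. f x = y} = (if f x \<in> B then {f x} else {})" by auto
    thus "card {y\<in>B. f x = y} = (if f x \<in> B then 1 else 0)" by simp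
  qed
  also have "\<dots> = card {x\<in>A. f x \<in> B}"
    using assms by (simp add: sum.If_cases Int_def)
  finally show ?thesis by simp
qed

section \<open>Partial spreads and averaging over their translates\<close>

context finite_vector_space
begin

text \<open>H is isomorphic to the plane K x K over the field K of order q^i, viewed as a space over
  the ground field. The lines of this plane through the origin form the spread: the graphs
  \<open>L m\<close> of the slopes m in K and the vertical line \<open>M\<close>.\<close>

lemma partial_spread_exists:
  assumes "0 < i" "subspace H" "dim H = 2 * i"
  obtains \<S> where "\<S> \<subseteq> between {0} i H" "card \<S> = CARD('a) ^ i + 1"
    "\<And>S T. S \<in> \<S> \<Longrightarrow> T \<in> \<S> \<Longrightarrow> S \<noteq> T \<Longrightarrow> S \<inter> T = {0}"
proof -
  define scale2 :: "'a \<Rightarrow> 'a alg_closure \<times> 'a alg_closure \<Rightarrow> 'a alg_closure \<times> 'a alg_closure"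
    where "scale2 = (\<lambda>c v. (to_ac c * fst v, to_ac c * snd v))"
  interpret W: vector_space_over_finite_field scale2
    by unfold_locales (auto simp: scale2_def algebra_simps)
  interpret VW: vector_space_pair scale scale2 by unfold_locales
  define K :: "'a alg_closure set" where "K = frobenius_fixed i"
  have K: "card K = CARD('a) ^ i" unfolding K_def using assms(1) by (rule card_frobenius_fixed)
  have K2: "2 \<le> card K" using card_finite_field_ge2[where ?'a = 'a] assms(1)
    unfolding K by (metis Suc_1 Suc_leI less_le_trans one_less_power lessI)
  hence finK: "finite K" using card.infinite by fastforce
  have K0: "0 \<in> K" by (simp add: K_def)
  have sub: "W.subspace (K \<times> K)"
    by (rule W.subspaceI) (auto simp: K_def scale2_def zero_prod_def intro: frobenius_fixed_closed)
  have "CARD('a) ^ W.dim (K \<times> K) = CARD('a) ^ (2 * i)"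
    using W.card_subspace[OF sub] finK by (simp add: K card_cartesian_product mult_2 power_add)
  hence dimK: "W.dim (K \<times> K) = dim H"
    using card_finite_field_ge2[where ?'a = 'a] assms(3) by (simp add: power_inject_exp)
  obtain B where B: "B \<subseteq> H" "independent B" "H \<subseteq> span B" "card B = dim H"
    using basis_exists by blast
  obtain C where C: "C \<subseteq> K \<times> K" "W.independent C" "K \<times> K \<subseteq> W.span C" "card C = W.dim (K \<times> K)"
    using W.basis_exists by blast
  have "finite B" "finite C" using C(1) finK by (auto intro: finite_subset)
  then obtain f where f: "Vector_Spaces.linear scale scale2 f" "f ` H = K \<times> K" "inj_on f H"
    using VW.finite_basis_to_basis_subspace_isomorphism[OF assms(2) sub dimK[symmetric] _ B _ C] by auto
  interpret f: Vector_Spaces.linear scale scale2 f by fact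
  define L where "L = (\<lambda>m. {v\<in>H. snd (f v) = m * fst (f v)})"
  define M where "M = {v\<in>H. fst (f v) = 0}"
  have H: "subspace H" by fact
  have subL: "subspace (L m)" for m
    using H unfolding L_def
    by (intro subspaceI) (auto simp: f.add f.scale f.zero scale2_def algebra_simps subspace_0 subspace_add subspace_scale)
  have subM: "subspace M"
    using H unfolding M_def
    by (intro subspaceI) (auto simp: f.add f.scale f.zero scale2_def algebra_simps subspace_0 subspace_add subspace_scale)
  have dim_eq: "dim S = i" if "subspace S" "S \<subseteq> H" "card (f ` S) = card K" for S
  proof -
    have "card S = card (f ` S)" using f(3) that(2) by (intro card_image[symmetric] inj_on_subset[OF f(3)])
    hence "CARD('a) ^ dim S = CARD('a) ^ i" using card_subspace[OF that(1)] that K by simp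
    thus ?thesis using card_finite_field_ge2[where ?'a = 'a] by (simp add: power_inject_exp)
  qed
  have fL: "f ` L m = (\<lambda>a. (a, m * a)) ` K" if "m \<in> K" for m
  proof -
    have "f ` L m = {w\<in>K \<times> K. snd w = m * fst w}"
      unfolding f(2)[symmetric] L_def by auto
    also have "\<dots> = (\<lambda>a. (a, m * a)) ` K"
      using that by (auto simp: K_def frobenius_fixed_closed)
    finally show ?thesis .
  qed
  have dimL: "dim (L m) = i" if "m \<in> K" for m
  proof (rule dim_eq[OF subL])
    show "card (f ` L m) = card K" unfolding fL[OF that] by (intro card_image inj_onI) auto
  qed (simp add: L_def)
  have fM: "f ` M = Pair 0 ` K"
  proof -
    have "f ` M = {w\<in>K \<times> K. fst w = 0}" unfolding f(2)[symmetric] M_def by auto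
    also have "\<dots> = Pair 0 ` K" using K0 by auto
    finally show ?thesis .
  qed
  have dimM: "dim M = i"
  proof (rule dim_eq[OF subM])
    show "card (f ` M) = card K" unfolding fM by (intro card_image inj_onI) auto
  qed (simp add: M_def)
  have zero: "v = 0" if "v \<in> H" "f v = 0" for v
    using that f(3) f.zero subspace_0[OF H] by (metis inj_onD)
  have LL: "L m \<inter> L m' = {0}" if "m \<noteq> m'" for m m'
  proof -
    have "v = 0" if v: "v \<in> L m" "v \<in> L m'" for v
    proof -
      have "fst (f v) = 0" using v \<open>m \<noteq> m'\<close> by (auto simp: L_def)
      hence "f v = 0" using v by (simp add: L_def prod_eq_iff)
      thus ?thesis using v by (intro zero) (auto simp: L_def)
    qed
    thus ?thesis using subspace_0[OF subL] by blast
  qed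
  have LM: "L m \<inter> M = {0}" for m
  proof -
    have "v = 0" if v: "v \<in> L m" "v \<in> M" for v
      using v by (intro zero) (auto simp: L_def M_def prod_eq_iff)
    thus ?thesis using subspace_0[OF subL] subspace_0[OF subM] by blast
  qed
  have ne: "L m \<noteq> {0}" if "m \<in> K" for m using dimL[OF that] assms(1) by auto
  show ?thesis
  proof
    show "insert M (L ` K) \<subseteq> between {0} i H"
      using subL subM dimL dimM by (auto simp: between_iff subspace_0) (auto simp: L_def M_def)
    have "inj_on L K" by (rule inj_onI) (metis LL Int_absorb ne)
    moreover have "M \<notin> L ` K" by (metis LM Int_absorb ne imageE)
    ultimately show "card (insert M (L ` K)) = CARD('a) ^ i + 1"
      using finK by (simp add: card_image K)
    show "S \<inter> T = {0}" if "S \<in> insert M (L ` K)" "T \<in> insert M (L ` K)" "S \<noteq> T" for S T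
      using that LL LM by (metis Int_commute imageE insertE)
  qed
qed

text \<open>Bases of D and D' are extended to bases of H and matched. The resulting transitivity on
  subspaces of one dimension is what makes averaging over translates uniform.\<close>

lemma linear_bij_subspace_transitive:
  assumes "subspace D" "subspace D'" "subspace H" "D \<subseteq> H" "D' \<subseteq> H" "dim D = dim D'"
  obtains g where "Vector_Spaces.linear scale scale g" "bij g" "g ` H = H" "g ` D = D'"
proof -
  have ext: "\<exists>B C. B \<subseteq> C \<and> independent C \<and> span B = D \<and> span C = H \<and> card B = dim D \<and> card C = dim H"
    if D: "subspace D" "D \<subseteq> H" for D
  proof -
    obtain B where B: "B \<subseteq> D" "independent B" "D \<subseteq> span B" "card B = dim D"
      using basis_exists by blast
    obtain C where C: "B \<subseteq> C" "C \<subseteq> H" "independent C" "H \<subseteq> span C"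
      using maximal_independent_subset_extend[of B H] B D by (metis subset_trans)
    have "span B = D" using B D by (simp add: span_minimal subset_antisym)
    moreover have "span C = H" using C assms by (simp add: span_minimal subset_antisym)
    moreover have "card C = dim H" using C by (simp add: dim_unique)
    ultimately show ?thesis using B C by blast
  qed
  obtain B C where BC: "B \<subseteq> C" "independent C" "span B = D" "span C = H" "card B = dim D" "card C = dim H"
    using ext[of D] assms by blast
  obtain B' C' where BC': "B' \<subseteq> C'" "independent C'" "span B' = D'" "span C' = H" "card B' = dim D'" "card C' = dim H"
    using ext[of D'] assms by blast
  obtain h where h: "bij_betw h B B'"
    using finite_same_card_bij[of B B'] BC BC' assms by auto
  have "card (C - B) = card (C' - B')"
    using BC BC' assms by (simp add: card_Diff_subset)
  then obtain h' where h': "bij_betw h' (C - B) (C' - B')"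
    using finite_same_card_bij[of "C - B" "C' - B'"] by auto
  define f where "f = (\<lambda>x. if x \<in> B then h x else h' x)"
  have fB: "bij_betw f B B'" using h by (simp add: f_def cong: bij_betw_cong)
  have "bij_betw f (C - B) (C' - B')" using h' by (subst bij_betw_cong[where g = h']) (auto simp: f_def)
  hence "bij_betw f (B \<union> (C - B)) (B' \<union> (C' - B'))"
    using fB by (intro bij_betw_combine) auto
  hence fC: "bij_betw f C C'" using BC BC' by (simp add: Un_absorb1 Un_Diff_cancel)
  obtain g where g: "Vector_Spaces.linear scale scale g" "inj g" "\<forall>x\<in>C. g x = f x"
    using linear_independent_extend_inj[of C f] BC BC' fC by (metis bij_betw_def)
  interpret g: Vector_Spaces.linear scale scale g by fact
  have gC: "g ` C = C'" using g(3) fC by (metis bij_betw_def image_cong)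
  have "g ` B = f ` B" using g(3) BC(1) by (intro image_cong) auto
  hence gB: "g ` B = B'" using fB by (simp add: bij_betw_def)
  show ?thesis
  proof
    show "bij g" using g(2) by (simp add: bij_def finite_UNIV_inj_surj)
    show "g ` H = H" using g.span_image[of C] BC BC' gC by simp
    show "g ` D = D'" using g.span_image[of B] BC BC' gB by simp
  qed fact
qed

text \<open>Averaging over the translates of a spread of \<open>H\<close>.\<close>

lemma disjointness_weight_le:
  assumes H: "0 < i" "subspace H" "dim H = 2 * i"
    and sub: "\<L> \<subseteq> between {0} i H" "\<P> \<subseteq> between {0} i H" "\<L> \<inter> \<P> = {}"
    and meet: "\<And>D D'. D \<in> \<L> \<Longrightarrow> D' \<in> \<L> \<union> \<P> \<Longrightarrow> D \<noteq> D' \<Longrightarrow> D \<inter> D' \<noteq> {0}"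
  shows "real (card \<P>) + (q ^ i + 1) * real (card \<L>) \<le> gb (2 * i) i"
proof -
  obtain \<S> where \<S>: "\<S> \<subseteq> between {0} i H" "card \<S> = CARD('a) ^ i + 1"
    "\<And>S T. S \<in> \<S> \<Longrightarrow> T \<in> \<S> \<Longrightarrow> S \<noteq> T \<Longrightarrow> S \<inter> T = {0}"
    using partial_spread_exists[OF H] by blast
  define G where "G = {g. Vector_Spaces.linear scale scale g \<and> bij g \<and> g ` H = H}"
  define N where "N = (\<lambda>S D. card {g\<in>G. g ` S = D})"
  have finF: "finite (UNIV :: ('b \<Rightarrow> 'b) set)"
    using finite_set_of_finite_funs[of "UNIV :: 'b set" "UNIV :: 'b set"] by simp
  hence finG: "finite G" by (rule finite_subset[rotated]) simp
  have img: "g ` S \<in> between {0} i H" if "g \<in> G" "S \<in> between {0} i H" for g S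
  proof -
    interpret g: Vector_Spaces.linear scale scale g using that by (simp add: G_def)
    have sp: "subspace S" "subspace (g ` S)" using that by (auto simp: between_iff intro: g.subspace_image)
    have "card (g ` S) = card S" using that by (intro card_image) (auto simp: G_def bij_def intro: inj_on_subset)
    hence "CARD('a) ^ dim (g ` S) = CARD('a) ^ dim S" using card_subspace sp by simp
    hence "dim (g ` S) = dim S" using card_finite_field_ge2[where ?'a = 'a] by (simp add: power_inject_exp)
    thus ?thesis using that sp by (auto simp: between_iff G_def subspace_0)
  qed
  \<comment> \<open>Composing with a map that carries D to D' injects the maps counted by
    \<open>N S D\<close> into those counted by \<open>N S D'\<close>; by symmetry \<open>N S\<close>
    is constant.\<close>
  have N_le: "N S D \<le> N S D'" if D: "D \<in> between {0} i H" "D' \<in> between {0} i H" for S D D'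
  proof -
    obtain h where h: "Vector_Spaces.linear scale scale h" "bij h" "h ` H = H" "h ` D = D'"
      using linear_bij_subspace_transitive[of D D' H] D H by (auto simp: between_iff)
    have "h \<circ> g \<in> {g\<in>G. g ` S = D'}" if "g \<in> {g\<in>G. g ` S = D}" for g
      unfolding G_def mem_Collect_eq image_comp[symmetric]
      using that h unfolding G_def by (auto intro: Vector_Spaces.linear_compose bij_comp)
    hence "(\<lambda>g. h \<circ> g) ` {g\<in>G. g ` S = D} \<subseteq> {g\<in>G. g ` S = D'}" by blast
    moreover have "inj_on (\<lambda>g. h \<circ> g) {g\<in>G. g ` S = D}"
      using h(2) by (auto simp: inj_on_def fun_eq_iff bij_def)
    ultimately show ?thesis unfolding N_def using finG by (intro card_inj_on_le) auto
  qed
  hence N_eq: "N S D = N S D'" if "D \<in> between {0} i H" "D' \<in> between {0} i H" for S D D'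
    using that by (intro antisym) auto
  obtain D0 where D0: "D0 \<in> between {0} i H" using \<S> by (metis card.empty add_is_0 one_neq_zero equals0I subsetD)
  have cB: "real (card (between {0} i H)) = gb (2 * i) i"
    using card_between[of "{0}" H i] H by (simp add: subspace_0)
  have GN: "real (card G) = gb (2 * i) i * real (N S D0)" if "S \<in> \<S>" for S
  proof -
    have "G = {g\<in>G. g ` S \<in> between {0} i H}" using img that \<S>(1) by blast
    hence "card G = card {g\<in>G. g ` S \<in> between {0} i H}" by (rule arg_cong)
    also have "\<dots> = (\<Sum>D\<in>between {0} i H. N S D)"
      unfolding N_def by (intro card_vimage_eq_sum_fibres finG finite_vecs)
    also have "\<dots> = (\<Sum>D\<in>between {0} i H. N S D0)" using D0 by (intro sum.cong refl N_eq)
    finally show ?thesis using cB by simp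
  qed
  have cnt: "gb (2 * i) i * real (\<Sum>g\<in>G. card {S\<in>\<S>. g ` S \<in> T}) = real (card \<S>) * real (card T) * real (card G)"
    if T: "T \<subseteq> between {0} i H" for T
  proof -
    have "(\<Sum>g\<in>G. card {S\<in>\<S>. g ` S \<in> T}) = (\<Sum>S\<in>\<S>. card {g\<in>G. g ` S \<in> T})"
      by (rule sum_card_swap) (use finG in auto)
    also have "\<dots> = (\<Sum>S\<in>\<S>. card T * N S D0)"
    proof (intro sum.cong refl)
      fix S
      have "card {g\<in>G. g ` S \<in> T} = (\<Sum>D\<in>T. N S D)"
        unfolding N_def by (intro card_vimage_eq_sum_fibres finG finite_vecs)
      also have "\<dots> = (\<Sum>D\<in>T. N S D0)" using T D0 by (intro sum.cong refl N_eq) auto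
      finally show "card {g\<in>G. g ` S \<in> T} = card T * N S D0" by simp
    qed
    finally have "gb (2 * i) i * real (\<Sum>g\<in>G. card {S\<in>\<S>. g ` S \<in> T}) =
        (\<Sum>S\<in>\<S>. real (card T) * (gb (2 * i) i * real (N S D0)))"
      by (simp add: sum_distrib_left mult_ac)
    also have "\<dots> = (\<Sum>S\<in>\<S>. real (card T) * real (card G))" by (intro sum.cong) (auto simp: GN)
    finally show ?thesis by simp
  qed
  \<comment> \<open>The elements of a translated spread are pairwise disjoint, so one of them in the
    first family excludes all others from both families; otherwise at most all
    \<open>q ^ i + 1\<close> lie in the second one.\<close>
  have le: "card {S\<in>\<S>. g ` S \<in> \<P>} + card \<S> * card {S\<in>\<S>. g ` S \<in> \<L>} \<le> card \<S>" if g: "g \<in> G" for g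
  proof (cases "{S\<in>\<S>. g ` S \<in> \<L>} = {}")
    case True
    have "card {S\<in>\<S>. g ` S \<in> \<P>} \<le> card \<S>" by (intro card_mono) auto
    thus ?thesis unfolding True by simp
  next
    case False
    then obtain S where S: "S \<in> \<S>" "g ` S \<in> \<L>" by blast
    have other: "T = S" if T: "T \<in> \<S>" "g ` T \<in> \<L> \<union> \<P>" for T
    proof (rule ccontr)
      assume "T \<noteq> S"
      hence "S \<inter> T = {0}" using S T \<S>(3) by blast
      moreover have inj: "inj g" using g by (simp add: G_def bij_def)
      moreover interpret g: Vector_Spaces.linear scale scale g using g by (simp add: G_def)
      have "g 0 = 0" by (rule g.zero)
      ultimately have "g ` S \<inter> g ` T = {0}" by (simp add: image_Int[symmetric])
      moreover have "g ` S \<noteq> g ` T" using inj \<open>T \<noteq> S\<close> by (simp add: inj_image_eq_iff)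
      ultimately show False using meet[OF S(2) T(2)] by simp
    qed
    have "{S\<in>\<S>. g ` S \<in> \<L>} = {S}" using S other by blast
    moreover have "{S\<in>\<S>. g ` S \<in> \<P>} = {}" using S other sub(3) by blast
    ultimately show ?thesis by simp
  qed
  have "(\<Sum>g\<in>G. card {S\<in>\<S>. g ` S \<in> \<P>} + card \<S> * card {S\<in>\<S>. g ` S \<in> \<L>}) \<le> (\<Sum>g\<in>G. card \<S>)"
    by (intro sum_mono le)
  hence "real (\<Sum>g\<in>G. card {S\<in>\<S>. g ` S \<in> \<P>}) + real (card \<S>) * real (\<Sum>g\<in>G. card {S\<in>\<S>. g ` S \<in> \<L>})
      \<le> real (card G) * real (card \<S>)"
    by (simp only: sum.distrib sum_distrib_left[symmetric] sum_constant of_nat_le_iff of_nat_id flip: of_nat_mult of_nat_add)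
  hence "gb (2 * i) i * (real (\<Sum>g\<in>G. card {S\<in>\<S>. g ` S \<in> \<P>}) + real (card \<S>) * real (\<Sum>g\<in>G. card {S\<in>\<S>. g ` S \<in> \<L>}))
      \<le> gb (2 * i) i * (real (card G) * real (card \<S>))"
    by (rule mult_left_mono) simp
  hence "real (card \<S>) * real (card \<P>) * real (card G) + real (card \<S>) * (real (card \<S>) * real (card \<L>) * real (card G))
      \<le> gb (2 * i) i * (real (card G) * real (card \<S>))"
    by (simp only: distrib_left mult.left_commute[of "gb (2 * i) i" "real (card \<S>)"] cnt[OF sub(1)] cnt[OF sub(2)])
  hence le': "(real (card G) * real (card \<S>)) * (real (card \<P>) + real (card \<S>) * real (card \<L>)) \<le>
      (real (card G) * real (card \<S>)) * gb (2 * i) i"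
    by (simp add: algebra_simps)
  have "id \<in> G" by (simp add: G_def linear_id)
  hence "0 < card G" using finG card_gt_0_iff by blast
  moreover have "0 < card \<S>" using \<S>(2) by linarith
  ultimately have "0 < real (card G) * real (card \<S>)" by simp
  hence "real (card \<P>) + real (card \<S>) * real (card \<L>) \<le> gb (2 * i) i"
    using le' by (simp only: mult_le_cancel_left_pos)
  moreover have "real (card \<S>) = q ^ i + 1" using \<S>(2) by (simp add: q_def)
  ultimately show ?thesis by simp
qed

section \<open>Families that are intersecting modulo a subspace\<close>

text \<open>The number c(j) of the overview. The value 0 for j > k keeps \<open>above_Suc\<close>
  and \<open>card_above\<close> valid without side conditions on j.\<close>

definition above :: "nat \<Rightarrow> nat \<Rightarrow> real" where
  "above k j = (if j \<le> k then gb (dim UNIV - j) (k - j) else 0)"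

lemma card_above: "subspace S \<Longrightarrow> real (card (between S k UNIV)) = above k (dim S)"
proof (cases "dim S \<le> k")
  case False
  hence "between S k UNIV = {}" using dim_subset by (fastforce simp: between_iff)
  thus ?thesis using False by (simp add: above_def)
qed (simp add: above_def card_between)

lemma above_nonneg [simp]: "0 \<le> above k j"
  by (simp add: above_def)

lemma above_pos: "j \<le> k \<Longrightarrow> k \<le> dim UNIV \<Longrightarrow> 0 < above k j"
  by (simp add: above_def gb_pos)

lemma above_Suc: "above k j * br (k - j) = br (dim UNIV - j) * above k (Suc j)"
proof (cases "j < k")
  case True
  then obtain t where "k - j = Suc t" by (metis Suc_diff_Suc)
  thus ?thesis using True gb_Suc[of "dim UNIV - j" t] by (auto simp: above_def Suc_diff_Suc dest: arg_cong[where f = "\<lambda>m. m - 1"])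
qed (auto simp: above_def)

lemma subset_betweenD:
  assumes "J \<subseteq> between S k A" "B \<in> J"
  shows "subspace B" "S \<subseteq> B" "B \<subseteq> A" "dim B = k"
  using assms unfolding between_def by blast+

lemma ex_pts_Int:
  assumes "subspace B" "subspace C" "subspace D" "D \<subseteq> B" "D \<subseteq> C" "B \<inter> C \<noteq> D"
  obtains E where "E \<in> pts D UNIV" "E \<subseteq> B" "E \<subseteq> C"
  using ex_pts[of D "B \<inter> C"] assms subspace_inter[of B C] by (auto simp: pts_iff)

lemma card_UN_le:
  assumes "\<And>x. x \<in> A \<Longrightarrow> real (card (f x)) \<le> c" "finite A" "real (card A) \<le> a" "0 \<le> c" "S \<subseteq> (\<Union>x\<in>A. f x)" "finite (\<Union>x\<in>A. f x)"
  shows "real (card S) \<le> a * c"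
proof -
  have "card S \<le> card (\<Union>x\<in>A. f x)" using assms(5,6) by (rule card_mono[rotated])
  also have "\<dots> \<le> (\<Sum>x\<in>A. card (f x))" using assms(2) by (rule card_UN_le)
  finally have "real (card S) \<le> (\<Sum>x\<in>A. real (card (f x)))" by (metis of_nat_le_iff of_nat_sum)
  also have "\<dots> \<le> (\<Sum>x\<in>A. c)" using assms(1) by (rule sum_mono)
  also have "\<dots> \<le> a * c" using assms(3,4) by (simp add: mult_right_mono)
  finally show ?thesis .
qed

text \<open>Each member of J contains a point E of C modulo D. As S meets C only in D, the join
  \<open>S + E\<close> is one dimension larger than S, and there are few such joins.\<close>

lemma card_meeting_le:
  assumes "subspace S" "subspace C" "S \<inter> C = D" "J \<subseteq> between S k UNIV" "\<And>B. B \<in> J \<Longrightarrow> B \<inter> C \<noteq> D"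
  shows "real (card J) \<le> br (dim C - dim D) * above k (Suc (dim S))"
proof (rule card_UN_le)
  have D: "subspace D" "D \<subseteq> C" "D \<subseteq> S" using assms(1-3) subspace_inter by auto
  let ?P = "pts D C"
  show "real (card ?P) \<le> br (dim C - dim D)" using D assms by (simp add: card_pts)
  show "real (card (between (S + E) k UNIV)) \<le> above k (Suc (dim S))" if "E \<in> ?P" for E
  proof -
    have "\<not> E \<subseteq> S"
    proof
      assume "E \<subseteq> S"
      hence "E \<subseteq> D" using that assms(3) by (auto simp: pts_iff)
      hence "dim E \<le> dim D" by (rule dim_subset)
      thus False using that by (simp add: pts_iff)
    qed
    hence "S + E \<in> pts S UNIV" using that D assms by (intro plus_pts[of D]) (auto simp: pts_iff)
    thus ?thesis by (simp add: pts_iff card_above)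
  qed
  show "J \<subseteq> (\<Union>E\<in>?P. between (S + E) k UNIV)"
  proof
    fix B assume B: "B \<in> J"
    hence "B \<in> between S k UNIV" using assms(4) by blast
    hence Bs: "subspace B" "S \<subseteq> B" "dim B = k" by (simp_all add: between_iff)
    obtain E where E: "E \<in> pts D UNIV" "E \<subseteq> B" "E \<subseteq> C"
      using ex_pts_Int[of B C D] Bs D assms(2,5) B by blast
    hence "B \<in> between (S + E) k UNIV" using Bs by (simp add: between_iff plus_subsetI)
    moreover have "E \<in> ?P" using E by (simp add: pts_iff)
    ultimately show "B \<in> (\<Union>E\<in>?P. between (S + E) k UNIV)" by blast
  qed
qed auto

lemma br_pow: "q ^ n = (q - 1) * br n + 1"
  using br_mult[of n] by (simp add: algebra_simps)

text \<open>Multiplying by (q - 1)^3, which is at least q - 1, turns every bracket into a power of q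
  minus 1; the exponents add up to m + m + (m - 1) = 3m - 1.\<close>

lemma br_square_mult_less:
  assumes "2 \<le> m" "3 * m - 1 \<le> l" shows "br m ^ 2 * br (m - 1) < br l"
proof -
  define a b where "a = q ^ m" and "b = q ^ (m - 1)"
  have ab: "2 \<le> a" "2 \<le> b"
    using q_ge2 assms self_le_power[of q m] self_le_power[of q "m - 1"] by (auto simp: a_def b_def)
  have "br m ^ 2 * br (m - 1) * (q - 1) \<le> br m ^ 2 * br (m - 1) * (q - 1) ^ 3"
    using q_ge2 self_le_power[of "q - 1" 3] by (intro mult_left_mono) auto
  also have "\<dots> = (br m * (q - 1)) ^ 2 * (br (m - 1) * (q - 1))"
    by (simp add: power2_eq_square power3_eq_cube)
  also have "\<dots> = (a - 1) ^ 2 * (b - 1)" by (simp add: br_mult a_def b_def)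
  also have "\<dots> = a ^ 2 * b - 1 - (a * (a - 2) + b * (2 * a - 1))"
    by (simp add: power2_eq_square algebra_simps)
  also have "\<dots> < a ^ 2 * b - 1"
  proof -
    have "0 \<le> a * (a - 2)" "0 < b * (2 * a - 1)" using ab by auto
    thus ?thesis by linarith
  qed
  also have "a ^ 2 * b = q ^ (3 * m - 1)"
    using assms by (simp add: a_def b_def flip: power_mult power_add)
  also have "q ^ (3 * m - 1) - 1 = br (3 * m - 1) * (q - 1)" by (simp add: br_mult)
  finally have "br m ^ 2 * br (m - 1) < br (3 * m - 1)" using q_ge2 by simp
  also have "\<dots> \<le> br l" using assms(2) by (rule br_mono)
  finally show ?thesis .
qed

text \<open>An Erdos--Ko--Rado theorem with ample room, modulo \<open>D\<close>: a family without a common point is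
  covered by the lines joining two points of two suitable members.\<close>

lemma intersecting_mod_le:
  assumes D: "subspace D" "dim D < k" "3 * (k - dim D) + dim D \<le> dim UNIV"
    and J: "J \<subseteq> between D k UNIV" "\<And>A B. A \<in> J \<Longrightarrow> B \<in> J \<Longrightarrow> A \<noteq> B \<Longrightarrow> A \<inter> B \<noteq> D"
  shows "real (card J) \<le> above k (Suc (dim D))"
    and "real (card J) = above k (Suc (dim D)) \<Longrightarrow> \<exists>E\<in>pts D UNIV. between E k UNIV = J"
proof -
  let ?m = "k - dim D"
  have neD: "B \<noteq> D" if "B \<in> J" for B using that J(1) D by (auto simp: between_iff)
  have J2: "A \<inter> B \<noteq> D" if "A \<in> J" "B \<in> J" for A B using that J(2) neD by (cases "A = B") auto
  have "real (card J) < above k (Suc (dim D)) \<or> (\<exists>E\<in>pts D UNIV. \<forall>B\<in>J. E \<subseteq> B)"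
  proof (rule disjCI)
    assume no: "\<not> (\<exists>E\<in>pts D UNIV. \<forall>B\<in>J. E \<subseteq> B)"
    have "D \<noteq> UNIV" using D by auto
    then obtain E0 where E0: "E0 \<in> pts D UNIV" using ex_pts[of D UNIV] D by auto
    then obtain A where A: "A \<in> J" using no by blast
    note As = subset_betweenD[OF J(1) this]
    have m2: "2 \<le> ?m"
    proof (rule ccontr)
      assume "\<not> 2 \<le> ?m"
      hence k: "k = Suc (dim D)" using D by linarith
      hence "A \<in> pts D UNIV" using As by (simp add: pts_iff)
      then obtain B where B: "B \<in> J" "\<not> A \<subseteq> B" using no by blast
      hence "B \<in> pts D UNIV" using subset_betweenD[OF J(1) B(1)] k by (simp add: pts_iff)
      hence "A \<inter> B = D" using B \<open>A \<in> pts D UNIV\<close> D by (intro pts_Int[of _ _ UNIV _ UNIV]) auto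
      thus False using J2 A B by blast
    qed
    have "real (card J) \<le> br ?m * (br ?m * above k (Suc (Suc (dim D))))"
    proof (rule card_UN_le)
      let ?P = "pts D A"
      show "real (card ?P) \<le> br ?m" using As D by (simp add: card_pts)
      show "real (card {B\<in>J. E \<subseteq> B}) \<le> br ?m * above k (Suc (Suc (dim D)))" if "E \<in> ?P" for E
      proof -
        have E: "subspace E" "D \<subseteq> E" "dim E = Suc (dim D)" "E \<in> pts D UNIV" using that by (auto simp: pts_iff)
        then obtain C where C: "C \<in> J" "\<not> E \<subseteq> C" using no by blast
        note Cs = subset_betweenD[OF J(1) C(1)]
        have "C \<inter> E = D" using E Cs C D by (intro subspace_between_Int)
        hence "real (card {B\<in>J. E \<subseteq> B}) \<le> br (dim C - dim D) * above k (Suc (dim E))"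
          using J C J2 E Cs by (intro card_meeting_le) (auto simp: between_iff)
        thus ?thesis using E Cs by simp
      qed
      show "J \<subseteq> (\<Union>E\<in>?P. {B\<in>J. E \<subseteq> B})"
      proof
        fix B assume B: "B \<in> J"
        hence "subspace B" "D \<subseteq> B" using subset_betweenD[OF J(1)] by auto
        then obtain E where "E \<in> pts D UNIV" "E \<subseteq> B" "E \<subseteq> A"
          using ex_pts_Int[of B A D] As D J2[OF B A] by blast
        thus "B \<in> (\<Union>E\<in>?P. {B\<in>J. E \<subseteq> B})" using B by (auto simp: pts_iff)
      qed
    qed auto
    \<comment> \<open>These two consecutive values of \<open>above\<close> have the ratio
      \<open>br (dim UNIV - Suc (dim D)) / br (m - 1)\<close> with \<open>m = k - dim D\<close>,
      which the assumed room makes larger than \<open>br m ^ 2\<close>.\<close>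
    also have "\<dots> < above k (Suc (dim D))"
    proof -
      let ?c = "above k (Suc (Suc (dim D)))"
      have c: "0 < ?c" using m2 D by (intro above_pos) auto
      have "br ?m * (br ?m * ?c) * br (?m - 1) = (br ?m ^ 2 * br (?m - 1)) * ?c"
        by (simp add: power2_eq_square)
      also have "\<dots> < br (dim UNIV - Suc (dim D)) * ?c"
        using c m2 D by (intro mult_strict_right_mono br_square_mult_less) auto
      also have "\<dots> = above k (Suc (dim D)) * br (?m - 1)" using above_Suc[of k "Suc (dim D)"] by simp
      finally show ?thesis using m2 by (simp add: mult_less_cancel_right_pos)
    qed
    finally show "real (card J) < above k (Suc (dim D))" .
  qed
  moreover have "J \<subseteq> between E k UNIV" "real (card (between E k UNIV)) = above k (Suc (dim D))"
    if "E \<in> pts D UNIV" "\<forall>B\<in>J. E \<subseteq> B" for E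
    using that J(1) by (auto simp: between_iff pts_iff card_above)
  ultimately show "real (card J) \<le> above k (Suc (dim D))"
    "real (card J) = above k (Suc (dim D)) \<Longrightarrow> \<exists>E\<in>pts D UNIV. between E k UNIV = J"
    by (metis card_mono finite_vecs of_nat_le_iff less_imp_le,
        metis card_subset_eq finite_vecs of_nat_eq_iff less_irrefl)
qed

section \<open>Unsafe subspaces of a member\<close>

lemma card_hyperplanes_between:
  assumes "subspace S" "subspace B" "S \<subseteq> B" "dim B = Suc m"
  shows "real (card (between S m B)) = br (dim B - dim S)"
proof (cases "dim S \<le> m")
  case True
  hence "dim B - dim S = Suc (m - dim S)" using assms by simp
  thus ?thesis using True assms by (simp add: card_between gb_pred)
next
  case False
  hence "dim S = dim B" using dim_subset[OF assms(3)] assms(4) by linarith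
  moreover have "between S m B = {}" using False dim_subset by (fastforce simp: between_iff)
  ultimately show ?thesis by simp
qed

lemma gb_compl: "gb m j * br (m - j) = br m * gb (m - 1) j"
proof -
  have "(\<Prod>t<j. br (m - t)) * br (m - j) = (\<Prod>t<Suc j. br (m - t))" by simp
  also have "\<dots> = br m * (\<Prod>t<j. br (m - 1 - t))" by (subst prod.lessThan_Suc_shift) simp
  finally show ?thesis by (simp add: gb_def prod_dividef)
qed

text \<open>Since \<open>br (2 * i) = (q ^ i + 1) * br i\<close>, the share of the i-spaces of a
  2i-space that pass through a fixed point is one over the size of a spread.\<close>

lemma gb_double: "0 < i \<Longrightarrow> gb (2 * i) i = (q ^ i + 1) * gb (2 * i - 1) (i - 1)"
proof -
  assume i: "0 < i"
  have "gb (2 * i) i * br i = br (i + i) * gb (2 * i - 1) (i - 1)"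
    using gb_Suc[of "2 * i" "i - 1"] i by (simp add: mult_2)
  also have "\<dots> = ((q ^ i + 1) * gb (2 * i - 1) (i - 1)) * br i"
    by (simp add: br_add algebra_simps)
  finally show ?thesis using i by simp
qed

end

locale covering_triple_free_family = finite_vector_space scale
  for scale :: "'a::{field,finite} \<Rightarrow> 'b::ab_group_add \<Rightarrow> 'b" +
  fixes \<F> :: "'b set set" and k :: nat
  assumes family: "\<F> \<subseteq> between {0} k UNIV"
    and covering_triple_free: "covering_triple_free scale k \<F>"
    and k_ge_2: "2 \<le> k"
    and dim_ge: "2 * k \<le> dim UNIV"
begin

lemmas familyD = subset_betweenD[OF family]

lemma no_covering_triple:
  assumes "A \<in> \<F>" "B \<in> \<F>" "C \<in> \<F>" "A \<noteq> B" "A \<noteq> C" "B \<noteq> C" "A \<inter> B \<inter> C = {0}"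
    and "dim (A \<inter> B) + dim (A \<inter> C) = k"
  shows False
proof -
  note s = familyD[OF assms(1)] familyD[OF assms(2)] familyD[OF assms(3)]
  have sub: "subspace (A \<inter> B)" "subspace (A \<inter> C)" using s subspace_inter by auto
  have "(A \<inter> B) \<inter> (A \<inter> C) = {0}" using assms(7) by blast
  hence "dim ((A \<inter> B) + (A \<inter> C)) = k" using dim_plus[OF sub] assms(8) by simp
  hence "(A \<inter> B) + (A \<inter> C) = A"
    using s sub by (intro subspace_eqI subspace_plus plus_subsetI) auto
  hence "covering_triple scale k A B C"
    using assms s unfolding covering_triple_def k_subspaces_def by simp
  thus False using covering_triple_free assms unfolding covering_triple_free_def by blast
qed

text \<open>C may be B itself, which affects only D = B.\<close>

definition safe :: "'b set \<Rightarrow> 'b set \<Rightarrow> bool" where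
  "safe D B \<longleftrightarrow> (\<forall>C\<in>\<F>. B \<inter> C \<noteq> D)"

text \<open>If D and E were disjoint, the members C and C' witnessing that they are unsafe would
  form a covering triple with B. The positive dimensions keep C and C' different from B and from
  each other.\<close>

lemma unsafe_Int_nonzero:
  assumes "B \<in> \<F>" "\<not> safe D B" "\<not> safe E B" "dim D + dim E = k" "0 < dim D" "0 < dim E"
  shows "D \<inter> E \<noteq> {0}"
proof
  assume DE: "D \<inter> E = {0}"
  obtain C C' where C: "C \<in> \<F>" "B \<inter> C = D" "C' \<in> \<F>" "B \<inter> C' = E"
    using assms unfolding safe_def by blast
  have "dim D < k" "dim E < k" using assms(4-6) by auto
  hence "D \<noteq> B" "E \<noteq> B" using familyD(4)[OF assms(1)] by auto
  hence "B \<noteq> C" "B \<noteq> C'" using C by blast+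
  moreover have "C \<noteq> C'"
  proof
    assume "C = C'"
    hence "D = E" using C by metis
    thus False using DE assms(5) by simp
  qed
  moreover have "B \<inter> C \<inter> C' = {0}" using C DE by blast
  ultimately show False using no_covering_triple[of B C C'] C assms(1,4) by simp
qed

text \<open>The unsafe i-spaces of B meet pairwise, so \<open>disjointness_weight_le\<close> with an
  empty second family bounds their number by that of the i-spaces through a point.\<close>

lemma card_safe_ge:
  assumes "B \<in> \<F>" "k = 2 * i"
  shows "gb k i - gb (k - 1) (i - 1) \<le> real (card {D\<in>between {0} i B. safe D B})"
proof -
  note B = familyD[OF assms(1)]
  let ?U = "{D\<in>between {0} i B. \<not> safe D B}"
  have i: "0 < i" using k_ge_2 assms by simp
  have "real (card ({} :: 'b set set)) + (q ^ i + 1) * real (card ?U) \<le> gb (2 * i) i"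
    by (rule disjointness_weight_le[OF i, of B])
       (use B assms i unsafe_Int_nonzero[OF assms(1)] in \<open>auto simp: between_iff\<close>)
  hence "(q ^ i + 1) * real (card ?U) \<le> (q ^ i + 1) * gb (k - 1) (i - 1)"
    using gb_double[OF i] assms by simp
  moreover have "0 < q ^ i + 1" using q_ge2 by (intro add_nonneg_pos) auto
  ultimately have "real (card ?U) \<le> gb (k - 1) (i - 1)" by simp
  moreover have "real (card (between {0} i B)) = gb k i"
    using B i assms card_between[of "{0}" B i] by (simp add: subspace_0)
  moreover have "card {D\<in>between {0} i B. safe D B} + card ?U = card (between {0} i B)"
    by (subst card_Un_disjoint[symmetric]) (auto intro: arg_cong[where f = card])
  ultimately show ?thesis by linarith
qed

section \<open>Weights for odd k\<close>

definition unsafe_span :: "'b set \<Rightarrow> 'b set \<Rightarrow> 'b set" where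
  "unsafe_span D B = span (D \<union> \<Union>{E\<in>pts D B. \<not> safe E B})"

definition unsafe_rank :: "'b set \<Rightarrow> 'b set \<Rightarrow> nat" where
  "unsafe_rank D B = dim (unsafe_span D B) - dim D"

text \<open>Multiplied by \<open>br m - 1\<close>, the weight is \<open>br m\<close> minus a loss: 0
  at rank 0, 1 for a safe D of positive rank, and for an unsafe D the number of hyperplanes of B
  that contain D but not its unsafe span. At rank 0 the weight slightly exceeds 1.\<close>

definition weight :: "'b set \<Rightarrow> 'b set \<Rightarrow> real" where
  "weight D B = (let m = k - dim D; r = unsafe_rank D B in
     if r = 0 then br m / (br m - 1) else if safe D B then 1 else br (m - r) / (br m - 1))"

lemma unsafe_span:
  assumes "subspace B" "D \<subseteq> B"
  shows "subspace (unsafe_span D B)" "D \<subseteq> unsafe_span D B" "unsafe_span D B \<subseteq> B"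
proof -
  show "subspace (unsafe_span D B)" by (simp add: unsafe_span_def)
  show "D \<subseteq> unsafe_span D B" unfolding unsafe_span_def using span_superset by blast
  have "\<Union>{E\<in>pts D B. \<not> safe E B} \<subseteq> B" unfolding pts_def between_def by blast
  thus "unsafe_span D B \<subseteq> B" using assms unfolding unsafe_span_def by (intro span_minimal) auto
qed

lemma unsafe_subset_span: "E \<in> pts D B \<Longrightarrow> \<not> safe E B \<Longrightarrow> E \<subseteq> unsafe_span D B"
  unfolding unsafe_span_def by (auto intro: span_base)

lemma unsafe_span_subset_iff:
  assumes "subspace S" "D \<subseteq> S"
  shows "unsafe_span D B \<subseteq> S \<longleftrightarrow> (\<forall>E\<in>pts D B. \<not> safe E B \<longrightarrow> E \<subseteq> S)"
proof
  assume *: "\<forall>E\<in>pts D B. \<not> safe E B \<longrightarrow> E \<subseteq> S"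
  show "unsafe_span D B \<subseteq> S"
    unfolding unsafe_span_def using * assms by (intro span_minimal) auto
qed (use unsafe_subset_span in blast)

lemma unsafe_rank_eq_0:
  assumes "subspace B" "subspace D" "D \<subseteq> B" "unsafe_rank D B = 0" "E \<in> pts D B"
  shows "safe E B"
proof (rule ccontr)
  assume "\<not> safe E B"
  hence "dim E \<le> dim (unsafe_span D B)" using unsafe_subset_span[OF assms(5)] by (intro dim_subset)
  thus False using assms(4,5) by (simp add: unsafe_rank_def pts_iff)
qed

lemma dim_unsafe_span:
  assumes "subspace B" "D \<subseteq> B"
  shows "dim (unsafe_span D B) = dim D + unsafe_rank D B" "unsafe_rank D B \<le> dim B - dim D"
  using dim_subset[OF unsafe_span(2)[OF assms]] dim_subset[OF unsafe_span(3)[OF assms]]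
  by (simp_all add: unsafe_rank_def)

lemma card_hyperplanes_not_ge_unsafe_span:
  assumes "subspace B" "subspace D" "D \<subseteq> B" "dim B = Suc m"
  shows "real (card {H\<in>between {0} m B. D \<subseteq> H \<and> \<not> unsafe_span D B \<subseteq> H}) =
    br (dim B - dim D) - br (dim B - dim D - unsafe_rank D B)"
proof -
  let ?R = "unsafe_span D B"
  note R = unsafe_span[OF assms(1,3)]
  have eq: "{H\<in>between {0} m B. D \<subseteq> H \<and> \<not> ?R \<subseteq> H} = between D m B - between ?R m B"
    using subspace_0 by (auto simp: between_iff)
  have "between ?R m B \<subseteq> between D m B" using R unfolding between_def by blast
  hence "card (between D m B - between ?R m B) = card (between D m B) - card (between ?R m B)"
    "card (between ?R m B) \<le> card (between D m B)"
    by (auto intro: card_Diff_subset card_mono)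
  thus ?thesis unfolding eq using R assms dim_unsafe_span[OF assms(1,3)]
    by (simp add: of_nat_diff card_hyperplanes_between)
qed

text \<open>An unsafe D of rank 0 needs no case of its own, since the difference of brackets is then
  0.\<close>

lemma weight_mult:
  assumes "dim D + 1 < k"
  shows "weight D B * (br (k - dim D) - 1) = br (k - dim D) -
    (if safe D B then if unsafe_rank D B = 0 then 0 else 1 else br (k - dim D) - br (k - dim D - unsafe_rank D B))"
proof -
  have "1 \<le> br (k - dim D - 1)" using assms by (intro br_ge1) auto
  moreover have "br (k - dim D) = q * br (k - dim D - 1) + 1"
  proof -
    have "k - dim D = Suc (k - dim D - 1)" using assms by simp
    thus ?thesis by (metis br_Suc)
  qed
  ultimately have "br (k - dim D) - 1 \<noteq> 0" using q_ge2 by auto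
  thus ?thesis by (simp add: weight_def Let_def)
qed

text \<open>An unsafe \<open>D\<close> meets every unsafe point over \<open>D'\<close>; if the latter is not in \<open>H\<close>, then \<open>D\<close> meets \<open>D'\<close>.\<close>

lemma hyperplane_weight_le:
  assumes "B \<in> \<F>" "k = 2 * i + 1" "0 < i" "H \<in> between {0} (2 * i) B"
  shows "real (card {D\<in>between {0} i H. safe D B \<and> \<not> unsafe_span D B \<subseteq> H}) +
    (q ^ i + 1) * real (card {D\<in>between {0} i H. \<not> safe D B \<and> \<not> unsafe_span D B \<subseteq> H}) \<le> gb (2 * i) i"
proof (rule disjointness_weight_le[OF assms(3)])
  have H: "subspace H" "H \<subseteq> B" "dim H = 2 * i" using assms(4) by (auto simp: between_iff)
  show "subspace H" "dim H = 2 * i" by fact+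
  let ?P = "{D\<in>between {0} i H. safe D B \<and> \<not> unsafe_span D B \<subseteq> H}"
  let ?L = "{D\<in>between {0} i H. \<not> safe D B \<and> \<not> unsafe_span D B \<subseteq> H}"
  show "?P \<subseteq> between {0} i H" "?L \<subseteq> between {0} i H" "?L \<inter> ?P = {}" by auto
  fix D D' assume D: "D \<in> ?L" "D' \<in> ?L \<union> ?P"
  have Ds: "subspace D" "dim D = i" "\<not> safe D B" using D(1) by (auto simp: between_iff)
  have D': "subspace D'" "dim D' = i" "D' \<subseteq> H" "\<not> unsafe_span D' B \<subseteq> H"
    using D(2) unfolding between_def by blast+
  then obtain E where E: "E \<in> pts D' B" "\<not> safe E B" "\<not> E \<subseteq> H"
    using unsafe_span_subset_iff[OF H(1) D'(3)] by blast
  hence "H \<inter> E = D'" using H D' by (intro subspace_between_Int) (auto simp: pts_iff)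
  moreover have "D \<inter> E \<noteq> {0}"
    using Ds E D' assms by (intro unsafe_Int_nonzero[OF assms(1)]) (auto simp: pts_iff)
  moreover have "D \<subseteq> H" using D(1) by (simp add: between_iff)
  moreover have "0 \<in> D \<inter> E" using Ds E subspace_0 by (auto simp: pts_iff)
  ultimately show "D \<inter> D' \<noteq> {0}" by blast
qed

text \<open>\<open>hyperplane_weight_le\<close> is summed over all hyperplanes H of B, which counts
  each D \<open>N D\<close> times. Together with the trivial bound \<open>br m\<close> on a single
  loss this controls the total loss \<open>s + LL\<close>.\<close>

lemma sum_weight_ge:
  assumes "B \<in> \<F>" "k = 2 * i + 1" "0 < i"
  shows "gb k i - gb (k - 1) (i - 1) \<le> (\<Sum>D\<in>between {0} i B. weight D B)"
proof -
  note B = familyD[OF assms(1)]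
  define ds where "ds = between {0} i B"
  define hs where "hs = between {0} (2 * i) B"
  define m where "m = i + 1"
  define N where "N = (\<lambda>D. br m - br (m - unsafe_rank D B))"
  define L where "L = (\<lambda>D H. D \<subseteq> H \<and> \<not> unsafe_span D B \<subseteq> H)"
  define g where "g = gb k i"
  define g' where "g' = gb (k - 1) (i - 1)"
  have z: "subspace {0 :: 'b}" "dim {0 :: 'b} = 0" by simp_all
  have dsD: "subspace D" "dim D = i" "D \<subseteq> B" if "D \<in> ds" for D
    using that by (simp_all add: ds_def between_iff)
  have card_ds: "real (card ds) = g"
    using card_between[OF z(1) B(1), of i] B assms by (simp add: ds_def g_def)
  have card_hs: "real (card hs) = br k"
    using card_hyperplanes_between[OF z(1) B(1), of "2 * i"] B assms by (simp add: hs_def)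
  have N_nonneg: "0 \<le> N D" "N D \<le> br m" for D by (auto simp: N_def intro: br_mono)
  have cL: "real (card {H\<in>hs. L D H}) = N D" if "D \<in> ds" for D
    using card_hyperplanes_not_ge_unsafe_span[of B D "2 * i"] dsD[OF that] B assms
    by (simp add: hs_def L_def N_def m_def)
  have swap: "(\<Sum>H\<in>hs. real (card {D\<in>between {0} i H. p D \<and> \<not> unsafe_span D B \<subseteq> H})) =
      (\<Sum>D\<in>{D\<in>ds. p D}. N D)" for p
  proof -
    have "{D\<in>between {0} i H. p D \<and> \<not> unsafe_span D B \<subseteq> H} = {D\<in>{D\<in>ds. p D}. L D H}"
      if "H \<in> hs" for H
      using that unfolding hs_def ds_def L_def between_def by blast
    hence "(\<Sum>H\<in>hs. card {D\<in>between {0} i H. p D \<and> \<not> unsafe_span D B \<subseteq> H}) =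
        (\<Sum>H\<in>hs. card {D\<in>{D\<in>ds. p D}. L D H})" by (intro sum.cong) auto
    also have "\<dots> = (\<Sum>D\<in>{D\<in>ds. p D}. card {H\<in>hs. L D H})"
      by (rule sum_card_swap) auto
    finally have "(\<Sum>H\<in>hs. real (card {D\<in>between {0} i H. p D \<and> \<not> unsafe_span D B \<subseteq> H})) =
        (\<Sum>D\<in>{D\<in>ds. p D}. real (card {H\<in>hs. L D H}))" by (simp flip: of_nat_sum)
    also have "\<dots> = (\<Sum>D\<in>{D\<in>ds. p D}. N D)" by (intro sum.cong refl cL) auto
    finally show ?thesis .
  qed
  define LL where "LL = (\<Sum>D\<in>{D\<in>ds. \<not> safe D B}. N D)"
  define s where "s = real (card {D\<in>ds. safe D B \<and> unsafe_rank D B \<noteq> 0})"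
  have "(\<Sum>H\<in>hs. real (card {D\<in>between {0} i H. safe D B \<and> \<not> unsafe_span D B \<subseteq> H}) +
    (q ^ i + 1) * real (card {D\<in>between {0} i H. \<not> safe D B \<and> \<not> unsafe_span D B \<subseteq> H})) \<le> (\<Sum>H\<in>hs. gb (2 * i) i)"
    unfolding hs_def by (intro sum_mono hyperplane_weight_le assms)
  hence 1: "(\<Sum>D\<in>{D\<in>ds. safe D B}. N D) + (q ^ i + 1) * LL \<le> br k * gb (2 * i) i"
    unfolding sum.distrib sum_distrib_left[symmetric] swap LL_def using card_hs by simp
  have 2: "q ^ i * s \<le> (\<Sum>D\<in>{D\<in>ds. safe D B}. N D)"
  proof -
    have "(\<Sum>D\<in>{D\<in>ds. safe D B \<and> unsafe_rank D B \<noteq> 0}. q ^ i) \<le> (\<Sum>D\<in>{D\<in>ds. safe D B \<and> unsafe_rank D B \<noteq> 0}. N D)"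
    proof (intro sum_mono)
      fix D assume "D \<in> {D\<in>ds. safe D B \<and> unsafe_rank D B \<noteq> 0}"
      hence "br (m - unsafe_rank D B) \<le> br i" by (intro br_mono) (auto simp: m_def)
      thus "q ^ i \<le> N D" by (simp add: N_def m_def br_Suc')
    qed
    also have "\<dots> \<le> (\<Sum>D\<in>{D\<in>ds. safe D B}. N D)"
      by (rule sum_mono2) (use N_nonneg in auto)
    finally show ?thesis by (simp add: s_def mult.commute)
  qed
  have sum_if: "(\<Sum>D\<in>ds. if safe D B then if unsafe_rank D B = 0 then 0 else c else N D) = c * s + LL" for c
  proof -
    have "(\<Sum>D\<in>ds. if safe D B then if unsafe_rank D B = 0 then 0 else c else N D) =
      (\<Sum>D\<in>{D\<in>ds. safe D B}. if unsafe_rank D B = 0 then 0 else c) + LL"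
      unfolding LL_def by (subst sum.If_cases) (auto simp: Int_def conj_commute)
    also have "(\<Sum>D\<in>{D\<in>ds. safe D B}. if unsafe_rank D B = 0 then 0 else c) =
        (\<Sum>D\<in>{D\<in>ds. safe D B \<and> unsafe_rank D B \<noteq> 0}. c)"
      by (rule sum.mono_neutral_cong_right) auto
    finally show ?thesis by (simp add: s_def)
  qed
  have 3: "br m * s + LL \<le> br m * g"
  proof -
    have "br m * s + LL \<le> (\<Sum>D\<in>ds. br m)"
      unfolding sum_if[symmetric] by (intro sum_mono) (use N_nonneg in auto)
    thus ?thesis using card_ds by (simp add: mult.commute)
  qed
  have 4: "(br m - 1) * (\<Sum>D\<in>ds. weight D B) = br m * g - (s + LL)"
  proof -
    have "(br m - 1) * (\<Sum>D\<in>ds. weight D B) =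
        (\<Sum>D\<in>ds. br m - (if safe D B then if unsafe_rank D B = 0 then 0 else 1 else N D))"
      unfolding sum_distrib_left
    proof (intro sum.cong refl)
      fix D assume "D \<in> ds"
      hence "k - dim D = m" "dim D + 1 < k" using dsD assms by (auto simp: m_def)
      thus "(br m - 1) * weight D B = br m - (if safe D B then if unsafe_rank D B = 0 then 0 else 1 else N D)"
        using weight_mult[of D B] by (simp only: N_def mult.commute)
    qed
    also have "\<dots> = br m * g - (s + LL)"
      using sum_if[of 1] card_ds by (simp add: sum_subtractf mult.commute)
    finally show ?thesis .
  qed
  define b where "b = br i"
  have m: "br m = q * b + 1" by (simp add: m_def b_def br_Suc)
  have u: "q ^ i = (q - 1) * b + 1" by (simp add: b_def br_pow)
  have K: "br k = q * q ^ i * b + q * b + 1"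
    using br_add[of "i + 1" i] m assms by (simp add: b_def m_def mult_2)
  have gb1: "br k * gb (2 * i) i = br m * g"
    using gb_compl[of k i] assms by (simp add: g_def m_def mult.commute)
  have gb2: "g * b = br k * g'"
    using gb_Suc[of k "i - 1"] assms by (simp add: g_def g'_def b_def)
  have q0: "0 < q" "0 < b" using q_ge2 assms by (auto simp: b_def)
  have A: "q ^ i * s + (q ^ i + 1) * LL \<le> br m * g" using 1 2 gb1 by simp
  \<comment> \<open>The multipliers \<open>q * b\<close> for \<open>A\<close> and 1 for
    \<open>3\<close> are the ones for which \<open>s\<close> and \<open>LL\<close> both receive the
    coefficient \<open>br k\<close>.\<close>
  have "br k * (s + LL) = q * b * (q ^ i * s + (q ^ i + 1) * LL) + (br m * s + LL)"
    unfolding K m by (simp add: algebra_simps)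
  also have "\<dots> \<le> q * b * (br m * g) + br m * g"
    using A 3 q0 by (intro add_mono mult_left_mono) auto
  also have "\<dots> = (br k + q * b * b) * g" unfolding K m u by (simp add: algebra_simps)
  also have "\<dots> = br k * (g + q * b * g')" using gb2 by (simp add: algebra_simps)
  finally have "s + LL \<le> g + q * b * g'" using assms by simp
  hence "q * b * (g - g') \<le> br m * g - (s + LL)"
    unfolding m by (simp add: algebra_simps)
  hence "q * b * (g - g') \<le> (br m - 1) * (\<Sum>D\<in>ds. weight D B)"
    by (simp only: 4)
  hence "g - g' \<le> (\<Sum>D\<in>ds. weight D B)" using q0 by (simp add: m)
  thus ?thesis by (simp add: g_def g'_def ds_def)
qed

section \<open>Local bounds\<close>

definition link :: "'b set \<Rightarrow> 'b set set" where
  "link D = {B\<in>\<F>. D \<subseteq> B}"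

definition full :: "'b set \<Rightarrow> bool" where
  "full S \<longleftrightarrow> between S k UNIV \<subseteq> \<F>"

definition num_safe :: "'b set \<Rightarrow> 'b set \<Rightarrow> real" where
  "num_safe D B = real (card {E\<in>pts D B. safe E B})"

text \<open>Up to the factor \<open>br (k - dim D) - 1\<close>, the number of points E of B modulo
  D, other than y, at which B belongs to the intersecting family of
  \<open>sum_lym_weight_le\<close>.\<close>

definition lym_weight :: "'b set \<Rightarrow> 'b set \<Rightarrow> 'b set \<Rightarrow> real" where
  "lym_weight D y B = (if y \<subseteq> B then 1 else num_safe D B / (br (k - dim D) - 1))"

lemma linkD:
  assumes "B \<in> link D" shows "B \<in> \<F>" "subspace B" "D \<subseteq> B" "dim B = k"
  using assms familyD[of B] by (auto simp: link_def)

lemma link_subset: "link D \<subseteq> between D k UNIV"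
  using linkD by (auto simp: between_iff)

lemma br_diff_1: "0 < m \<Longrightarrow> br m - 1 = q * br (m - 1)"
  using br_Suc[of "m - 1"] by simp

lemma card_pts_UNIV: "subspace D \<Longrightarrow> real (card (pts D UNIV)) = br (dim UNIV - dim D)"
  by (simp add: card_pts del: dim_UNIV)

text \<open>For each \<open>E \<noteq> y\<close> the members through \<open>E\<close> that contain \<open>y\<close> or in which \<open>E\<close> is safe are intersecting
  modulo \<open>E\<close>; the claim is the sum of the resulting bounds.\<close>

lemma sum_lym_weight_le:
  assumes D: "subspace D" "Suc (dim D) < k" "3 * (k - Suc (dim D)) + Suc (dim D) \<le> dim UNIV"
    and y: "y \<in> pts D UNIV"
  shows "(\<Sum>B\<in>link D. lym_weight D y B) \<le> above k (Suc (dim D))"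
    and "(\<Sum>B\<in>link D. lym_weight D y B) = above k (Suc (dim D)) \<Longrightarrow> E \<in> pts D UNIV \<Longrightarrow> E \<noteq> y \<Longrightarrow>
      \<exists>L\<in>pts E UNIV. full L"
proof -
  define T where "T = (\<lambda>E. {B\<in>link D. E \<subseteq> B \<and> (y \<subseteq> B \<or> safe E B)})"
  define P where "P = pts D UNIV - {y}"
  let ?m = "k - dim D"
  have ys: "subspace y" "D \<subseteq> y" "dim y = Suc (dim D)" using y by (auto simp: pts_iff)
  have PD: "subspace E" "D \<subseteq> E" "dim E = Suc (dim D)" "E \<noteq> y" if "E \<in> P" for E
    using that by (auto simp: P_def pts_iff)
  have T: "T E \<subseteq> between E k UNIV" for E
    using linkD by (auto simp: T_def between_iff)
  \<comment> \<open>Two members meeting exactly in E are both unsafe at E, so both contain y; then y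
    is contained in E, hence equal to it.\<close>
  have Tint: "A \<inter> B \<noteq> E" if "E \<in> P" "A \<in> T E" "B \<in> T E" "A \<noteq> B" for A B E
  proof
    assume AB: "A \<inter> B = E"
    hence "\<not> safe E A" "\<not> safe E B" using that linkD(1) unfolding safe_def T_def by (blast, metis (no_types, lifting) Int_commute mem_Collect_eq)
    hence "y \<subseteq> E" using that AB unfolding T_def by blast
    hence "y = E" using PD[OF that(1)] ys by (intro subspace_eqI) auto
    thus False using PD[OF that(1)] by simp
  qed
  have room: "dim E < k" "3 * (k - dim E) + dim E \<le> dim UNIV" if "E \<in> P" for E
    using D PD[OF that] by auto
  have Tle: "real (card (T E)) \<le> above k (Suc (Suc (dim D)))" if "E \<in> P" for E
    using intersecting_mod_le(1)[OF PD(1)[OF that] room[OF that] T Tint[OF that]] PD[OF that] by simp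
  have Teq: "\<exists>L\<in>pts E UNIV. between L k UNIV = T E" if "E \<in> P" "real (card (T E)) = above k (Suc (Suc (dim D)))" for E
    using intersecting_mod_le(2)[OF PD(1)[OF that(1)] room[OF that(1)] T Tint[OF that(1)]] PD[OF that(1)] that(2) by simp
  have m1: "0 < br ?m - 1" using br_diff_1[of ?m] D q_ge2 by simp
  have "(\<Sum>E\<in>P. card (T E)) = (\<Sum>B\<in>link D. card {E\<in>P. E \<subseteq> B \<and> (y \<subseteq> B \<or> safe E B)})"
    unfolding T_def by (rule sum_card_swap) auto
  hence "(\<Sum>E\<in>P. real (card (T E))) = (\<Sum>B\<in>link D. real (card {E\<in>P. E \<subseteq> B \<and> (y \<subseteq> B \<or> safe E B)}))"
    by (simp flip: of_nat_sum)
  also have "\<dots> = (\<Sum>B\<in>link D. (br ?m - 1) * lym_weight D y B)"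
  proof (intro sum.cong refl)
    fix B assume "B \<in> link D"
    note B = linkD[OF this]
    show "real (card {E\<in>P. E \<subseteq> B \<and> (y \<subseteq> B \<or> safe E B)}) = (br ?m - 1) * lym_weight D y B"
    proof (cases "y \<subseteq> B")
      case True
      have "{E\<in>P. E \<subseteq> B \<and> (y \<subseteq> B \<or> safe E B)} = pts D B - {y}"
        using True by (auto simp: P_def pts_iff)
      moreover have "y \<in> pts D B" using True ys by (simp add: pts_iff)
      moreover have "real (card (pts D B)) = br ?m" using B D by (simp add: card_pts)
      moreover have "0 < card (pts D B)" using \<open>y \<in> pts D B\<close> card_gt_0_iff by blast
      ultimately show ?thesis using True by (simp add: lym_weight_def card_Diff_singleton of_nat_diff)
    next
      case False
      have "{E\<in>P. E \<subseteq> B \<and> (y \<subseteq> B \<or> safe E B)} = {E\<in>pts D B. safe E B}"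
        using False by (auto simp: P_def pts_iff)
      thus ?thesis using False m1 by (simp add: lym_weight_def num_safe_def)
    qed
  qed
  finally have sumT: "(\<Sum>E\<in>P. real (card (T E))) = (br ?m - 1) * (\<Sum>B\<in>link D. lym_weight D y B)"
    by (simp add: sum_distrib_left)
  have sumA: "(\<Sum>E\<in>P. above k (Suc (Suc (dim D)))) = (br ?m - 1) * above k (Suc (dim D))"
  proof -
    have dn: "dim D < dim UNIV" using D by linarith
    have "0 < card (pts D UNIV)" using y card_gt_0_iff by blast
    hence "real (card P) = br (dim UNIV - dim D) - 1"
      using y D(1) by (simp add: P_def card_Diff_singleton of_nat_diff card_pts_UNIV del: dim_UNIV)
    also have "\<dots> = q * br (dim UNIV - Suc (dim D))" using br_diff_1[of "dim UNIV - dim D"] dn by simp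
    finally have "(\<Sum>E\<in>P. above k (Suc (Suc (dim D)))) = q * (br (dim UNIV - Suc (dim D)) * above k (Suc (Suc (dim D))))"
      by (simp only: sum_constant)
    also have "\<dots> = q * (above k (Suc (dim D)) * br (k - Suc (dim D)))"
      by (simp only: above_Suc)
    also have "\<dots> = (br ?m - 1) * above k (Suc (dim D))" using br_diff_1[of ?m] D by simp
    finally show ?thesis .
  qed
  have "(\<Sum>E\<in>P. real (card (T E))) \<le> (\<Sum>E\<in>P. above k (Suc (Suc (dim D))))" by (intro sum_mono Tle)
  thus "(\<Sum>B\<in>link D. lym_weight D y B) \<le> above k (Suc (dim D))"
    unfolding sumT sumA using m1 by simp
  show "\<exists>L\<in>pts E UNIV. full L"
    if eq: "(\<Sum>B\<in>link D. lym_weight D y B) = above k (Suc (dim D))" and E: "E \<in> pts D UNIV" "E \<noteq> y"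
  proof -
    have EP: "E \<in> P" using E by (simp add: P_def)
    have "(\<Sum>E\<in>P. real (card (T E))) = (\<Sum>E\<in>P. above k (Suc (Suc (dim D))))"
      unfolding sumT sumA eq ..
    hence "real (card (T E)) = above k (Suc (Suc (dim D)))"
      by (rule sum_mono_inv) (use Tle EP in auto)
    then obtain L where "L \<in> pts E UNIV" "between L k UNIV = T E" using Teq EP by blast
    moreover have "T E \<subseteq> \<F>" using linkD(1) by (auto simp: T_def)
    ultimately show ?thesis unfolding full_def by metis
  qed
qed

text \<open>The two families together are intersecting modulo D: members meeting only in D are both
  unsafe at D, so both would contain z, which is not in D.\<close>

lemma local_bound_even:
  assumes "k = 2 * i" "subspace D" "dim D = i" "z \<in> pts D UNIV"
  shows "real (card {B\<in>link D. z \<subseteq> B}) + real (card {B\<in>link D. \<not> z \<subseteq> B \<and> safe D B}) \<le> above k (Suc i)"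
    and "real (card {B\<in>link D. z \<subseteq> B}) + real (card {B\<in>link D. \<not> z \<subseteq> B \<and> safe D B}) = above k (Suc i) \<Longrightarrow>
      \<exists>E\<in>pts D UNIV. full E"
proof -
  let ?J = "{B\<in>link D. z \<subseteq> B \<or> safe D B}"
  have "?J = {B\<in>link D. z \<subseteq> B} \<union> {B\<in>link D. \<not> z \<subseteq> B \<and> safe D B}" by auto
  hence card: "card ?J = card {B\<in>link D. z \<subseteq> B} + card {B\<in>link D. \<not> z \<subseteq> B \<and> safe D B}"
    by (simp only: ) (rule card_Un_disjoint, auto)
  have J: "?J \<subseteq> between D k UNIV" using link_subset by auto
  have Jint: "A \<inter> B \<noteq> D" if "A \<in> ?J" "B \<in> ?J" for A B
  proof
    assume AB: "A \<inter> B = D"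
    hence "\<not> safe D A" "\<not> safe D B" using that linkD(1) unfolding safe_def by (blast, metis (no_types, lifting) Int_commute mem_Collect_eq)
    hence "z \<subseteq> D" using that AB by auto
    hence "dim z \<le> dim D" by (rule dim_subset)
    thus False using assms(4) by (simp add: pts_iff)
  qed
  have room: "dim D < k" "3 * (k - dim D) + dim D \<le> dim UNIV" using assms k_ge_2 dim_ge by auto
  note le = intersecting_mod_le[OF assms(2) room J Jint, unfolded card assms(3) of_nat_add]
  show "real (card {B\<in>link D. z \<subseteq> B}) + real (card {B\<in>link D. \<not> z \<subseteq> B \<and> safe D B}) \<le> above k (Suc i)"
    by (rule le(1))
  assume "real (card {B\<in>link D. z \<subseteq> B}) + real (card {B\<in>link D. \<not> z \<subseteq> B \<and> safe D B}) = above k (Suc i)"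
  then obtain E where "E \<in> pts D UNIV" "between E k UNIV = ?J" using le(2) by blast
  moreover have "?J \<subseteq> \<F>" using linkD(1) by auto
  ultimately have "full E" unfolding full_def by simp
  thus "\<exists>E\<in>pts D UNIV. full E" using \<open>E \<in> pts D UNIV\<close> by blast
qed

end

section \<open>Numerical estimates for odd k\<close>

lemma sum_split:
  fixes f :: "'c \<Rightarrow> real"
  assumes "finite A"
  shows "sum f A = sum f {x\<in>A. P x} + sum f {x\<in>A. \<not> P x}"
proof -
  have "{x\<in>A. P x} \<union> {x\<in>A. \<not> P x} = A" by auto
  moreover have "sum f ({x\<in>A. P x} \<union> {x\<in>A. \<not> P x}) = sum f {x\<in>A. P x} + sum f {x\<in>A. \<not> P x}"
    using assms by (intro sum.union_disjoint) auto
  ultimately show ?thesis by simp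
qed

context finite_vector_space
begin

text \<open>Repeated use of \<open>br_add\<close> shows that the constant is the quotient of
  \<open>br (3 * m - 2)\<close> by \<open>br (m - 1)\<close> with remainder 1. It bounds from below
  the ratio of consecutive values of \<open>above\<close> in
  \<open>above_ratio_less\<close>.\<close>

lemma br_ratio_less:
  assumes "2 \<le> m" "3 * m - 2 \<le> l"
  shows "(q ^ (2 * m - 1) + q ^ m + q) * br (m - 1) < br l"
proof -
  have "br (3 * m - 2) = q ^ (2 * m - 1) * br (m - 1) + br (2 * m - 1)"
  proof -
    have "3 * m - 2 = (2 * m - 1) + (m - 1)" using assms by simp
    thus ?thesis by (simp only: br_add)
  qed
  moreover have "br (2 * m - 1) = q ^ m * br (m - 1) + br m"
  proof -
    have "2 * m - 1 = m + (m - 1)" using assms by simp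
    thus ?thesis by (simp only: br_add)
  qed
  moreover have "br m = q * br (m - 1) + 1" using br_Suc[of "m - 1"] assms by simp
  ultimately have "(q ^ (2 * m - 1) + q ^ m + q) * br (m - 1) < br (3 * m - 2)"
    by (simp add: algebra_simps)
  also have "\<dots> \<le> br l" using assms(2) by (rule br_mono)
  finally show ?thesis .
qed

text \<open>Everything is expressed through \<open>br m\<close> by \<open>br_pow\<close>, so that
  the two comparisons below become comparisons of quadratic polynomials.\<close>

lemma q_mult_ratio:
  assumes "0 < m"
  shows "q * (q ^ (2 * m - 1) + q ^ m + q) =
    (q - 1) ^ 2 * br m ^ 2 + (2 * (q - 1) + q * (q - 1)) * br m + 1 + q + q ^ 2"
proof -
  have "q * q ^ (2 * m - 1) = q ^ (2 * m)"
    using assms by (simp flip: power_Suc)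
  hence "q * q ^ (2 * m - 1) = (q ^ m) ^ 2" by (simp add: power_mult[symmetric] mult.commute)
  hence "q * (q ^ (2 * m - 1) + q ^ m + q) = (q ^ m) ^ 2 + q * q ^ m + q ^ 2"
    by (simp add: distrib_left power2_eq_square)
  thus ?thesis by (simp add: br_pow power2_eq_square algebra_simps)
qed

text \<open>The left side is the total collected in \<open>local_bound_odd\<close>, in units of
  \<open>above k (i + 2)\<close>, when the safe members off z have no common point.\<close>

lemma ratio_bound_no_common_point:
  assumes "0 < m"
  shows "br m ^ 2 / q + (1 - 1 / q) * ((q + 2) * br m) \<le> q ^ (2 * m - 1) + q ^ m + q"
proof -
  have "1 \<le> (q - 1) ^ 2" using q_ge2 by simp
  hence "1 * br m ^ 2 \<le> (q - 1) ^ 2 * br m ^ 2" by (intro mult_right_mono) auto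
  hence "br m ^ 2 + (q - 1) * ((q + 2) * br m) \<le> q * (q ^ (2 * m - 1) + q ^ m + q)"
  proof -
    have "(q - 1) * ((q + 2) * br m) = (2 * (q - 1) + q * (q - 1)) * br m" by (simp add: algebra_simps)
    moreover have "0 \<le> q ^ 2" by simp
    ultimately show ?thesis
      unfolding q_mult_ratio[OF assms] using \<open>1 * br m ^ 2 \<le> (q - 1) ^ 2 * br m ^ 2\<close> q_ge2 by linarith
  qed
  moreover have "br m ^ 2 + (q - 1) * ((q + 2) * br m) = q * (br m ^ 2 / q + (1 - 1 / q) * ((q + 2) * br m))"
    using q_ge2 by (simp add: field_simps)
  ultimately show ?thesis using q_ge2 by simp
qed

text \<open>The companion for a common point: three families contribute at most \<open>br m\<close>
  units each, and the last summand belongs to the members of rank 0.\<close>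

lemma ratio_bound_common_point:
  assumes "0 < m"
  shows "3 * br m + br m ^ 2 / (q * (q + 1)) \<le> q ^ (2 * m - 1) + q ^ m + q"
proof -
  define t where "t = br m"
  define s where "s = (q - 1) ^ 2"
  have t: "0 \<le> t" by (simp add: t_def)
  have "1 \<le> s" using q_ge2 by (simp add: s_def)
  hence "1 * (t ^ 2 + t) \<le> s * (t ^ 2 + t)" using t by (intro mult_right_mono) auto
  moreover define d where "d = t ^ 2 / (q + 1)"
  have "d \<le> t ^ 2 / 3" unfolding d_def using q_ge2 by (intro divide_left_mono) auto
  \<comment> \<open>After the other estimates it remains to see that 2t^2/3 - 2t + 7 is nonnegative,
    which is done by completing the square.\<close>
  moreover have "0 \<le> (2 * t - 3) ^ 2" by simp
  moreover have "0 \<le> q ^ 2 - 4" using q_ge2 power_mono[of 2 q 2] by simp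
  ultimately have "3 * q * t + d \<le> s * t ^ 2 + (2 * (q - 1) + q * (q - 1)) * t + 1 + q + q ^ 2"
    using q_ge2 by (simp add: s_def power2_eq_square algebra_simps)
  hence "3 * q * t + d \<le> q * (q ^ (2 * m - 1) + q ^ m + q)"
    unfolding q_mult_ratio[OF assms] s_def t_def .
  moreover have "3 * q * t + d = q * (3 * t + t ^ 2 / (q * (q + 1)))"
  proof -
    have "t ^ 2 / (q * (q + 1)) = d / q"
      by (simp only: d_def divide_divide_eq_left mult.commute[of q])
    thus ?thesis using q_ge2 by (simp only: distrib_left) simp
  qed
  ultimately show ?thesis unfolding t_def using q_ge2 by simp
qed

lemma br_square_mult_le:
  assumes "2 \<le> m" "3 * m - 3 \<le> l"
  shows "br m ^ 2 * br (m - 2) \<le> (q + 1) * br l"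
proof -
  define a c where "a = q ^ m" and "c = q ^ (m - 2)"
  have ac: "1 \<le> a" "1 \<le> c" using q_ge2 by (auto simp: a_def c_def)
  have e: "a ^ 2 * c = q * q ^ (3 * m - 3)"
  proof -
    have "m * 2 + (m - 2) = Suc (3 * m - 3)" using assms by simp
    thus ?thesis by (metis a_def c_def power_Suc power_add power_mult)
  qed
  have "br m ^ 2 * br (m - 2) * (q - 1) \<le> br m ^ 2 * br (m - 2) * (q - 1) ^ 3"
    using q_ge2 self_le_power[of "q - 1" 3] by (intro mult_left_mono) auto
  also have "\<dots> = (br m * (q - 1)) ^ 2 * (br (m - 2) * (q - 1))"
    by (simp add: power2_eq_square power3_eq_cube)
  also have "\<dots> = (a - 1) ^ 2 * (c - 1)" by (simp add: br_mult a_def c_def)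
  also have "\<dots> = a ^ 2 * c - 1 - (a * (a - 1) + (c - 1) * (2 * a - 1) + a - 1)"
    by (simp add: power2_eq_square algebra_simps)
  also have "\<dots> \<le> a ^ 2 * c - 1"
  proof -
    have "0 \<le> a * (a - 1)" "0 \<le> (c - 1) * (2 * a - 1)" using ac by auto
    thus ?thesis using ac by linarith
  qed
  also have "\<dots> \<le> (q + 1) * (q ^ (3 * m - 3) - 1)"
  proof -
    have "q \<le> q ^ (3 * m - 3)" using q_ge2 assms by (intro self_le_power) auto
    thus ?thesis unfolding e by (simp add: algebra_simps)
  qed
  also have "q ^ (3 * m - 3) - 1 = br (3 * m - 3) * (q - 1)" by (simp add: br_mult)
  finally have "br m ^ 2 * br (m - 2) * (q - 1) \<le> (q + 1) * br (3 * m - 3) * (q - 1)" by (simp add: mult.assoc)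
  hence "br m ^ 2 * br (m - 2) \<le> (q + 1) * br (3 * m - 3)" using q_ge2 by simp
  also have "\<dots> \<le> (q + 1) * br l" using q_ge2 assms(2) by (intro mult_left_mono br_mono) auto
  finally show ?thesis .
qed

end

section \<open>The local bound for odd k\<close>

context covering_triple_free_family
begin

lemma num_safe_ge:
  assumes "subspace D" "B \<in> link D"
  shows "br (k - dim D) - br (unsafe_rank D B) \<le> num_safe D B"
proof -
  note B = linkD[OF assms(2)]
  note R = unsafe_span[OF B(2,3)]
  have "{E\<in>pts D B. \<not> safe E B} \<subseteq> pts D (unsafe_span D B)"
    using unsafe_subset_span by (auto simp: pts_iff)
  hence "card {E\<in>pts D B. \<not> safe E B} \<le> card (pts D (unsafe_span D B))" by (intro card_mono) auto
  hence "real (card {E\<in>pts D B. \<not> safe E B}) \<le> br (unsafe_rank D B)"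
    using R assms(1) card_pts[of D "unsafe_span D B"] unfolding unsafe_rank_def by simp
  moreover have "card {E\<in>pts D B. safe E B} + card {E\<in>pts D B. \<not> safe E B} = card (pts D B)"
    by (subst card_Un_disjoint[symmetric]) (auto intro: arg_cong[where f = card])
  moreover have "real (card (pts D B)) = br (k - dim D)" using B assms(1) by (simp add: card_pts)
  ultimately show ?thesis unfolding num_safe_def by linarith
qed

lemma num_safe_rank_0:
  assumes "subspace D" "B \<in> link D" "unsafe_rank D B = 0"
  shows "num_safe D B = br (k - dim D)"
proof -
  note B = linkD[OF assms(2)]
  have "{E\<in>pts D B. safe E B} = pts D B"
    using unsafe_rank_eq_0[OF B(2) assms(1) B(3) assms(3)] by blast
  thus ?thesis using B assms(1) by (simp add: num_safe_def card_pts)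
qed

lemma br_diff_1_pos: "1 < m \<Longrightarrow> 0 < br m - 1"
  using q_ge2 by (simp add: br_diff_1)

text \<open>For positive rank r, \<open>br m - br r = q ^ r * br (m - r)\<close> bounds the number
  of safe points from below, and \<open>q * br (m - r)\<close> is at most this and at most
  \<open>br m - 1\<close>. The factor q is the slack that \<open>local_bound_odd\<close>
  spends.\<close>

lemma weight_unsafe:
  assumes "subspace D" "Suc (dim D) < k" "B \<in> link D" "\<not> safe D B" "unsafe_rank D B \<noteq> 0"
  shows "0 \<le> weight D B" "q * weight D B \<le> 1" "q * weight D B \<le> num_safe D B / (br (k - dim D) - 1)"
proof -
  let ?m = "k - dim D" and ?r = "unsafe_rank D B"
  have w: "weight D B = br (?m - ?r) / (br ?m - 1)" using assms by (simp add: weight_def Let_def)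
  have m: "0 < br ?m - 1" "br ?m - 1 = q * br (?m - 1)"
    using assms br_diff_1_pos[of ?m] br_diff_1[of ?m] by auto
  show "0 \<le> weight D B" using m(1) unfolding w by simp
  have "br (?m - ?r) \<le> br (?m - 1)" using assms(5) by (intro br_mono) auto
  hence "q * br (?m - ?r) \<le> br ?m - 1" using m(2) q_ge2 by simp
  thus "q * weight D B \<le> 1" using m(1) unfolding w by (simp add: divide_simps)
  have "?r \<le> ?m" using dim_unsafe_span(2)[of B D] linkD[OF assms(3)] by simp
  hence "br ?m = q ^ ?r * br (?m - ?r) + br ?r" by (metis br_add le_add_diff_inverse)
  moreover have "q ^ 1 \<le> q ^ ?r" using q_ge2 assms(5) by (intro power_increasing) auto
  hence "q * br (?m - ?r) \<le> q ^ ?r * br (?m - ?r)" by (intro mult_right_mono) auto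
  ultimately have "q * br (?m - ?r) \<le> num_safe D B" using num_safe_ge[OF assms(1,3)] by linarith
  thus "q * weight D B \<le> num_safe D B / (br ?m - 1)" using m(1) unfolding w by (simp add: divide_simps)
qed

lemma lym_weight_nonneg:
  assumes "Suc (dim D) < k" shows "0 \<le> lym_weight D y B"
proof -
  have "0 < br (k - dim D) - 1" using assms by (intro br_diff_1_pos) auto
  thus ?thesis by (simp add: lym_weight_def num_safe_def)
qed

lemma safe_Int_ne: "safe D A \<Longrightarrow> B \<in> \<F> \<Longrightarrow> A \<inter> B \<noteq> D" "safe D A \<Longrightarrow> B \<in> \<F> \<Longrightarrow> B \<inter> A \<noteq> D"
  unfolding safe_def by blast+

text \<open>All members meet the safe member A in more than D, whereas y meets A only in D, so
  \<open>card_meeting_le\<close> applies.\<close>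

lemma card_link_point_le:
  assumes "subspace D" "y \<in> pts D UNIV" "A \<in> link D" "safe D A" "\<not> y \<subseteq> A"
  shows "real (card {B\<in>link D. y \<subseteq> B}) \<le> br (k - dim D) * above k (Suc (Suc (dim D)))"
proof -
  note A = linkD[OF assms(3)]
  have y: "subspace y" "D \<subseteq> y" "dim y = Suc (dim D)" using assms(2) by (auto simp: pts_iff)
  have "A \<inter> y = D" using assms A y by (intro subspace_between_Int) auto
  hence "real (card {B\<in>link D. y \<subseteq> B}) \<le> br (dim A - dim D) * above k (Suc (dim y))"
    using A y safe_Int_ne[OF assms(4)] by (intro card_meeting_le) (auto dest: linkD simp: between_iff)
  thus ?thesis using A y by simp
qed

text \<open>At rank 0 every point of B modulo D is safe in B, so A cannot meet B in just one such
  point.\<close>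

lemma ex_line_rank_0:
  assumes "subspace D" "B \<in> link D" "unsafe_rank D B = 0" "A \<in> link D" "A \<inter> B \<noteq> D"
  obtains L where "L \<in> between D (Suc (Suc (dim D))) A" "L \<subseteq> B"
proof -
  note A = linkD[OF assms(4)] and B = linkD[OF assms(2)]
  obtain E where E: "E \<in> pts D UNIV" "E \<subseteq> A" "E \<subseteq> B"
    using ex_pts_Int[OF A(2) B(2) assms(1) A(3) B(3) assms(5)] by blast
  hence Es: "subspace E" "D \<subseteq> E" "dim E = Suc (dim D)" "E \<in> pts D B" by (auto simp: pts_iff)
  have "safe E B" using unsafe_rank_eq_0[OF B(2) assms(1) B(3) assms(3) Es(4)] .
  hence "A \<inter> B \<noteq> E" using A(1) by (rule safe_Int_ne(2))
  then obtain L where "L \<in> pts E UNIV" "L \<subseteq> A" "L \<subseteq> B"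
    using ex_pts_Int[OF A(2) B(2) Es(1) E(2,3)] by blast
  hence "L \<in> between D (Suc (Suc (dim D))) A" using Es by (auto simp: pts_iff between_iff)
  thus ?thesis using \<open>L \<subseteq> B\<close> that by blast
qed

lemma card_rank_0_le:
  assumes "subspace D" "Suc (dim D) < k" "A \<in> link D" "safe D A"
  shows "real (card {B\<in>link D. unsafe_rank D B = 0}) \<le> gb (k - dim D) 2 * above k (Suc (Suc (dim D)))"
proof (rule card_UN_le)
  note A = linkD[OF assms(3)]
  let ?L = "between D (Suc (Suc (dim D))) A"
  show "real (card ?L) \<le> gb (k - dim D) 2"
    using card_between[OF assms(1) A(2,3), of "Suc (Suc (dim D))"] A(4) by (simp add: numeral_2_eq_2)
  show "real (card (between L k UNIV)) \<le> above k (Suc (Suc (dim D)))" if "L \<in> ?L" for L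
    using that by (simp add: between_iff card_above)
  show "{B\<in>link D. unsafe_rank D B = 0} \<subseteq> (\<Union>L\<in>?L. between L k UNIV)"
  proof
    fix B assume B: "B \<in> {B\<in>link D. unsafe_rank D B = 0}"
    hence "A \<inter> B \<noteq> D" using safe_Int_ne[OF assms(4)] linkD(1) by blast
    then obtain L where L: "L \<in> ?L" "L \<subseteq> B" using ex_line_rank_0 assms(1,3) B by blast
    hence "B \<in> between L k UNIV" using linkD[of B D] B by (simp add: between_iff)
    thus "B \<in> (\<Union>L\<in>?L. between L k UNIV)" using L by blast
  qed
qed auto

lemma above_ratio_less:
  assumes "k = 2 * i + 1" "0 < i"
  shows "(q ^ (2 * (i + 1) - 1) + q ^ (i + 1) + q) * above k (Suc (Suc i)) < above k (Suc i)"
proof -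
  let ?c = "q ^ (2 * (i + 1) - 1) + q ^ (i + 1) + q"
  have c: "0 < above k (Suc (Suc i))" using assms dim_ge by (intro above_pos) (auto simp del: dim_UNIV)
  have "?c * br (i + 1 - 1) < br (dim UNIV - Suc i)"
    using assms dim_ge by (intro br_ratio_less) (auto simp del: dim_UNIV)
  hence "?c * br i * above k (Suc (Suc i)) < br (dim UNIV - Suc i) * above k (Suc (Suc i))"
    using c by (intro mult_strict_right_mono) auto
  also have "\<dots> = above k (Suc i) * br i" using above_Suc[of k "Suc i"] assms by simp
  finally have "?c * above k (Suc (Suc i)) * br i < above k (Suc i) * br i" by (simp only: mult_ac)
  thus ?thesis using assms by (simp only: mult_less_cancel_right_pos br_pos)
qed

text \<open>It makes the cover by planes in \<open>card_no_common_point_le\<close> no worse than the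
  cover by the points of a line.\<close>

lemma above_square_le:
  assumes "k = 2 * i + 1" "0 < i"
  shows "br (i + 1) ^ 2 * above k (i + 3) \<le> (q + 1) * above k (i + 2)"
proof (cases "i = 1")
  case True
  hence "above k (i + 3) = 0" using assms by (simp add: above_def)
  thus ?thesis using q_ge2 by simp
next
  case False
  hence i: "0 < i - 1" using assms by simp
  have "br (i + 1) ^ 2 * br (i + 1 - 2) \<le> (q + 1) * br (dim UNIV - (i + 2))"
    using assms dim_ge by (intro br_square_mult_le) (auto simp del: dim_UNIV)
  hence "br (i + 1) ^ 2 * br (i - 1) * above k (i + 3) \<le> (q + 1) * br (dim UNIV - (i + 2)) * above k (i + 3)"
    by (intro mult_right_mono) auto
  also have "\<dots> = (q + 1) * above k (i + 2) * br (i - 1)"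
    using above_Suc[of k "i + 2"] assms by (simp add: numeral_3_eq_3)
  finally have "br (i + 1) ^ 2 * above k (i + 3) * br (i - 1) \<le> (q + 1) * above k (i + 2) * br (i - 1)"
    by (simp only: mult_ac)
  thus ?thesis using i by (simp only: mult_le_cancel_right_pos br_pos)
qed

text \<open>Either some line \<open>L\<close> modulo \<open>D\<close> is met by all of \<open>J\<close>, or every member of \<open>J\<close> contains one of at
  most \<open>br (i + 1) ^ 3\<close> planes modulo \<open>D\<close>.\<close>

lemma card_no_common_point_le:
  assumes "k = 2 * i + 1" "0 < i" "subspace D" "dim D = i"
    and J: "J \<subseteq> {B\<in>link D. safe D B}" "A \<in> J" "\<And>y. y \<in> pts D UNIV \<Longrightarrow> \<exists>B\<in>J. \<not> y \<subseteq> B"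
  shows "real (card J) \<le> (q + 1) * (br (i + 1) * above k (i + 2))"
proof (cases "\<exists>L\<in>between D (i + 2) UNIV. \<forall>B\<in>J. L \<inter> B \<noteq> D")
  case True
  then obtain L where L: "L \<in> between D (i + 2) UNIV" "\<And>B. B \<in> J \<Longrightarrow> L \<inter> B \<noteq> D" by blast
  show ?thesis
  proof (rule card_UN_le)
    let ?P = "pts D L"
    show "real (card ?P) \<le> q + 1"
      using L assms card_pts[of D L] br_Suc[of "Suc 0"] by (simp add: between_iff numeral_2_eq_2)
    show "real (card {B\<in>link D. y \<subseteq> B}) \<le> br (i + 1) * above k (i + 2)" if "y \<in> ?P" for y
    proof -
      have y: "y \<in> pts D UNIV" using that by (auto simp: pts_iff)
      then obtain B where "B \<in> J" "\<not> y \<subseteq> B" using J(3) by blast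
      thus ?thesis using card_link_point_le[OF assms(3) y, of B] J(1) assms by auto
    qed
    show "J \<subseteq> (\<Union>y\<in>?P. {B\<in>link D. y \<subseteq> B})"
    proof
      fix B assume B: "B \<in> J"
      hence "B \<in> link D" using J(1) by blast
      moreover obtain y where "y \<in> pts D UNIV" "y \<subseteq> L" "y \<subseteq> B"
        using ex_pts_Int[of L B D] L B linkD[OF \<open>B \<in> link D\<close>] assms by (auto simp: between_iff)
      hence "y \<in> ?P" "y \<subseteq> B" by (auto simp: pts_iff)
      ultimately show "B \<in> (\<Union>y\<in>?P. {B\<in>link D. y \<subseteq> B})" by blast
    qed
  qed auto
next
  case False
  hence noL: "\<exists>B\<in>J. L \<inter> B = D" if "L \<in> between D (i + 2) UNIV" for L using that by blast
  let ?t = "br (i + 1)" and ?c = "above k (i + 3)"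
  have JD: "B \<in> link D" "safe D B" if "B \<in> J" for B using that J(1) by auto
  have Jint: "B \<inter> C \<noteq> D" if "B \<in> J" "C \<in> J" for B C
    using safe_Int_ne(1) JD linkD(1) that by blast
  have kD: "k - dim D = i + 1" using assms by simp
  have line: "real (card {B\<in>J. L \<subseteq> B}) \<le> ?t * ?c" if L: "L \<in> between D (i + 2) UNIV" for L
  proof -
    obtain C where C: "C \<in> J" "L \<inter> C = D" using noL[OF L] by blast
    note Cs = linkD[OF JD(1)[OF C(1)]]
    have "{B\<in>J. L \<subseteq> B} \<subseteq> between L k UNIV" using linkD[OF JD(1)] by (auto simp: between_iff)
    hence "real (card {B\<in>J. L \<subseteq> B}) \<le> br (dim C - dim D) * above k (Suc (dim L))"
      using L C Cs Jint by (intro card_meeting_le) (auto simp: between_iff)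
    thus ?thesis using L Cs kD by (simp add: between_iff numeral_3_eq_3)
  qed
  have point: "real (card {B\<in>J. E \<subseteq> B}) \<le> ?t * (?t * ?c)" if E: "E \<in> pts D UNIV" for E
  proof -
    obtain C where C: "C \<in> J" "\<not> E \<subseteq> C" using J(3)[OF E] by blast
    note Cs = linkD[OF JD(1)[OF C(1)]]
    have Es: "subspace E" "D \<subseteq> E" "dim E = i + 1" using E assms by (auto simp: pts_iff)
    show ?thesis
    proof (rule card_UN_le)
      let ?P = "pts D C"
      show "real (card ?P) \<le> ?t" using Cs assms kD by (simp add: card_pts)
      show "real (card {B\<in>J. E + E' \<subseteq> B}) \<le> ?t * ?c" if E': "E' \<in> ?P" for E'
      proof (rule line)
        have "\<not> E \<subseteq> E'" using C E' by (auto simp: pts_iff)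
        moreover have "E \<subseteq> E'" if "E' \<subseteq> E"
          using subspace_eqI[of E' E] that E' Es assms by (auto simp: pts_iff)
        ultimately have "\<not> E' \<subseteq> E" by blast
        moreover have "E' \<in> pts D UNIV" using E' by (auto simp: pts_iff)
        ultimately have "E + E' \<in> pts E UNIV" using Es assms by (intro plus_pts[of D]) auto
        thus "E + E' \<in> between D (i + 2) UNIV" using Es by (auto simp: pts_iff between_iff)
      qed
      show "{B\<in>J. E \<subseteq> B} \<subseteq> (\<Union>E'\<in>?P. {B\<in>J. E + E' \<subseteq> B})"
      proof
        fix B assume B: "B \<in> {B\<in>J. E \<subseteq> B}"
        note Bs = linkD[OF JD(1), of B]
        have BD: "subspace B" "D \<subseteq> B" using Bs B by auto
        obtain E' where E': "E' \<in> pts D UNIV" "E' \<subseteq> B" "E' \<subseteq> C"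
          using ex_pts_Int[OF BD(1) Cs(2) assms(3) BD(2) Cs(3)] Jint C B by blast
        hence "E' \<in> ?P" by (simp add: pts_iff)
        moreover have "E + E' \<subseteq> B" using B BD E' by (intro plus_subsetI) auto
        ultimately show "B \<in> (\<Union>E'\<in>?P. {B\<in>J. E + E' \<subseteq> B})" using B by blast
      qed
    qed auto
  qed
  have "real (card J) \<le> ?t * (?t * (?t * ?c))"
  proof (rule card_UN_le)
    note As = linkD[OF JD(1)[OF J(2)]]
    let ?P = "pts D A"
    show "real (card ?P) \<le> ?t" using As assms kD by (simp add: card_pts)
    show "real (card {B\<in>J. E \<subseteq> B}) \<le> ?t * (?t * ?c)" if "E \<in> ?P" for E
      using that by (intro point) (auto simp: pts_iff)
    show "J \<subseteq> (\<Union>E\<in>?P. {B\<in>J. E \<subseteq> B})"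
    proof
      fix B assume B: "B \<in> J"
      note Bs = linkD[OF JD(1)[OF B]]
      obtain E where "E \<in> pts D UNIV" "E \<subseteq> B" "E \<subseteq> A"
        using ex_pts_Int[OF Bs(2) As(2) assms(3) Bs(3) As(3) Jint[OF B J(2)]] by blast
      thus "B \<in> (\<Union>E\<in>?P. {B\<in>J. E \<subseteq> B})" using B by (auto simp: pts_iff)
    qed
  qed auto
  also have "\<dots> = ?t * (?t ^ 2 * ?c)" by (simp add: power2_eq_square)
  also have "\<dots> \<le> ?t * ((q + 1) * above k (i + 2))"
    using above_square_le[OF assms(1,2)] by (intro mult_left_mono) auto
  finally show ?thesis by (simp only: mult_ac)
qed

text \<open>With \<open>P\<close> the safe members of positive rank and \<open>r\<close> the total weight of the unsafe ones, the sum of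
  \<open>lym_weight D z\<close> dominates the total if \<open>card P \<le> (q - 1) * r\<close>. Otherwise \<open>P\<close> is nonempty; if the safe
  members off \<open>z\<close> share a point \<open>y\<close>, then \<open>lym_weight D y\<close> takes over, and all remaining families are
  smaller by an order of magnitude.\<close>

lemma local_bound_odd:
  assumes k: "k = 2 * i + 1" "0 < i" and D: "subspace D" "dim D = i" and z: "z \<in> pts D UNIV"
  shows "real (card {B\<in>link D. z \<subseteq> B}) + (\<Sum>B\<in>{B\<in>link D. \<not> z \<subseteq> B}. weight D B) \<le> above k (Suc i)"
    and "real (card {B\<in>link D. z \<subseteq> B}) + (\<Sum>B\<in>{B\<in>link D. \<not> z \<subseteq> B}. weight D B) = above k (Suc i) \<Longrightarrow>
      \<exists>y\<in>pts D UNIV. \<forall>E\<in>pts D UNIV. E \<noteq> y \<longrightarrow> (\<exists>L\<in>pts E UNIV. full L)"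
proof -
  define N N1 t where "N = above k (Suc i)" and "N1 = above k (Suc (Suc i))" and "t = br (i + 1)"
  define a where "a = t / (t - 1)"
  define X' where "X' = {B\<in>link D. z \<subseteq> B}"
  define Y where "Y = {B\<in>link D. \<not> z \<subseteq> B}"
  define Q where "Q = {B\<in>Y. unsafe_rank D B = 0}"
  define Y' where "Y' = {B\<in>Y. unsafe_rank D B \<noteq> 0}"
  define P where "P = {B\<in>Y'. safe D B}"
  define R where "R = {B\<in>Y'. \<not> safe D B}"
  define r where "r = (\<Sum>B\<in>R. weight D B)"
  let ?total = "real (card X') + (\<Sum>B\<in>Y. weight D B)"
  have kD: "k - dim D = i + 1" "Suc (dim D) < k" using k D by auto
  have room: "3 * (k - Suc (dim D)) + Suc (dim D) \<le> dim UNIV" using k D dim_ge by (auto simp del: dim_UNIV)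
  have subs: "X' \<subseteq> link D" "Q \<subseteq> link D" "P \<subseteq> link D" "R \<subseteq> link D"
    by (auto simp: X'_def Y_def Q_def Y'_def P_def R_def)
  have t: "t - 1 = q * br i" "1 \<le> br i" using k by (simp_all add: t_def br_Suc br_ge1)
  have t1: "0 < t - 1" using t q_ge2 by simp
  have N1: "0 < N1" unfolding N1_def using k dim_ge by (intro above_pos) (auto simp del: dim_UNIV)
  have ratio: "(q ^ (2 * (i + 1) - 1) + q ^ (i + 1) + q) * N1 < N"
    unfolding N_def N1_def by (rule above_ratio_less[OF k])
  have q1: "1 < q" "0 < q" using q_ge2 by auto
  have split: "sum f (link D) = sum f X' + sum f Q + sum f P + sum f R" for f :: "'b set \<Rightarrow> real"
    unfolding X'_def Q_def P_def R_def Y'_def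
    using sum_split[of "link D" f "\<lambda>B. z \<subseteq> B"] sum_split[of Y f "\<lambda>B. unsafe_rank D B = 0"]
      sum_split[of "{B\<in>Y. unsafe_rank D B \<noteq> 0}" f "safe D"] by (simp add: Y_def)
  have wQ: "weight D B = a" "num_safe D B / (t - 1) = a" if "B \<in> Q" for B
    using that num_safe_rank_0[OF D(1)] subs kD by (auto simp: Q_def weight_def Let_def a_def t_def)
  have wP: "weight D B = 1" if "B \<in> P" for B
    using that by (auto simp: P_def Y'_def weight_def Let_def)
  have wR: "0 \<le> weight D B" "q * weight D B \<le> 1" "q * weight D B \<le> num_safe D B / (t - 1)" if "B \<in> R" for B
  proof -
    have "B \<in> link D" "\<not> safe D B" "unsafe_rank D B \<noteq> 0" using that by (auto simp: R_def Y'_def Y_def)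
    from weight_unsafe[OF D(1) kD(2) this]
    show "0 \<le> weight D B" "q * weight D B \<le> 1" "q * weight D B \<le> num_safe D B / (t - 1)"
      by (simp_all only: kD t_def)
  qed
  have r0: "0 \<le> r" unfolding r_def using wR by (intro sum_nonneg)
  have total: "?total = real (card X') + a * real (card Q) + real (card P) + r"
  proof -
    have "(\<Sum>B\<in>Y. weight D B) = (\<Sum>B\<in>Q. weight D B) + (\<Sum>B\<in>P. weight D B) + r"
      unfolding Q_def P_def R_def Y'_def r_def
      using sum_split[of Y "weight D" "\<lambda>B. unsafe_rank D B = 0"]
        sum_split[of "{B\<in>Y. unsafe_rank D B \<noteq> 0}" "weight D" "safe D"] by simp
    thus ?thesis using wQ wP by simp
  qed
  have lymR: "q * r \<le> (\<Sum>B\<in>R. lym_weight D y B)" for y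
    unfolding r_def sum_distrib_left
    by (rule sum_mono) (use wR kD in \<open>auto simp: lym_weight_def t_def\<close>)
  note lym = sum_lym_weight_le[OF D(1) kD(2) room, unfolded D(2), folded N_def]
  \<comment> \<open>The strictness matters: with equality the first alternative is excluded, and the
    equality passes on to a sum of lym weights.\<close>
  have main: "?total < N \<or> (\<exists>y\<in>pts D UNIV. ?total \<le> (\<Sum>B\<in>link D. lym_weight D y B))"
  proof (cases "real (card P) \<le> (q - 1) * r")
    case True
    have "(\<Sum>B\<in>X'. lym_weight D z B) = real (card X')" by (simp add: X'_def lym_weight_def)
    moreover have "(\<Sum>B\<in>Q. lym_weight D z B) = a * real (card Q)"
    proof -
      have "lym_weight D z B = a" if "B \<in> Q" for B
        using wQ(2)[OF that] that kD by (simp add: lym_weight_def t_def Q_def Y_def)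
      thus ?thesis by simp
    qed
    moreover have "0 \<le> (\<Sum>B\<in>P. lym_weight D z B)" using kD by (intro sum_nonneg lym_weight_nonneg)
    ultimately have "?total \<le> (\<Sum>B\<in>link D. lym_weight D z B)"
      unfolding total split using True lymR[of z] by (simp add: algebra_simps)
    thus ?thesis using z by blast
  next
    case False
    hence "P \<noteq> {}" using r0 q1 by auto
    define J where "J = {B\<in>Y. safe D B}"
    have PJ: "P \<subseteq> J" by (auto simp: P_def Y'_def J_def)
    obtain A where A: "A \<in> J" using \<open>P \<noteq> {}\<close> PJ by blast
    hence As: "A \<in> link D" "safe D A" "\<not> z \<subseteq> A" by (auto simp: J_def Y_def)
    have AD: "A \<inter> B \<noteq> D" "B \<inter> A \<noteq> D" if "B \<in> link D" for B
      using safe_Int_ne[OF As(2)] linkD(1)[OF that] by blast+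
    have X'_le: "real (card X') \<le> t * N1"
      using card_link_point_le[OF D(1) z As] kD D by (simp add: X'_def t_def N1_def)
    have r_le: "r \<le> (q - 1) * r" using q_ge2 r0 mult_right_mono[of 1 "q - 1" r] by simp
    have "Q \<subseteq> {B\<in>link D. unsafe_rank D B = 0}" by (auto simp: Q_def Y_def)
    hence "real (card Q) \<le> real (card {B\<in>link D. unsafe_rank D B = 0})" by (simp add: card_mono)
    also have "\<dots> \<le> gb (i + 1) 2 * N1"
      using card_rank_0_le[OF D(1) kD(2) As(1,2)] k by (simp add: D(2) N1_def)
    finally have Q_le: "a * real (card Q) \<le> a * (gb (i + 1) 2 * N1)"
      using t1 by (intro mult_left_mono) (auto simp: a_def)
    have gb2: "a * gb (i + 1) 2 = t ^ 2 / (q * (q + 1))"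
    proof -
      have "gb (i + 1) 2 * br 2 = t * br i"
        using gb_Suc[of "i + 1" 1] gb_Suc[of i 0] by (simp add: numeral_2_eq_2 t_def)
      moreover have "br 2 = q + 1" using br_Suc[of "Suc 0"] by (simp add: numeral_2_eq_2)
      ultimately have "gb (i + 1) 2 = t * br i / (q + 1)" using q1 by (simp add: field_simps)
      thus ?thesis using t q1 k by (simp add: a_def power2_eq_square)
    qed
    show ?thesis
    proof (cases "\<exists>y\<in>pts D UNIV. \<forall>B\<in>J. y \<subseteq> B")
      case True
      then obtain y where y: "y \<in> pts D UNIV" "\<And>B. B \<in> J \<Longrightarrow> y \<subseteq> B" by blast
      have ys: "subspace y" "D \<subseteq> y" "dim y = i + 1" using y(1) D by (auto simp: pts_iff)
      define X1 where "X1 = {B\<in>X'. \<not> y \<subseteq> B}"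
      define Q1 where "Q1 = {B\<in>Q. y \<subseteq> B}"
      have "(\<Sum>B\<in>X'. lym_weight D y B) \<ge> real (card X') - real (card X1)"
      proof -
        have "real (card X') - real (card X1) = (\<Sum>B\<in>X'. if y \<subseteq> B then 1 else 0)"
          using sum_split[of X' "\<lambda>B. 1" "\<lambda>B. y \<subseteq> B"] by (simp add: X1_def sum.If_cases Int_def)
        also have "\<dots> \<le> (\<Sum>B\<in>X'. lym_weight D y B)"
        proof (rule sum_mono)
          fix B
          show "(if y \<subseteq> B then 1 else 0) \<le> lym_weight D y B"
            using lym_weight_nonneg[OF kD(2), of y B] by (cases "y \<subseteq> B") (simp_all add: lym_weight_def)
        qed
        finally show ?thesis .
      qed
      moreover have "(\<Sum>B\<in>Q. lym_weight D y B) = a * real (card Q) - (a - 1) * real (card Q1)"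
      proof -
        have "(\<Sum>B\<in>Q. lym_weight D y B) = (\<Sum>B\<in>Q. a - (if y \<subseteq> B then a - 1 else 0))"
          using wQ(2) kD by (intro sum.cong) (auto simp: lym_weight_def t_def)
        also have "\<dots> = a * real (card Q) - (a - 1) * real (card Q1)"
          by (simp add: sum_subtractf sum.If_cases Int_def Q1_def)
        finally show ?thesis .
      qed
      moreover have "(\<Sum>B\<in>P. lym_weight D y B) = real (card P)"
        using y(2) PJ by (simp add: lym_weight_def subset_iff)
      \<comment> \<open>Compared with the total, \<open>lym_weight D y\<close> loses at most 1 on
        each member of \<open>X1\<close> and \<open>a - 1\<close> on each of \<open>Q1\<close>,
        keeps \<open>P\<close>, and gains at least \<open>(q - 1) * r\<close> on
        \<open>R\<close>.\<close>
      ultimately have lymy: "?total - (real (card X1) + (a - 1) * real (card Q1) - (q - 1) * r) \<le> (\<Sum>B\<in>link D. lym_weight D y B)"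
        unfolding total split using lymR[of y] by (simp add: algebra_simps)
      show ?thesis
      proof (cases "real (card X1) + (a - 1) * real (card Q1) \<le> (q - 1) * r")
        case True
        thus ?thesis using lymy y(1) by (intro disjI2 bexI[of _ y]) auto
      next
        case False
        hence ne: "X1 \<noteq> {} \<or> Q1 \<noteq> {}" using r0 q1 by auto
        \<comment> \<open>The members of \<open>P\<close> all contain y. A member C of
          \<open>X1\<close> or \<open>Q1\<close> makes each of them contain in addition a part of C
          outside y, and at most t joins with y arise.\<close>
        have P_le: "real (card P) \<le> t * N1"
        proof -
          have Py: "P \<subseteq> between y k UNIV"
          proof
            fix B assume B: "B \<in> P"
            hence "y \<subseteq> B" using y(2) PJ by blast
            thus "B \<in> between y k UNIV" using linkD[of B D] B subs(3) by (auto simp: between_iff)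
          qed
          have PD: "B \<inter> C \<noteq> D" if "B \<in> P" "C \<in> link D" for B C
            using that safe_Int_ne(1) linkD(1) by (auto simp: P_def)
          show ?thesis
          proof (cases "X1 = {}")
            case False
            then obtain C where C: "C \<in> link D" "\<not> y \<subseteq> C" by (auto simp: X1_def X'_def)
            note Cs = linkD[OF C(1)]
            have "C \<inter> y = D" using C Cs ys D by (intro subspace_between_Int) auto
            hence "real (card P) \<le> br (dim C - dim D) * above k (Suc (dim y))"
              using Py PD C Cs ys by (intro card_meeting_le) auto
            thus ?thesis using Cs ys kD by (simp add: t_def N1_def)
          next
            case True
            then obtain C where C: "C \<in> link D" "y \<subseteq> C" "unsafe_rank D C = 0" using ne by (auto simp: Q1_def Q_def Y_def)
            note Cs = linkD[OF C(1)]
            have "y \<in> pts D C" using y(1) C(2) by (auto simp: pts_iff)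
            hence "safe y C" by (rule unsafe_rank_eq_0[OF Cs(2) D(1) Cs(3) C(3)])
            hence "B \<inter> C \<noteq> y" if "B \<in> P" for B
              using safe_Int_ne(2) linkD(1) that subs(3) by blast
            hence "real (card P) \<le> br (dim C - dim y) * above k (Suc (dim y))"
              using Py C Cs ys by (intro card_meeting_le) auto
            also have "\<dots> \<le> t * N1"
              using ys Cs k by (auto simp: t_def N1_def intro!: mult_right_mono br_mono)
            finally show ?thesis .
          qed
        qed
        have "r < t * N1" using r_le \<open>\<not> real (card P) \<le> (q - 1) * r\<close> P_le by linarith
        hence "?total < t * N1 + a * (gb (i + 1) 2 * N1) + t * N1 + t * N1"
          unfolding total using X'_le Q_le P_le by linarith
        also have "\<dots> = (3 * t + t ^ 2 / (q * (q + 1))) * N1"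
          unfolding gb2[symmetric] by (simp add: algebra_simps)
        also have "\<dots> \<le> (q ^ (2 * (i + 1) - 1) + q ^ (i + 1) + q) * N1"
          unfolding t_def using N1 by (intro mult_right_mono ratio_bound_common_point) auto
        finally show ?thesis using ratio by simp
      qed
    next
      case False
      hence nc: "\<exists>B\<in>J. \<not> y \<subseteq> B" if "y \<in> pts D UNIV" for y using that by blast
      have JL: "J \<subseteq> {B\<in>link D. safe D B}" by (auto simp: J_def Y_def)
      have "real (card P) \<le> real (card J)" using PJ by (simp add: card_mono)
      also have "\<dots> \<le> (q + 1) * (t * N1)"
        using card_no_common_point_le[OF k D JL A nc] by (simp add: t_def N1_def)
      finally have P_le: "real (card P) \<le> (q + 1) * (t * N1)" .
      have deg: "real (card {B\<in>link D. y \<subseteq> B}) \<le> t * N1" if "y \<in> pts D A" for y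
      proof -
        have y: "y \<in> pts D UNIV" using that by (auto simp: pts_iff)
        obtain B where "B \<in> J" "\<not> y \<subseteq> B" using nc[OF y] by blast
        thus ?thesis using card_link_point_le[OF D(1) y, of B] JL kD D by (auto simp: t_def N1_def)
      qed
      note AL = linkD[OF As(1)]
      \<comment> \<open>Incidences between members and points of A modulo D. Every member has at
        least one, since A is safe at D, and those of rank 0 have at least a whole line, hence q +
        1.\<close>
      have count: "(\<Sum>B\<in>link D. real (card {y\<in>pts D A. y \<subseteq> B})) \<le> t * (t * N1)"
      proof -
        have "(\<Sum>B\<in>link D. card {y\<in>pts D A. y \<subseteq> B}) = (\<Sum>y\<in>pts D A. card {B\<in>link D. y \<subseteq> B})"
          by (rule sum_card_swap) auto
        hence "(\<Sum>B\<in>link D. real (card {y\<in>pts D A. y \<subseteq> B})) = (\<Sum>y\<in>pts D A. real (card {B\<in>link D. y \<subseteq> B}))"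
          by (simp flip: of_nat_sum)
        also have "\<dots> \<le> (\<Sum>y\<in>pts D A. t * N1)" by (intro sum_mono deg)
        also have "\<dots> = t * (t * N1)"
          using card_pts[OF D(1) AL(2,3)] AL kD by (simp add: t_def)
        finally show ?thesis .
      qed
      have one: "1 \<le> real (card {y\<in>pts D A. y \<subseteq> B})" if BL: "B \<in> link D" for B
      proof -
        note B = linkD[OF BL]
        obtain y where "y \<in> pts D UNIV" "y \<subseteq> A" "y \<subseteq> B"
          using ex_pts_Int[OF AL(2) B(2) D(1) AL(3) B(3) AD(1)[OF BL]] by blast
        hence "y \<in> {y\<in>pts D A. y \<subseteq> B}" by (auto simp: pts_iff)
        hence "0 < card {y\<in>pts D A. y \<subseteq> B}" using card_gt_0_iff by blast
        thus ?thesis by simp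
      qed
      have two: "q + 1 \<le> real (card {y\<in>pts D A. y \<subseteq> B})" if "B \<in> Q" for B
      proof -
        have B: "B \<in> link D" "unsafe_rank D B = 0" using that by (auto simp: Q_def Y_def)
        obtain L where L: "L \<in> between D (Suc (Suc (dim D))) A" "L \<subseteq> B"
          using ex_line_rank_0[OF D(1) B As(1) AD(1)[OF B(1)]] by blast
        have "pts D L \<subseteq> {y\<in>pts D A. y \<subseteq> B}"
          using L unfolding pts_def between_def by blast
        hence "real (card (pts D L)) \<le> real (card {y\<in>pts D A. y \<subseteq> B})" by (simp add: card_mono)
        moreover have "real (card (pts D L)) = q + 1"
          using L D card_pts[of D L] br_Suc[of "Suc 0"] by (simp add: between_iff numeral_2_eq_2)
        ultimately show ?thesis by simp
      qed
      have Y_sum: "real (card X') + (q + 1) * real (card Q) + real (card P) + real (card R) \<le> t * (t * N1)"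
      proof -
        have ge: "real (card S) \<le> (\<Sum>B\<in>S. real (card {y\<in>pts D A. y \<subseteq> B}))" if "S \<subseteq> link D" for S
        proof -
          have "(\<Sum>B\<in>S. 1 :: real) \<le> (\<Sum>B\<in>S. real (card {y\<in>pts D A. y \<subseteq> B}))"
            using that by (intro sum_mono one) auto
          thus ?thesis by simp
        qed
        have "real (card X') \<le> (\<Sum>B\<in>X'. real (card {y\<in>pts D A. y \<subseteq> B}))"
          by (rule ge) (rule subs)
        moreover have "(q + 1) * real (card Q) \<le> (\<Sum>B\<in>Q. real (card {y\<in>pts D A. y \<subseteq> B}))"
          using sum_mono[of Q "\<lambda>B. q + 1" "\<lambda>B. real (card {y\<in>pts D A. y \<subseteq> B})"] two by (simp add: mult.commute)
        moreover have "real (card P) \<le> (\<Sum>B\<in>P. real (card {y\<in>pts D A. y \<subseteq> B}))"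
          by (rule ge) (rule subs)
        moreover have "real (card R) \<le> (\<Sum>B\<in>R. real (card {y\<in>pts D A. y \<subseteq> B}))"
          by (rule ge) (rule subs)
        ultimately show ?thesis using count unfolding split by linarith
      qed
      have "q * r \<le> real (card R)"
        unfolding r_def sum_distrib_left using sum_mono[of R "\<lambda>B. q * weight D B" "\<lambda>B. 1"] wR by simp
      moreover have "q * (a * real (card Q)) \<le> (q + 1) * real (card Q)"
      proof -
        have "q * a \<le> q + 1"
        proof -
          have "q * t \<le> (q + 1) * (t - 1)"
            using t q1 mult_left_mono[of 1 "br i" q] by (simp add: algebra_simps)
          thus ?thesis unfolding a_def using t1 by (simp add: pos_divide_le_eq)
        qed
        thus ?thesis by (metis mult.assoc mult_right_mono of_nat_0_le_iff)
      qed
      \<comment> \<open>On \<open>R\<close> and \<open>Q\<close>, q times the weight is covered by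
        the multiplicities 1 and q + 1 of the incidence count; only \<open>X'\<close> and
        \<open>P\<close> exceed their multiplicity, by q - 1 per member.\<close>
      ultimately have "q * ?total \<le> t * (t * N1) + (q - 1) * (real (card X') + real (card P))"
        unfolding total using Y_sum by (simp add: algebra_simps)
      also have "\<dots> \<le> t * (t * N1) + (q - 1) * (t * N1 + (q + 1) * (t * N1))"
        using X'_le P_le q1 by (intro add_left_mono mult_left_mono add_mono) auto
      also have "\<dots> = q * ((t ^ 2 / q + (1 - 1 / q) * ((q + 2) * t)) * N1)"
        using q1 by (simp add: field_simps power2_eq_square)
      finally have "?total \<le> (t ^ 2 / q + (1 - 1 / q) * ((q + 2) * t)) * N1" using q1 by simp
      also have "\<dots> \<le> (q ^ (2 * (i + 1) - 1) + q ^ (i + 1) + q) * N1"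
        unfolding t_def using N1 by (intro mult_right_mono ratio_bound_no_common_point) auto
      finally show ?thesis using ratio by simp
    qed
  qed
  show "real (card {B\<in>link D. z \<subseteq> B}) + (\<Sum>B\<in>{B\<in>link D. \<not> z \<subseteq> B}. weight D B) \<le> above k (Suc i)"
    using main lym(1) unfolding X'_def Y_def N_def by fastforce
  assume "real (card {B\<in>link D. z \<subseteq> B}) + (\<Sum>B\<in>{B\<in>link D. \<not> z \<subseteq> B}. weight D B) = above k (Suc i)"
  hence "?total = N" by (simp add: X'_def Y_def N_def)
  then obtain y where y: "y \<in> pts D UNIV" "N \<le> (\<Sum>B\<in>link D. lym_weight D y B)" using main by auto
  hence "(\<Sum>B\<in>link D. lym_weight D y B) = N" using lym(1)[OF y(1)] by simp
  thus "\<exists>y\<in>pts D UNIV. \<forall>E\<in>pts D UNIV. E \<noteq> y \<longrightarrow> (\<exists>L\<in>pts E UNIV. full L)"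
    using lym(2)[OF y(1)] y(1) by blast
qed

end

section \<open>Counting subspaces that avoid a point\<close>

context finite_vector_space
begin

lemma gb_diff_pos:
  assumes "0 < i" "i < m" shows "gb (m - 1) (i - 1) < gb m i"
proof -
  have "gb m i * br i = br m * gb (m - 1) (i - 1)" using gb_Suc[of m "i - 1"] assms by simp
  moreover have "0 < gb (m - 1) (i - 1)" using assms by (intro gb_pos) auto
  moreover have "br i < br m"
  proof -
    have "br i < br (Suc i)" using q_ge2 by (simp add: br_Suc')
    also have "\<dots> \<le> br m" using assms by (intro br_mono) auto
    finally show ?thesis .
  qed
  ultimately have "br i * gb (m - 1) (i - 1) < gb m i * br i" by simp
  thus ?thesis using assms by (simp add: mult.commute[of "br i"])
qed

lemma card_between_not_ge:
  assumes "x \<in> pts {0} UNIV" "subspace B" "x \<subseteq> B" "dim B = k" "0 < i" "i < k"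
  shows "real (card {D\<in>between {0} i B. \<not> x \<subseteq> D}) = gb k i - gb (k - 1) (i - 1)"
proof -
  have x: "subspace x" "dim x = 1" using assms(1) by (auto simp: pts_iff)
  have "{D\<in>between {0} i B. \<not> x \<subseteq> D} = between {0} i B - between x i B"
    using subspace_0 by (auto simp: between_iff)
  moreover have "between x i B \<subseteq> between {0} i B" using subspace_0 by (auto simp: between_iff)
  ultimately have "real (card {D\<in>between {0} i B. \<not> x \<subseteq> D}) = real (card (between {0} i B)) - real (card (between x i B))"
    by (simp add: card_Diff_subset card_mono of_nat_diff)
  thus ?thesis using card_between[OF x(1) assms(2,3), of i] card_between[of "{0}" B i] assms x
    by (simp add: subspace_0)
qed

lemma plus_point:
  assumes "x \<in> pts {0} UNIV" "subspace D" "\<not> x \<subseteq> D"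
  shows "D + x \<in> pts D UNIV" "subspace B \<Longrightarrow> D \<subseteq> B \<Longrightarrow> D + x \<subseteq> B \<longleftrightarrow> x \<subseteq> B"
proof -
  show "D + x \<in> pts D UNIV" using assms by (intro plus_pts[of "{0}"]) (auto simp: subspace_0)
  show "D + x \<subseteq> B \<longleftrightarrow> x \<subseteq> B" if "subspace B" "D \<subseteq> B"
    using plus_subsetI[OF that] subset_plus2[OF assms(2), of x] by blast
qed

text \<open>Pairs of an avoiding D and a k-space through both D and x, counted in two ways. It is
  this identity that makes the final bound exactly \<open>above k 1\<close>.\<close>

lemma card_avoiding_mult_above:
  assumes "x \<in> pts {0} UNIV" "0 < i" "i < k"
  shows "real (card {D\<in>between {0} i UNIV. \<not> x \<subseteq> D}) * above k (Suc i) =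
    above k 1 * (gb k i - gb (k - 1) (i - 1))"
proof -
  have x: "subspace x" "dim x = 1" using assms(1) by (auto simp: pts_iff)
  let ?A = "{D\<in>between {0} i UNIV. \<not> x \<subseteq> D}"
  have "(\<Sum>D\<in>?A. card {B\<in>between x k UNIV. D \<subseteq> B}) = (\<Sum>B\<in>between x k UNIV. card {D\<in>?A. D \<subseteq> B})"
    by (rule sum_card_swap) auto
  hence "(\<Sum>D\<in>?A. real (card {B\<in>between x k UNIV. D \<subseteq> B})) = (\<Sum>B\<in>between x k UNIV. real (card {D\<in>?A. D \<subseteq> B}))"
    by (simp flip: of_nat_sum)
  moreover have "real (card {B\<in>between x k UNIV. D \<subseteq> B}) = above k (Suc i)" if "D \<in> ?A" for D
  proof -
    have D: "subspace D" "dim D = i" "\<not> x \<subseteq> D" using that by (auto simp: between_iff)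
    have "{B\<in>between x k UNIV. D \<subseteq> B} = between (D + x) k UNIV"
      using plus_point(2)[OF assms(1) D(1,3)] subset_plus1[OF x(1), of D] by (fastforce simp: between_iff)
    thus ?thesis using plus_point(1)[OF assms(1) D(1,3)] D by (simp add: pts_iff card_above)
  qed
  moreover have "real (card {D\<in>?A. D \<subseteq> B}) = gb k i - gb (k - 1) (i - 1)" if "B \<in> between x k UNIV" for B
  proof -
    have "{D\<in>?A. D \<subseteq> B} = {D\<in>between {0} i B. \<not> x \<subseteq> D}" by (auto simp: between_iff)
    thus ?thesis using that assms card_between_not_ge[of x B k i] by (simp add: between_iff)
  qed
  ultimately show ?thesis using x by (simp add: card_above)
qed

end

context covering_triple_free_family
begin

section \<open>The bound\<close>

text \<open>Double counting over the \<open>i\<close>-spaces \<open>D\<close> not containing the point \<open>x\<close>.\<close>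

lemma weighted_double_count:
  fixes \<omega> :: "'b set \<Rightarrow> 'b set \<Rightarrow> real"
  assumes i: "0 < i" "i < k" and x: "x \<in> pts {0} UNIV"
    and per_member: "\<And>B. B \<in> \<F> \<Longrightarrow> gb k i - gb (k - 1) (i - 1) \<le> (\<Sum>D\<in>between {0} i B. \<omega> D B)"
    and local: "\<And>D z. subspace D \<Longrightarrow> dim D = i \<Longrightarrow> z \<in> pts D UNIV \<Longrightarrow>
      real (card {B\<in>link D. z \<subseteq> B}) + (\<Sum>B\<in>{B\<in>link D. \<not> z \<subseteq> B}. \<omega> D B) \<le> above k (Suc i)"
  shows "real (card \<F>) \<le> above k 1"
    and "real (card \<F>) = above k 1 \<Longrightarrow> B \<in> \<F> \<Longrightarrow> \<not> x \<subseteq> B \<Longrightarrow>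
      (\<Sum>D\<in>between {0} i B. \<omega> D B) = gb k i - gb (k - 1) (i - 1)"
    and "real (card \<F>) = above k 1 \<Longrightarrow> subspace D \<Longrightarrow> dim D = i \<Longrightarrow> \<not> x \<subseteq> D \<Longrightarrow> \<exists>z\<in>pts D UNIV.
      real (card {B\<in>link D. z \<subseteq> B}) + (\<Sum>B\<in>{B\<in>link D. \<not> z \<subseteq> B}. \<omega> D B) = above k (Suc i)"
proof -
  define A where "A = {D\<in>between {0} i UNIV. \<not> x \<subseteq> D}"
  \<comment> \<open>A member through x gets weight 1 on each D avoiding x, so its total is exactly
    the target \<open>d\<close>; the given weights are needed only for members off x.\<close>
  define v where "v = (\<lambda>D B. if x \<subseteq> B then 1 else \<omega> D B)"
  define d where "d = gb k i - gb (k - 1) (i - 1)"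
  have d: "0 < d" using gb_diff_pos[OF i] by (simp add: d_def)
  have AD: "subspace D" "dim D = i" "\<not> x \<subseteq> D" if "D \<in> A" for D
    using that by (auto simp: A_def between_iff)
  have link_v: "(\<Sum>B\<in>{B\<in>\<F>. D \<subseteq> B}. v D B) =
      real (card {B\<in>link D. D + x \<subseteq> B}) + (\<Sum>B\<in>{B\<in>link D. \<not> D + x \<subseteq> B}. \<omega> D B)" if D: "D \<in> A" for D
  proof -
    have "(\<Sum>B\<in>{B\<in>\<F>. D \<subseteq> B}. v D B) = (\<Sum>B\<in>link D. if D + x \<subseteq> B then 1 else \<omega> D B)"
    proof (rule sum.cong)
      fix B assume "B \<in> link D"
      note B = linkD[OF this]
      show "v D B = (if D + x \<subseteq> B then 1 else \<omega> D B)"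
        using plus_point(2)[OF x AD(1,3)[OF D] B(2,3)] by (simp add: v_def)
    qed (simp add: link_def)
    thus ?thesis by (simp add: sum.If_cases Int_def)
  qed
  have zD: "D + x \<in> pts D UNIV" if "D \<in> A" for D
    using plus_point(1)[OF x] AD[OF that] by blast
  have le: "(\<Sum>B\<in>{B\<in>\<F>. D \<subseteq> B}. v D B) \<le> above k (Suc i)" if "D \<in> A" for D
    unfolding link_v[OF that] by (intro local AD that zD)
  have sum_in: "(\<Sum>D\<in>{D\<in>A. D \<subseteq> B}. v D B) = (if x \<subseteq> B then d else (\<Sum>D\<in>between {0} i B. \<omega> D B))"
    if "B \<in> \<F>" for B
  proof (cases "x \<subseteq> B")
    case True
    have "{D\<in>A. D \<subseteq> B} = {D\<in>between {0} i B. \<not> x \<subseteq> D}" by (auto simp: A_def between_iff)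
    thus ?thesis using True familyD[OF that] i x card_between_not_ge[of x B k i] by (simp add: v_def d_def)
  next
    case False
    hence "{D\<in>A. D \<subseteq> B} = between {0} i B" unfolding A_def between_def by blast
    thus ?thesis using False by (simp add: v_def)
  qed
  have ge: "d \<le> (\<Sum>D\<in>{D\<in>A. D \<subseteq> B}. v D B)" if "B \<in> \<F>" for B
    unfolding sum_in[OF that] using per_member[OF that] by (simp add: d_def)
  have swap: "(\<Sum>D\<in>A. \<Sum>B\<in>{B\<in>\<F>. D \<subseteq> B}. v D B) = (\<Sum>B\<in>\<F>. \<Sum>D\<in>{D\<in>A. D \<subseteq> B}. v D B)"
    by (rule sum.swap_restrict) auto
  have card_A: "(\<Sum>D\<in>A. above k (Suc i)) = above k 1 * d"
    using card_avoiding_mult_above[OF x i] by (simp add: A_def d_def)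
  have 1: "(\<Sum>B\<in>\<F>. d) \<le> (\<Sum>B\<in>\<F>. \<Sum>D\<in>{D\<in>A. D \<subseteq> B}. v D B)" by (intro sum_mono ge)
  have 2: "(\<Sum>D\<in>A. \<Sum>B\<in>{B\<in>\<F>. D \<subseteq> B}. v D B) \<le> (\<Sum>D\<in>A. above k (Suc i))" by (intro sum_mono le)
  have "real (card \<F>) * d \<le> above k 1 * d" using 1 2 unfolding swap card_A by simp
  thus "real (card \<F>) \<le> above k 1" using d by simp
  assume eq: "real (card \<F>) = above k 1"
  have eq1: "(\<Sum>B\<in>\<F>. d) = (\<Sum>B\<in>\<F>. \<Sum>D\<in>{D\<in>A. D \<subseteq> B}. v D B)"
    and eq2: "(\<Sum>D\<in>A. \<Sum>B\<in>{B\<in>\<F>. D \<subseteq> B}. v D B) = (\<Sum>D\<in>A. above k (Suc i))"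
    using 1 2 eq unfolding swap card_A by simp_all
  show "(\<Sum>D\<in>between {0} i B. \<omega> D B) = gb k i - gb (k - 1) (i - 1)" if "B \<in> \<F>" "\<not> x \<subseteq> B"
  proof -
    have "d = (\<Sum>D\<in>{D\<in>A. D \<subseteq> B}. v D B)" by (rule sum_mono_inv[OF eq1 ge]) (use that in auto)
    thus ?thesis using sum_in[OF that(1)] that(2) by (simp add: d_def)
  qed
  show "\<exists>z\<in>pts D UNIV. real (card {B\<in>link D. z \<subseteq> B}) + (\<Sum>B\<in>{B\<in>link D. \<not> z \<subseteq> B}. \<omega> D B) = above k (Suc i)"
    if "subspace D" "dim D = i" "\<not> x \<subseteq> D"
  proof -
    have D: "D \<in> A" using that by (simp add: A_def between_iff subspace_0)
    have "(\<Sum>B\<in>{B\<in>\<F>. D \<subseteq> B}. v D B) = above k (Suc i)" by (rule sum_mono_inv[OF eq2 le]) (use D in auto)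
    thus ?thesis using link_v[OF D] zD[OF D] by (intro bexI[of _ "D + x"]) auto
  qed
qed

lemma ex_point_not_subset:
  assumes "subspace S" "dim S < dim UNIV"
  obtains x where "x \<in> pts {0} UNIV" "\<not> x \<subseteq> S"
proof -
  obtain v where v: "v \<notin> S" using assms by (metis UNIV_eq_I less_irrefl)
  hence "v \<noteq> 0" using assms(1) subspace_0 by metis
  hence "span (insert v {0}) \<in> pts {0} UNIV" by (intro span_insert_pts) (auto simp: subspace_0)
  moreover have "\<not> span (insert v {0}) \<subseteq> S" using v span_superset by blast
  ultimately show ?thesis using that by blast
qed

lemma ex_point: obtains x where "x \<in> pts {0} UNIV"
proof -
  have "dim ({0} :: 'b set) < dim UNIV" using k_ge_2 dim_ge by (simp del: dim_UNIV)
  thus ?thesis using ex_point_not_subset[of "{0}"] that by (metis subspace_single_0)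
qed

lemma weight_ge_1:
  assumes "safe D B" "Suc (dim D) < k" shows "1 \<le> weight D B"
proof -
  have "0 < br (k - dim D) - 1" using assms by (intro br_diff_1_pos) auto
  thus ?thesis using assms by (simp add: weight_def Let_def)
qed

lemma card_family_le: "real (card \<F>) \<le> above k 1"
proof -
  obtain x where x: "x \<in> pts {0} UNIV" by (rule ex_point)
  show ?thesis
  proof (cases "even k")
    case True
    then obtain i where i: "k = 2 * i" by blast
    show ?thesis
    proof (rule weighted_double_count(1)[of i x "\<lambda>D B. if safe D B then 1 else 0"])
      show "gb k i - gb (k - 1) (i - 1) \<le> (\<Sum>D\<in>between {0} i B. if safe D B then 1 else 0)" if "B \<in> \<F>" for B
        using card_safe_ge[OF that i] by (simp add: sum.If_cases Int_def)
      show "real (card {B\<in>link D. z \<subseteq> B}) + (\<Sum>B\<in>{B\<in>link D. \<not> z \<subseteq> B}. if safe D B then 1 else 0) \<le> above k (Suc i)"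
        if "subspace D" "dim D = i" "z \<in> pts D UNIV" for D z
        using local_bound_even(1)[OF i that] by (simp add: sum.If_cases Int_def)
    qed (use i k_ge_2 x in auto)
  next
    case False
    then obtain i where i: "k = 2 * i + 1" by (elim oddE)
    hence "0 < i" using k_ge_2 by simp
    show ?thesis
    proof (rule weighted_double_count(1)[of i x "weight"])
      show "gb k i - gb (k - 1) (i - 1) \<le> (\<Sum>D\<in>between {0} i B. weight D B)" if "B \<in> \<F>" for B
        using sum_weight_ge[OF that i \<open>0 < i\<close>] .
      show "real (card {B\<in>link D. z \<subseteq> B}) + (\<Sum>B\<in>{B\<in>link D. \<not> z \<subseteq> B}. weight D B) \<le> above k (Suc i)"
        if "subspace D" "dim D = i" "z \<in> pts D UNIV" for D z
        using local_bound_odd(1)[OF i \<open>0 < i\<close> that] .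
    qed (use i \<open>0 < i\<close> x in auto)
  qed
qed

text \<open>Equality makes every inequality of the double count an equality, whatever the point x.
  It is taken off D in the first part and off B in the second, where a B with all i-spaces safe
  would exceed the target.\<close>

lemma extremal_even:
  assumes "k = 2 * i" "real (card \<F>) = above k 1"
  shows "subspace D \<Longrightarrow> dim D = i \<Longrightarrow> \<exists>E\<in>pts D UNIV. full E"
    and "B \<in> \<F> \<Longrightarrow> \<exists>D\<in>between {0} i B. \<not> safe D B"
proof -
  let ?w = "\<lambda>D B. if safe D B then 1 else 0 :: real"
  have i: "0 < i" "i < k" using assms k_ge_2 by auto
  have per_member: "gb k i - gb (k - 1) (i - 1) \<le> (\<Sum>D\<in>between {0} i B. ?w D B)" if "B \<in> \<F>" for B
    using card_safe_ge[OF that assms(1)] by (simp add: sum.If_cases Int_def)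
  have local: "real (card {B\<in>link D. z \<subseteq> B}) + (\<Sum>B\<in>{B\<in>link D. \<not> z \<subseteq> B}. ?w D B) \<le> above k (Suc i)"
    if "subspace D" "dim D = i" "z \<in> pts D UNIV" for D z
    using local_bound_even(1)[OF assms(1) that] by (simp add: sum.If_cases Int_def)
  show "\<exists>E\<in>pts D UNIV. full E" if D: "subspace D" "dim D = i"
  proof -
    obtain x where "x \<in> pts {0} UNIV" "\<not> x \<subseteq> D"
      using ex_point_not_subset[OF D(1)] D(2) i dim_ge by (auto simp del: dim_UNIV)
    then obtain z where z: "z \<in> pts D UNIV"
      "real (card {B\<in>link D. z \<subseteq> B}) + (\<Sum>B\<in>{B\<in>link D. \<not> z \<subseteq> B}. ?w D B) = above k (Suc i)"
      using weighted_double_count(3)[OF i _ per_member local assms(2) D] by blast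
    thus ?thesis using local_bound_even(2)[OF assms(1) D z(1)] by (simp add: sum.If_cases Int_def)
  qed
  show "\<exists>D\<in>between {0} i B. \<not> safe D B" if B: "B \<in> \<F>"
  proof (rule ccontr)
    assume "\<not> ?thesis"
    hence "(\<Sum>D\<in>between {0} i B. ?w D B) = (\<Sum>D\<in>between {0} i B. 1)" by (intro sum.cong) auto
    also have "\<dots> = gb k i"
      using card_between[of "{0}" B i] familyD[OF B] i by (simp add: subspace_0)
    finally have "gb k i = (\<Sum>D\<in>between {0} i B. ?w D B)" by simp
    moreover obtain x where "x \<in> pts {0} UNIV" "\<not> x \<subseteq> B"
      using ex_point_not_subset[of B] familyD[OF B] k_ge_2 dim_ge by (auto simp del: dim_UNIV)
    hence "(\<Sum>D\<in>between {0} i B. ?w D B) = gb k i - gb (k - 1) (i - 1)"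
      using weighted_double_count(2)[OF i _ per_member local assms(2) B] by blast
    moreover have "0 < gb (k - 1) (i - 1)" using i by (intro gb_pos) auto
    ultimately show False by simp
  qed
qed

text \<open>As for even k; in the second part each safe D weighs at least 1, so a B without unsafe
  i-spaces is again too heavy.\<close>

lemma extremal_odd:
  assumes "k = 2 * i + 1" "real (card \<F>) = above k 1"
  shows "subspace D \<Longrightarrow> dim D = i \<Longrightarrow>
      \<exists>y\<in>pts D UNIV. \<forall>E\<in>pts D UNIV. E \<noteq> y \<longrightarrow> (\<exists>L\<in>pts E UNIV. full L)"
    and "B \<in> \<F> \<Longrightarrow> \<exists>D\<in>between {0} i B. \<not> safe D B"
proof -
  have i: "0 < i" "i < k" using assms k_ge_2 by auto
  have per_member: "gb k i - gb (k - 1) (i - 1) \<le> (\<Sum>D\<in>between {0} i B. weight D B)" if "B \<in> \<F>" for B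
    using sum_weight_ge[OF that assms(1) i(1)] .
  have local: "real (card {B\<in>link D. z \<subseteq> B}) + (\<Sum>B\<in>{B\<in>link D. \<not> z \<subseteq> B}. weight D B) \<le> above k (Suc i)"
    if "subspace D" "dim D = i" "z \<in> pts D UNIV" for D z
    using local_bound_odd(1)[OF assms(1) i(1) that] .
  show "\<exists>y\<in>pts D UNIV. \<forall>E\<in>pts D UNIV. E \<noteq> y \<longrightarrow> (\<exists>L\<in>pts E UNIV. full L)" if D: "subspace D" "dim D = i"
  proof -
    obtain x where "x \<in> pts {0} UNIV" "\<not> x \<subseteq> D"
      using ex_point_not_subset[OF D(1)] D(2) i dim_ge by (auto simp del: dim_UNIV)
    then obtain z where z: "z \<in> pts D UNIV"
      "real (card {B\<in>link D. z \<subseteq> B}) + (\<Sum>B\<in>{B\<in>link D. \<not> z \<subseteq> B}. weight D B) = above k (Suc i)"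
      using weighted_double_count(3)[OF i _ per_member local assms(2) D] by blast
    thus ?thesis by (intro local_bound_odd(2)[OF assms(1) i(1) D])
  qed
  show "\<exists>D\<in>between {0} i B. \<not> safe D B" if B: "B \<in> \<F>"
  proof (rule ccontr)
    assume "\<not> ?thesis"
    hence "(\<Sum>D\<in>between {0} i B. 1) \<le> (\<Sum>D\<in>between {0} i B. weight D B)"
      using assms i by (intro sum_mono weight_ge_1) (auto simp: between_iff)
    moreover have "(\<Sum>D\<in>between {0} i B. 1 :: real) = gb k i"
      using card_between[of "{0}" B i] familyD[OF B] i by (simp add: subspace_0)
    moreover obtain x where "x \<in> pts {0} UNIV" "\<not> x \<subseteq> B"
      using ex_point_not_subset[of B] familyD[OF B] k_ge_2 dim_ge by (auto simp del: dim_UNIV)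
    hence "(\<Sum>D\<in>between {0} i B. weight D B) = gb k i - gb (k - 1) (i - 1)"
      using weighted_double_count(2)[OF i _ per_member local assms(2) B] by blast
    moreover have "0 < gb (k - 1) (i - 1)" using i by (intro gb_pos) auto
    ultimately show False by simp
  qed
qed

end

section \<open>Subspaces in general position\<close>

context finite_vector_space
begin

text \<open>B grows by vectors outside \<open>B + S\<close>, so its intersection with S never
  does.\<close>

lemma subspace_extension_Int:
  assumes "subspace L" "subspace S" "L \<subseteq> S" "dim S + d \<le> dim UNIV"
  shows "\<exists>B. subspace B \<and> L \<subseteq> B \<and> dim B = dim L + d \<and> B \<inter> S = L"
  using assms(4)
proof (induction d)
  case 0
  thus ?case using assms by (intro exI[of _ L]) auto
next
  case (Suc d)
  then obtain B where B: "subspace B" "L \<subseteq> B" "dim B = dim L + d" "B \<inter> S = L" by auto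
  have "dim (B + S) < dim UNIV" using dim_plus[OF B(1) assms(2)] B Suc by simp
  hence "B + S \<noteq> UNIV" by auto
  then obtain v where v: "v \<notin> B + S" by blast
  have BS: "subspace (B + S)" "B \<subseteq> B + S" "S \<subseteq> B + S"
    using B assms by (auto intro: subspace_plus subset_plus1[THEN subsetD] subset_plus2[THEN subsetD])
  hence E: "span (insert v B) \<in> pts B UNIV" using B v by (intro span_insert_pts) auto
  have "\<not> span (insert v B) \<subseteq> B + S" using v span_superset by blast
  hence "(B + S) \<inter> span (insert v B) = B"
    using E B BS by (intro subspace_between_Int) (auto simp: pts_iff)
  hence "span (insert v B) \<inter> S = B \<inter> S" using BS E by (auto simp: pts_iff)
  thus ?case using E B by (intro exI[of _ "span (insert v B)"]) (auto simp: pts_iff)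
qed

text \<open>Three proper subspaces can cover a space when q = 2, two never can; the generic choices
  below therefore avoid two subspaces at a time.\<close>

lemma ex_not_in_two_subspaces:
  assumes "subspace S" "subspace T" "S \<noteq> UNIV" "T \<noteq> UNIV"
  obtains v where "v \<notin> S" "v \<notin> T"
proof -
  obtain a b where ab: "a \<notin> S" "b \<notin> T" using assms by blast
  show ?thesis
  proof (cases "a \<in> T \<and> b \<in> S")
    case True
    hence "a + b \<notin> S" "a + b \<notin> T"
      using ab assms by (metis add_diff_cancel_right' subspace_diff, metis add_diff_cancel_left' subspace_diff)
    thus ?thesis using that by blast
  qed (use ab that in blast)
qed

lemma span_insert_Int:
  assumes "subspace D" "subspace U" "D \<inter> U = {0}" "v \<notin> D + U"
  shows "span (insert v D) \<in> pts D UNIV" "span (insert v D) \<inter> U = {0}"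
proof -
  have DU: "subspace (D + U)" "D \<subseteq> D + U" "U \<subseteq> D + U"
    using assms by (auto intro: subspace_plus subset_plus1[THEN subsetD] subset_plus2[THEN subsetD])
  show E: "span (insert v D) \<in> pts D UNIV" using assms DU by (intro span_insert_pts) auto
  have "\<not> span (insert v D) \<subseteq> D + U" using assms(4) span_superset by blast
  hence "(D + U) \<inter> span (insert v D) = D"
    using E assms DU by (intro subspace_between_Int) (auto simp: pts_iff)
  thus "span (insert v D) \<inter> U = {0}" using DU(3) assms(3) by blast
qed

lemma plus_ne_UNIV:
  assumes "subspace D" "subspace U" "dim D + dim U < dim UNIV" shows "D + U \<noteq> UNIV"
proof
  assume "D + U = UNIV"
  thus False using dim_plus[OF assms(1,2)] assms(3) by (simp del: dim_UNIV)
qed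

lemma ex_disjoint_from_two:
  assumes "subspace U" "subspace W" "dim U + d \<le> dim UNIV" "dim W + d \<le> dim UNIV"
  shows "\<exists>D. subspace D \<and> dim D = d \<and> D \<inter> U = {0} \<and> D \<inter> W = {0}"
  using assms(3,4)
proof (induction d)
  case 0
  thus ?case using assms subspace_0 by (intro exI[of _ "{0}"]) (auto simp: subspace_0)
next
  case (Suc d)
  then obtain D where D: "subspace D" "dim D = d" "D \<inter> U = {0}" "D \<inter> W = {0}" by auto
  obtain v where "v \<notin> D + U" "v \<notin> D + W"
    using ex_not_in_two_subspaces[of "D + U" "D + W"] plus_ne_UNIV[of D U] plus_ne_UNIV[of D W]
      subspace_plus D assms Suc.prems by (metis Suc_le_lessD add.commute add_Suc_right)
  thus ?case using span_insert_Int[OF D(1) assms(1) D(3)] span_insert_Int[OF D(1) assms(2) D(4)] D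
    by (intro exI[of _ "span (insert v D)"]) (auto simp: pts_iff)
qed

text \<open>E has codimension 1 in L and misses U, so L meets U in at most a point, and the nonzero
  T must be that point.\<close>

lemma point_eq_Int:
  assumes "subspace E" "L \<in> pts E UNIV" "subspace U" "E \<inter> U = {0}"
    and "subspace T" "T \<subseteq> L" "T \<subseteq> U" "T \<noteq> {0}"
  shows "T = L \<inter> U" "dim T = 1"
proof -
  have L: "subspace L" "E \<subseteq> L" "dim L = Suc (dim E)" using assms by (auto simp: pts_iff)
  have LU: "subspace (L \<inter> U)" using L assms by (simp add: subspace_inter)
  have "E \<inter> (L \<inter> U) = {0}" using assms(4) L by blast
  hence "dim E + dim (L \<inter> U) = dim (E + (L \<inter> U))"
    using dim_plus[OF assms(1) LU] by simp
  also have "\<dots> \<le> dim L" using L by (intro dim_subset plus_subsetI) auto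
  finally have le: "dim (L \<inter> U) \<le> 1" using L by simp
  have "dim T \<noteq> 0" using zero_in_dim[OF assms(5)] assms(8) by blast
  moreover have "dim T \<le> dim (L \<inter> U)" using assms by (intro dim_subset) auto
  ultimately show "dim T = 1" using le by linarith
  have "dim (L \<inter> U) \<le> dim T" using le \<open>dim T \<noteq> 0\<close> by linarith
  thus "T = L \<inter> U" using assms(6,7) by (intro subspace_eqI[OF assms(5) LU]) auto
qed

end

context covering_triple_free_family
begin

section \<open>Uniqueness\<close>

text \<open>If \<open>L \<inter> L' = 0\<close>, then \<open>L + M\<close>, another \<open>k\<close>-space through \<open>L\<close>, and \<open>L' + M\<close> would be a covering triple.\<close>

lemma full_Int_nonzero:
  assumes L: "full L" "subspace L" "dim L = f" and L': "full L'" "subspace L'" "dim L' = f"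
    and f: "0 < f" "f < k"
  shows "L \<inter> L' \<noteq> {0}"
proof
  assume LL: "L \<inter> L' = {0}"
  have sub: "subspace (L + L')" "L \<subseteq> L + L'" "L' \<subseteq> L + L'"
    using L L' by (auto intro: subspace_plus subset_plus1[THEN subsetD] subset_plus2[THEN subsetD])
  have "dim (L + L') = 2 * f" using dim_plus[OF L(2) L'(2)] L L' LL by simp
  hence "\<exists>M. subspace M \<and> {0} \<subseteq> M \<and> dim M = dim {0} + (k - f) \<and> M \<inter> (L + L') = {0}"
    using sub dim_ge f subspace_0[OF sub(1)] by (intro subspace_extension_Int) (auto simp del: dim_UNIV)
  then obtain M where M: "subspace M" "dim M = k - f" "M \<inter> (L + L') = {0}" by auto
  have LM: "L \<inter> M = {0}" "L' \<inter> M = {0}"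
    using M sub subspace_0[OF L(2)] subspace_0[OF L'(2)] subspace_0[OF M(1)] by blast+
  define A C where "A = L + M" and "C = L' + M"
  have A: "subspace A" "L \<subseteq> A" "M \<subseteq> A" "dim A = k"
    using dim_plus[OF L(2) M(1)] LM L M f subset_plus1[OF M(1), of L] subset_plus2[OF L(2), of M]
    by (simp_all add: A_def subspace_plus)
  have C: "subspace C" "L' \<subseteq> C" "M \<subseteq> C" "dim C = k"
    using dim_plus[OF L'(2) M(1)] LM L' M f subset_plus1[OF M(1), of L'] subset_plus2[OF L'(2), of M]
    by (simp_all add: C_def subspace_plus)
  have AC: "A \<inter> C = M"
  proof (intro equalityI subsetI)
    fix v assume v: "v \<in> A \<inter> C"
    obtain l m where lm: "v = l + m" "l \<in> L" "m \<in> M" using v unfolding A_def by (auto elim: set_plus_elim)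
    obtain l' m' where lm': "v = l' + m'" "l' \<in> L'" "m' \<in> M" using v unfolding C_def by (auto elim: set_plus_elim)
    have "l + m = l' + m'" using lm(1) lm'(1) by simp
    hence "l - l' = m' - m" by (simp add: algebra_simps)
    moreover have "l - l' \<in> L + L'" using lm lm' sub by (intro subspace_diff) auto
    moreover have "m' - m \<in> M" using lm lm' M by (intro subspace_diff) auto
    ultimately have "l - l' \<in> M \<inter> (L + L')" by simp
    hence "l = l'" using M(3) by simp
    hence "l = 0" using lm lm' LL by blast
    thus "v \<in> M" using lm by simp
  qed (use A C in auto)
  have "\<exists>B. subspace B \<and> L \<subseteq> B \<and> dim B = dim L + (k - f) \<and> B \<inter> A = L"
    using L A f dim_ge by (intro subspace_extension_Int) (auto simp del: dim_UNIV)
  then obtain B where B: "subspace B" "L \<subseteq> B" "dim B = k" "A \<inter> B = L"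
    using L f by (auto simp: Int_commute)
  have "A \<in> between L k UNIV" "B \<in> between L k UNIV" "C \<in> between L' k UNIV"
    using A B C by (simp_all add: between_iff)
  hence "A \<in> \<F>" "B \<in> \<F>" "C \<in> \<F>" using L(1) L'(1) unfolding full_def by blast+
  moreover have "A \<noteq> B" using B(4) A(4) L(3) f(2) by (metis Int_absorb less_irrefl)
  moreover have "dim M < k" using M(2) f by simp
  hence "A \<noteq> C" using AC A(4) by (metis Int_absorb less_irrefl)
  moreover have "B \<noteq> C"
  proof
    assume "B = C"
    hence "L = M" using B(4) AC by simp
    hence "L = {0}" using LM(1) by simp
    thus False using L(3) f(1) by simp
  qed
  moreover have "A \<inter> B \<inter> C = {0}" using B AC LM by blast
  moreover have "dim (A \<inter> B) + dim (A \<inter> C) = k" using B AC L M f by simp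
  ultimately show False by (rule no_covering_triple)
qed

text \<open>A full space over an E in general position meets given full spaces in single points;
  comparing these points identifies y and puts it into every full space of this kind. One exception
  per D is allowed because odd k yields no more. The requirement 3e + 1 < n is the room for an
  e-space generic to \<open>L0 + L1\<close>, of dimension 2e + 1.\<close>

lemma ex_full_point:
  assumes e: "0 < e" "e + 1 < k" "3 * e + 1 < dim UNIV"
    and H: "\<And>D. subspace D \<Longrightarrow> dim D = e - 1 \<Longrightarrow> \<exists>y. \<forall>E\<in>pts D UNIV. E \<noteq> y \<longrightarrow> (\<exists>L\<in>pts E UNIV. full L)"
  shows "\<exists>y\<in>pts {0} UNIV. full y"
proof -
  have generic: "\<exists>E L. subspace E \<and> dim E = e \<and> E \<inter> U = {0} \<and> E \<inter> W = {0} \<and> L \<in> pts E UNIV \<and> full L"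
    if U: "subspace U" "dim U + e < dim UNIV" and W: "subspace W" "dim W + e < dim UNIV" for U W
  proof -
    have "dim U + (e - 1) \<le> dim UNIV" "dim W + (e - 1) \<le> dim UNIV" using U(2) W(2) by linarith+
    then obtain D where D: "subspace D" "dim D = e - 1" "D \<inter> U = {0}" "D \<inter> W = {0}"
      using ex_disjoint_from_two[OF U(1) W(1), of "e - 1"] by blast
    obtain y where y: "\<And>E. E \<in> pts D UNIV \<Longrightarrow> E \<noteq> y \<Longrightarrow> \<exists>L\<in>pts E UNIV. full L"
      using H[OF D(1,2)] by blast
    obtain v where v: "v \<notin> D + U" "v \<notin> D + W"
      using ex_not_in_two_subspaces[OF subspace_plus[OF D(1) U(1)] subspace_plus[OF D(1) W(1)]]
        plus_ne_UNIV[OF D(1) U(1)] plus_ne_UNIV[OF D(1) W(1)] D U W by (auto simp del: dim_UNIV)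
    define E where "E = span (insert v D)"
    have E: "E \<in> pts D UNIV" "E \<inter> U = {0}" "E \<inter> W = {0}"
      using span_insert_Int[OF D(1) U(1) D(3) v(1)] span_insert_Int[OF D(1) W(1) D(4) v(2)] by (auto simp: E_def)
    hence Es: "subspace E" "D \<subseteq> E" "dim E = e" using D e by (auto simp: pts_iff)
    obtain w where w: "w \<notin> E + U" "w \<notin> E + W"
      using ex_not_in_two_subspaces[OF subspace_plus[OF Es(1) U(1)] subspace_plus[OF Es(1) W(1)]]
        plus_ne_UNIV[OF Es(1) U(1)] plus_ne_UNIV[OF Es(1) W(1)] Es U W by (auto simp del: dim_UNIV)
    \<comment> \<open>A second candidate over the same D, in case E is the exceptional one.\<close>
    define E' where "E' = span (insert w D)"
    have "D + U \<subseteq> E + U" "D + W \<subseteq> E + W" using Es(2) by (auto intro: set_plus_mono2[THEN subsetD])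
    hence "w \<notin> D + U" "w \<notin> D + W" using w by blast+
    hence E': "E' \<in> pts D UNIV" "E' \<inter> U = {0}" "E' \<inter> W = {0}"
      using span_insert_Int[OF D(1) U(1) D(3)] span_insert_Int[OF D(1) W(1) D(4)] by (auto simp: E'_def)
    hence Es': "subspace E'" "dim E' = e" using D e by (auto simp: pts_iff)
    have "w \<in> E'" by (simp add: E'_def span_base)
    moreover have "w \<notin> E" using w subset_plus1[OF U(1), of E] by blast
    ultimately have "E \<noteq> E'" by blast
    hence "(\<exists>L\<in>pts E UNIV. full L) \<or> (\<exists>L\<in>pts E' UNIV. full L)" using y E E' by metis
    thus ?thesis using E E' Es Es' by blast
  qed
  have z: "subspace {0 :: 'b}" by (rule subspace_single_0)
  have fullInt: "L \<inter> L' \<noteq> {0}"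
    if "full L" "L \<in> pts E UNIV" "dim E = e" "full L'" "L' \<in> pts E' UNIV" "dim E' = e" for L L' E E'
    using full_Int_nonzero[of L "Suc e" L'] that e by (auto simp: pts_iff)
  obtain E0 L0 where E0: "dim E0 = e" "L0 \<in> pts E0 UNIV" "full L0"
    using generic[OF z _ z] e by (auto simp del: dim_UNIV)
  have L0: "subspace L0" "dim L0 = e + 1" using E0 by (auto simp: pts_iff)
  obtain E1 L1 where E1: "subspace E1" "dim E1 = e" "E1 \<inter> L0 = {0}" "L1 \<in> pts E1 UNIV" "full L1"
    using generic[OF L0(1) _ L0(1)] L0(2) e by (auto simp del: dim_UNIV)
  have L1: "subspace L1" "dim L1 = e + 1" using E1 by (auto simp: pts_iff)
  define y where "y = L1 \<inter> L0"
  have y: "subspace y" "y \<subseteq> L0" "y \<subseteq> L1" "y \<noteq> {0}"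
    using L0 L1 fullInt[OF E1(5,4,2) E0(3,2,1)] by (auto simp: y_def subspace_inter)
  have dy: "dim y = 1" using point_eq_Int(2)[OF E1(1,4) L0(1) E1(3) y(1,3,2,4)] .
  have y_in: "y \<subseteq> L" if E: "subspace E" "dim E = e" and L: "L \<in> pts E UNIV" "full L" for E L
  proof -
    have Ls: "subspace L" "dim L = e + 1" using E L by (auto simp: pts_iff)
    \<comment> \<open>A full \<open>L2\<close> over an \<open>E2\<close> missing both U and W meets
      each of them in one point. Inside U this point lies on \<open>L0\<close> and
      \<open>L1\<close>, so it is y; inside W it lies on L.\<close>
    define U where "U = L0 + L1"
    define W where "W = L + y"
    have U: "subspace U" "L0 \<subseteq> U" "L1 \<subseteq> U" "dim U = 2 * e + 1"
      using L0 L1 dy dim_plus[OF L0(1) L1(1)] unfolding y_def U_def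
      by (auto simp: Int_commute intro: subspace_plus subset_plus1[THEN subsetD] subset_plus2[THEN subsetD])
    have W: "subspace W" "L \<subseteq> W" "y \<subseteq> W" "dim W \<le> e + 2"
      using Ls y dy dim_plus[OF Ls(1) y(1)] unfolding W_def
      by (auto intro: subspace_plus subset_plus1[THEN subsetD] subset_plus2[THEN subsetD])
    obtain E2 L2 where E2: "subspace E2" "dim E2 = e" "E2 \<inter> U = {0}" "E2 \<inter> W = {0}" "L2 \<in> pts E2 UNIV" "full L2"
      using generic[OF U(1) _ W(1)] U W e by (auto simp del: dim_UNIV)
    have L2: "subspace L2" using E2 by (auto simp: pts_iff)
    have "L2 \<inter> L0 = L2 \<inter> U" "dim (L2 \<inter> L0) = 1"
      using point_eq_Int[OF E2(1,5) U(1) E2(3), of "L2 \<inter> L0"] U L2 L0 fullInt[OF E2(6,5,2) E0(3,2,1)]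
      by (auto simp: subspace_inter)
    moreover have "L2 \<inter> L1 = L2 \<inter> U"
      using point_eq_Int(1)[OF E2(1,5) U(1) E2(3), of "L2 \<inter> L1"] U L2 L1 fullInt[OF E2(6,5,2) E1(5,4,2)]
      by (auto simp: subspace_inter)
    ultimately have "L2 \<inter> U \<subseteq> y" "dim (L2 \<inter> U) = 1" by (auto simp: y_def)
    hence "L2 \<inter> U = y" using y dy L2 U by (intro subspace_eqI) (auto simp: subspace_inter)
    hence "y \<subseteq> L2" by blast
    hence "y = L2 \<inter> W" using point_eq_Int(1)[OF E2(1,5) W(1) E2(4) y(1) _ W(3) y(4)] by blast
    moreover have "L2 \<inter> L = L2 \<inter> W"
      using point_eq_Int(1)[OF E2(1,5) W(1) E2(4), of "L2 \<inter> L"] W L2 Ls fullInt[OF E2(6,5,2) L(2,1) E(2)]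
      by (auto simp: subspace_inter)
    ultimately show ?thesis by blast
  qed
  have "y \<in> pts {0} UNIV" using y dy subspace_0[OF y(1)] by (simp add: pts_iff)
  moreover have "full y"
    unfolding full_def
  proof
    fix C assume "C \<in> between y k UNIV"
    hence C: "subspace C" "y \<subseteq> C" "dim C = k" by (auto simp: between_iff)
    \<comment> \<open>Working in a hyperplane of C off y ensures that y is not in E; the full space
      over E, which contains y, is then \<open>E + y\<close> and lies in C.\<close>
    have "0 < real (card {M\<in>between {0} (k - 1) C. \<not> y \<subseteq> M})"
      using card_between_not_ge[OF \<open>y \<in> pts {0} UNIV\<close> C, of "k - 1"] gb_diff_pos[of "k - 1" k] k_ge_2 by simp
    then obtain M where M: "subspace M" "M \<subseteq> C" "dim M = k - 1" "\<not> y \<subseteq> M"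
      by (fastforce simp: card_gt_0_iff between_iff)
    have "0 < real (card (between {0} (e - 1) M))"
      using card_between[OF z M(1), of "e - 1"] M e subspace_0[OF M(1)] gb_pos[of "e - 1" "k - 1"] by simp
    then obtain D where D: "subspace D" "D \<subseteq> M" "dim D = e - 1"
      by (fastforce simp: card_gt_0_iff between_iff)
    obtain w where w: "\<And>E. E \<in> pts D UNIV \<Longrightarrow> E \<noteq> w \<Longrightarrow> \<exists>L\<in>pts E UNIV. full L"
      using H[OF D(1,3)] by blast
    have "real (card (pts D M)) = br (k - e)" using card_pts[OF D(1) M(1) D(2)] D M e by simp
    moreover have "br 2 \<le> br (k - e)" using e by (intro br_mono) auto
    moreover have "br 2 = q + 1" using br_Suc[of "Suc 0"] by (simp add: numeral_2_eq_2)
    ultimately have "1 < card (pts D M)" using q_ge2 by linarith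
    moreover have "card (pts D M) \<le> 1" if "pts D M \<subseteq> {w}"
      using card_mono[OF _ that] by simp
    ultimately obtain E where E: "E \<in> pts D M" "E \<noteq> w" by fastforce
    hence Es: "subspace E" "E \<subseteq> M" "dim E = e" "E \<in> pts D UNIV" using D e by (auto simp: pts_iff)
    obtain L where L: "L \<in> pts E UNIV" "full L" using w[OF Es(4) E(2)] by blast
    have "\<not> y \<subseteq> E" using Es M by blast
    hence "E + y \<in> pts E UNIV" using plus_point(1)[OF \<open>y \<in> pts {0} UNIV\<close> Es(1)] by blast
    moreover have "E + y \<subseteq> L" using y_in[OF Es(1,3) L] L by (intro plus_subsetI) (auto simp: pts_iff)
    ultimately have "E + y = L" using L by (intro subspace_eqI) (auto simp: pts_iff)
    moreover have "E + y \<subseteq> C" using Es M C by (intro plus_subsetI) auto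
    ultimately have "C \<in> between L k UNIV" using C by (simp add: between_iff)
    thus "C \<in> \<F>" using L by (auto simp: full_def)
  qed
  ultimately show ?thesis by blast
qed

end

section \<open>Equality for k <= 3: counting hyperplanes of members\<close>

context finite_vector_space
begin

lemma gb_1 [simp]: "gb m (Suc 0) = br m"
  using gb_Suc[of m 0] by simp

text \<open>The (k-1)-spaces are split according to whether they contain x. The right side is
  arranged as the size of an extremal family times the least total weight of a member in
  \<open>extremal_hyperplanes\<close>.\<close>

lemma card_hyperplane_sections:
  assumes "2 \<le> k" "2 * k \<le> dim UNIV" "x \<in> pts {0} UNIV"
  shows "real (card (between {0} (k - 1) UNIV)) =
    above k 1 * (br k - br (k - 1) * (1 - 1 / br (dim UNIV - k + 1)))"
proof -
  let ?b = "br (dim UNIV - k + 1)"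
  have x: "subspace x" "dim x = 1" using assms(3) by (auto simp: pts_iff)
  obtain j where k: "k = Suc (Suc j)" using assms(1) by (metis Suc_le_D numeral_2_eq_2 Suc_le_mono)
  have "{D\<in>between {0} (k - 1) UNIV. \<not> x \<subseteq> D} = between {0} (k - 1) UNIV - between x (k - 1) UNIV"
    using subspace_0 by (auto simp: between_iff)
  moreover have "between x (k - 1) UNIV \<subseteq> between {0} (k - 1) UNIV" using subspace_0 by (auto simp: between_iff)
  ultimately have "real (card {D\<in>between {0} (k - 1) UNIV. \<not> x \<subseteq> D}) =
      real (card (between {0} (k - 1) UNIV)) - real (card (between x (k - 1) UNIV))"
    by (simp add: card_Diff_subset card_mono of_nat_diff)
  moreover have "real (card {D\<in>between {0} (k - 1) UNIV. \<not> x \<subseteq> D}) = above k 1 * (br k - br (k - 1))"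
    using card_avoiding_mult_above[OF assms(3), of "k - 1" k] gb_pred[of "Suc j"] gb_pred[of j] k
    by (simp add: above_def)
  moreover have "real (card (between x (k - 1) UNIV)) = gb (dim UNIV - 1) j"
    using x k by (simp add: card_above above_def)
  ultimately have c: "real (card (between {0} (k - 1) UNIV)) = above k 1 * (br k - br (k - 1)) + gb (dim UNIV - 1) j"
    by simp
  have "above k 1 = gb (dim UNIV - 1) (Suc j)" using k by (simp add: above_def)
  hence "above k 1 * br (k - 1) = gb (dim UNIV - 1) j * br (dim UNIV - 1 - j)"
    using gb_Suc[of "dim UNIV - 1" j] gb_compl[of "dim UNIV - 1" j] k by (simp add: mult.commute)
  moreover have "dim UNIV - 1 - j = dim UNIV - k + 1" using k assms(2) by (simp del: dim_UNIV)
  ultimately have "gb (dim UNIV - 1) j = above k 1 * br (k - 1) / ?b" by simp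
  thus ?thesis unfolding c by (simp add: algebra_simps)
qed

end

context covering_triple_free_family
begin

text \<open>Two different k-spaces through a (k-1)-space M meet exactly in M.\<close>

lemma hyperplane_unsafe_iff:
  assumes "M \<in> between {0} (k - 1) UNIV" "B \<in> link M"
  shows "\<not> safe M B \<longleftrightarrow> (\<exists>C\<in>link M. C \<noteq> B)"
proof -
  note B = linkD[OF assms(2)]
  have M: "subspace M" "dim M = k - 1" using assms(1) by (auto simp: between_iff)
  have "B \<inter> C = M \<longleftrightarrow> M \<subseteq> C \<and> C \<noteq> B" if C: "C \<in> \<F>" for C
  proof
    assume BC: "B \<inter> C = M"
    have "M \<noteq> B" using M B k_ge_2 by auto
    thus "M \<subseteq> C \<and> C \<noteq> B" using BC by auto
  next
    note Cs = familyD[OF C]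
    assume MC: "M \<subseteq> C \<and> C \<noteq> B"
    have sub: "subspace (B \<inter> C)" using B Cs by (simp add: subspace_inter)
    have "dim (B \<inter> C) \<le> dim M"
    proof (rule ccontr)
      assume "\<not> dim (B \<inter> C) \<le> dim M"
      hence d: "k \<le> dim (B \<inter> C)" using M k_ge_2 by simp
      hence "B \<inter> C = B" using sub B by (intro subspace_eqI) auto
      moreover have "B \<inter> C = C" using sub Cs d by (intro subspace_eqI) auto
      ultimately show False using MC by blast
    qed
    hence "M = B \<inter> C" using M sub B MC by (intro subspace_eqI) auto
    thus "B \<inter> C = M" by simp
  qed
  thus ?thesis by (auto simp: safe_def link_def)
qed

text \<open>There are b spaces of dimension k through M. A member that is safe at M is the only
  member through M; otherwise at most b members share M, each with weight
  \<open>1 / b\<close>.\<close>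

lemma sum_hyperplane_weight_le:
  assumes M: "M \<in> between {0} (k - 1) UNIV"
  defines "b \<equiv> br (dim UNIV - k + 1)"
  shows "(\<Sum>B\<in>link M. if safe M B then 1 else 1 / b) \<le> 1"
    and "(\<Sum>B\<in>link M. if safe M B then 1 else 1 / b) = 1 \<Longrightarrow> B \<in> link M \<Longrightarrow> \<not> safe M B \<Longrightarrow> full M"
proof -
  have Ms: "subspace M" "dim M = k - 1" using M by (auto simp: between_iff)
  have b: "0 < b" unfolding b_def by (intro br_pos) simp
  have "(\<Sum>B\<in>link M. if safe M B then 1 else 1 / b) \<le> 1 \<and>
    ((\<Sum>B\<in>link M. if safe M B then 1 else 1 / b) = 1 \<longrightarrow> B \<in> link M \<longrightarrow> \<not> safe M B \<longrightarrow> full M)" for B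
  proof (cases "\<exists>C\<in>link M. safe M C")
    case True
    then obtain C where C: "C \<in> link M" "safe M C" by blast
    hence "link M = {C}" using hyperplane_unsafe_iff[OF M C(1)] by blast
    thus ?thesis using C by auto
  next
    case False
    hence s: "(\<Sum>B\<in>link M. if safe M B then 1 else 1 / b) = real (card (link M)) / b" by simp
    have "dim UNIV - (k - 1) = dim UNIV - k + 1" using dim_ge k_ge_2 by (simp del: dim_UNIV)
    hence c: "real (card (between M k UNIV)) = b"
      using Ms k_ge_2 by (simp add: card_above above_def b_def del: dim_UNIV)
    have "card (link M) \<le> card (between M k UNIV)" using link_subset by (intro card_mono) auto
    moreover have "full M" if "card (link M) = card (between M k UNIV)"
      using card_subset_eq[OF _ link_subset that] linkD(1)[of _ M] unfolding full_def by auto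
    ultimately show ?thesis unfolding s using b c by (auto simp: divide_le_eq)
  qed
  thus "(\<Sum>B\<in>link M. if safe M B then 1 else 1 / b) \<le> 1"
    "(\<Sum>B\<in>link M. if safe M B then 1 else 1 / b) = 1 \<Longrightarrow> B \<in> link M \<Longrightarrow> \<not> safe M B \<Longrightarrow> full M"
    by blast+
qed

text \<open>If the unsafe hyperplanes of every member pass through a point, the counting of pairs
  \<open>(M, B)\<close> below is sharp for a star.\<close>

lemma extremal_hyperplanes:
  assumes p: "\<And>B. B \<in> \<F> \<Longrightarrow> \<exists>p\<in>between {0} 1 B. \<forall>M\<in>between {0} (k - 1) B. \<not> safe M B \<longrightarrow> p \<subseteq> M"
    and eq: "real (card \<F>) = above k 1"
  shows "B \<in> link M \<Longrightarrow> M \<in> between {0} (k - 1) UNIV \<Longrightarrow> \<not> safe M B \<Longrightarrow> full M"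
    and "B \<in> \<F> \<Longrightarrow> \<exists>p\<in>between {0} 1 B. \<forall>M\<in>between p (k - 1) B. \<not> safe M B"
proof -
  define b where "b = br (dim UNIV - k + 1)"
  define u where "u = (\<lambda>M B. if safe M B then 1 else 1 / b)"
  define hp where "hp = between {0} (k - 1) (UNIV :: 'b set)"
  define c where "c = br k - br (k - 1) * (1 - 1 / b)"
  have "1 < br 2" using br_Suc[of "Suc 0"] q_ge2 by (simp add: numeral_2_eq_2)
  also have "br 2 \<le> b" unfolding b_def using dim_ge k_ge_2 by (intro br_mono) (simp del: dim_UNIV)
  finally have b: "0 < 1 - 1 / b" by simp
  have unsafe_le: "{M\<in>between {0} (k - 1) B. \<not> safe M B} \<subseteq> between p (k - 1) B"
    and card_p: "real (card (between p (k - 1) B)) = br (k - 1)"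
    if "B \<in> \<F>" "p \<in> between {0} 1 B" "\<forall>M\<in>between {0} (k - 1) B. \<not> safe M B \<longrightarrow> p \<subseteq> M" for B p
  proof -
    show "{M\<in>between {0} (k - 1) B. \<not> safe M B} \<subseteq> between p (k - 1) B"
      using that(3) unfolding between_def by blast
    have "dim B = Suc (k - 1)" using familyD[OF that(1)] k_ge_2 by simp
    thus "real (card (between p (k - 1) B)) = br (k - 1)"
      using card_hyperplanes_between[of p B "k - 1"] that(2) familyD[OF that(1)] by (simp add: between_iff)
  qed
  have sum_u: "(\<Sum>M\<in>{M\<in>hp. M \<subseteq> B}. u M B) =
      br k - real (card {M\<in>between {0} (k - 1) B. \<not> safe M B}) * (1 - 1 / b)" if B: "B \<in> \<F>" for B
  proof -
    have "{M\<in>hp. M \<subseteq> B} = between {0} (k - 1) B" by (auto simp: hp_def between_iff)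
    hence "(\<Sum>M\<in>{M\<in>hp. M \<subseteq> B}. u M B) = (\<Sum>M\<in>between {0} (k - 1) B. 1 - (if \<not> safe M B then 1 - 1 / b else 0))"
      by (intro sum.cong) (auto simp: u_def)
    also have "\<dots> = real (card (between {0} (k - 1) B)) - real (card {M\<in>between {0} (k - 1) B. \<not> safe M B}) * (1 - 1 / b)"
      by (simp only: sum_subtractf sum.If_cases[OF finite_vecs]) (simp add: Int_def algebra_simps)
    also have "real (card (between {0} (k - 1) B)) = br k"
      using card_hyperplanes_between[of "{0}" B "k - 1"] familyD[OF B] k_ge_2 by (simp add: subspace_0)
    finally show ?thesis .
  qed
  have ge: "c \<le> (\<Sum>M\<in>{M\<in>hp. M \<subseteq> B}. u M B)" if B: "B \<in> \<F>" for B
  proof -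
    obtain p where p': "p \<in> between {0} 1 B" "\<forall>M\<in>between {0} (k - 1) B. \<not> safe M B \<longrightarrow> p \<subseteq> M"
      using p[OF B] by blast
    have "real (card {M\<in>between {0} (k - 1) B. \<not> safe M B}) \<le> br (k - 1)"
      unfolding card_p[OF B p', symmetric] of_nat_le_iff by (intro card_mono unsafe_le[OF B p']) auto
    thus ?thesis unfolding sum_u[OF B] c_def using b by simp
  qed
  have le: "(\<Sum>B\<in>{B\<in>\<F>. M \<subseteq> B}. u M B) \<le> 1" if "M \<in> hp" for M
    using sum_hyperplane_weight_le(1)[of M] that unfolding hp_def u_def b_def link_def .
  have swap: "(\<Sum>M\<in>hp. \<Sum>B\<in>{B\<in>\<F>. M \<subseteq> B}. u M B) = (\<Sum>B\<in>\<F>. \<Sum>M\<in>{M\<in>hp. M \<subseteq> B}. u M B)"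
    by (rule sum.swap_restrict) auto
  obtain x where x: "x \<in> pts {0} UNIV" by (rule ex_point)
  have "(\<Sum>M\<in>hp. 1) = above k 1 * c"
    using card_hyperplane_sections[OF k_ge_2 dim_ge x] by (simp add: hp_def c_def b_def)
  moreover have "(\<Sum>B\<in>\<F>. c) = above k 1 * c" using eq by simp
  moreover have "(\<Sum>B\<in>\<F>. c) \<le> (\<Sum>B\<in>\<F>. \<Sum>M\<in>{M\<in>hp. M \<subseteq> B}. u M B)" by (intro sum_mono ge)
  moreover have "(\<Sum>M\<in>hp. \<Sum>B\<in>{B\<in>\<F>. M \<subseteq> B}. u M B) \<le> (\<Sum>M\<in>hp. 1)" by (intro sum_mono le)
  ultimately have eq1: "(\<Sum>B\<in>\<F>. c) = (\<Sum>B\<in>\<F>. \<Sum>M\<in>{M\<in>hp. M \<subseteq> B}. u M B)"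
    and eq2: "(\<Sum>M\<in>hp. \<Sum>B\<in>{B\<in>\<F>. M \<subseteq> B}. u M B) = (\<Sum>M\<in>hp. 1)"
    unfolding swap by linarith+
  show "full M" if M: "B \<in> link M" "M \<in> between {0} (k - 1) UNIV" "\<not> safe M B"
  proof -
    have "(\<Sum>B\<in>{B\<in>\<F>. M \<subseteq> B}. u M B) = 1"
      by (rule sum_mono_inv[OF eq2 le]) (use M in \<open>auto simp: hp_def\<close>)
    hence "(\<Sum>B\<in>link M. if safe M B then 1 else 1 / br (dim UNIV - k + 1)) = 1"
      unfolding u_def b_def link_def .
    thus ?thesis using sum_hyperplane_weight_le(2)[OF M(2)] M(1,3) by blast
  qed
  show "\<exists>p\<in>between {0} 1 B. \<forall>M\<in>between p (k - 1) B. \<not> safe M B" if B: "B \<in> \<F>"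
  proof -
    obtain p where p': "p \<in> between {0} 1 B" "\<forall>M\<in>between {0} (k - 1) B. \<not> safe M B \<longrightarrow> p \<subseteq> M"
      using p[OF B] by blast
    have "c = (\<Sum>M\<in>{M\<in>hp. M \<subseteq> B}. u M B)" by (rule sum_mono_inv[OF eq1 ge]) (use B in auto)
    hence "real (card {M\<in>between {0} (k - 1) B. \<not> safe M B}) * (1 - 1 / b) = br (k - 1) * (1 - 1 / b)"
      unfolding sum_u[OF B] c_def by linarith
    hence "real (card {M\<in>between {0} (k - 1) B. \<not> safe M B}) = br (k - 1)"
      by (rule mult_right_cancel[THEN iffD1, rotated]) (use b in linarith)
    hence "card {M\<in>between {0} (k - 1) B. \<not> safe M B} = card (between p (k - 1) B)"
      using card_p[OF B p'] by simp
    hence "{M\<in>between {0} (k - 1) B. \<not> safe M B} = between p (k - 1) B"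
      by (intro card_subset_eq unsafe_le[OF B p']) auto
    thus ?thesis using p' by blast
  qed
qed

text \<open>For k <= 3 the i-spaces are points, so every member has an unsafe point. It lies on all
  unsafe hyperplanes of the member, because the dimensions 1 and k - 1 are complementary.\<close>

lemma ex_full_point_small:
  assumes "k \<le> 3" "\<And>B. B \<in> \<F> \<Longrightarrow> \<exists>D\<in>between {0} 1 B. \<not> safe D B" and eq: "real (card \<F>) = above k 1"
  shows "\<exists>p\<in>pts {0} UNIV. full p"
proof -
  have p: "\<exists>p\<in>between {0} 1 B. \<forall>M\<in>between {0} (k - 1) B. \<not> safe M B \<longrightarrow> p \<subseteq> M" if B: "B \<in> \<F>" for B
  proof -
    obtain p where p: "p \<in> between {0} 1 B" "\<not> safe p B" using assms(2)[OF B] by blast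
    have "p \<subseteq> M" if M: "M \<in> between {0} (k - 1) B" "\<not> safe M B" for M
    proof -
      have s: "subspace p" "dim p = 1" "subspace M" "dim M = k - 1" using p M by (auto simp: between_iff)
      have "p \<inter> M \<noteq> {0}" using unsafe_Int_nonzero[OF B p(2) M(2)] s k_ge_2 by simp
      moreover have "subspace (p \<inter> M)" using s by (simp add: subspace_inter)
      ultimately have "dim (p \<inter> M) \<noteq> 0" using zero_in_dim by blast
      hence "dim p \<le> dim (p \<inter> M)" using s(2) by linarith
      hence "p \<inter> M = p" using s \<open>subspace (p \<inter> M)\<close> by (intro subspace_eqI) auto
      thus ?thesis by blast
    qed
    thus ?thesis using p by blast
  qed
  have unsafe_full: "full M" if "B \<in> link M" "M \<in> between {0} (k - 1) UNIV" "\<not> safe M B" for M B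
    using extremal_hyperplanes(1)[OF _ eq that] p by blast
  have "0 < above k 1" using k_ge_2 dim_ge by (intro above_pos) (auto simp del: dim_UNIV)
  hence "\<F> \<noteq> {}" using eq by auto
  then obtain B where B: "B \<in> \<F>" by blast
  note Bs = familyD[OF B]
  obtain x where x: "x \<in> between {0} 1 B" "\<forall>M\<in>between x (k - 1) B. \<not> safe M B"
    using extremal_hyperplanes(2)[OF p eq B] by blast
  have xs: "subspace x" "dim x = 1" "x \<subseteq> B" using x by (auto simp: between_iff)
  have fullM: "full M" if M: "M \<in> between x (k - 1) B" for M
  proof (rule unsafe_full)
    show "B \<in> link M" "M \<in> between {0} (k - 1) UNIV" "\<not> safe M B"
      using M B x(2) subspace_0 by (auto simp: between_iff link_def)
  qed
  have "full x"
    unfolding full_def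
  proof
    fix C assume "C \<in> between x k UNIV"
    hence C: "subspace C" "x \<subseteq> C" "dim C = k" "C \<in> between x k UNIV" by (auto simp: between_iff)
    define S where "S = C \<inter> B"
    have S: "subspace S" "x \<subseteq> S" "S \<subseteq> B" "S \<subseteq> C" using C Bs xs by (auto simp: S_def subspace_inter)
    show "C \<in> \<F>"
    proof (cases "k - 1 \<le> dim S")
      case True
      have "0 < real (card (between x (k - 1) S))"
        using card_between[OF xs(1) S(1,2), of "k - 1"] gb_pos[of "k - 1 - 1" "dim S - 1"] True k_ge_2 xs by simp
      then obtain M where M: "M \<in> between x (k - 1) S" by (fastforce simp: card_gt_0_iff)
      hence "full M" using S by (intro fullM) (auto simp: between_iff)
      moreover have "C \<in> between M k UNIV" using M C S by (auto simp: between_iff)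
      ultimately show ?thesis by (auto simp: full_def)
    next
      case False
      have "1 \<le> dim S" using dim_subset[OF S(2)] xs by simp
      hence k3: "k = 3" "dim S = 1" using False assms(1) by auto
      hence "S = x" using S xs by (intro subspace_eqI[symmetric]) auto
      have "x \<noteq> C" using xs C k3 by auto
      \<comment> \<open>Here C meets B only in x. The 2-space l becomes full because joining it to
        two full 2-spaces of B yields two different members through l, which makes l unsafe.\<close>
      then obtain l where l: "l \<in> pts x C" using ex_pts[OF xs(1) C(1)] C(2) by blast
      hence ls: "subspace l" "x \<subseteq> l" "l \<subseteq> C" "dim l = 2" "l \<in> pts x UNIV" using xs by (auto simp: pts_iff)
      have lB: "\<not> l \<subseteq> B"
      proof
        assume "l \<subseteq> B"
        hence "l \<subseteq> x" using ls \<open>S = x\<close> by (auto simp: S_def)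
        hence "dim l \<le> dim x" by (rule dim_subset)
        thus False using ls xs by simp
      qed
      have "real (card (pts x B)) = q + 1"
        using card_pts[OF xs(1) Bs(1) xs(3)] Bs xs k3 br_Suc[of "Suc 0"] by (simp add: numeral_2_eq_2)
      hence "1 < card (pts x B)" using q_ge2 by linarith
      then obtain M M' where M: "M \<in> pts x B" "M' \<in> pts x B" "M \<noteq> M'"
        by (metis One_nat_def card_le_Suc0_iff_eq finite_vecs not_less)
      have plus: "M + l \<in> \<F>" "l \<subseteq> M + l" if M: "M \<in> pts x B" for M
      proof -
        have Ms: "subspace M" "x \<subseteq> M" "M \<subseteq> B" "dim M = 2" using M xs by (auto simp: pts_iff)
        have "M + l \<in> pts M UNIV" using lB Ms ls xs by (intro plus_pts[of x]) auto
        hence "M + l \<in> between M k UNIV" using Ms k3 by (simp add: pts_iff between_iff)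
        moreover have "full M" using Ms k3 by (intro fullM) (auto simp: between_iff)
        ultimately show "M + l \<in> \<F>" by (auto simp: full_def)
        show "l \<subseteq> M + l" using Ms by (intro subset_plus2)
      qed
      have "M + l \<noteq> M' + l"
      proof
        assume eq: "M + l = M' + l"
        have Ms: "subspace M" "x \<subseteq> M" "dim M = 2" "subspace M'" "dim M' = 2" "M \<subseteq> B" "M' \<subseteq> B"
          using M xs by (auto simp: pts_iff)
        have "\<not> M' \<subseteq> M" using subspace_eqI[of M' M] Ms M(3) by auto
        hence "M + M' \<in> pts M UNIV" using M Ms xs by (intro plus_pts[of x]) (auto simp: pts_iff)
        hence 1: "subspace (M + M')" "dim (M + M') = 3" using Ms by (auto simp: pts_iff)
        have "M + M' \<subseteq> B" using Ms Bs by (intro plus_subsetI) auto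
        hence "M + M' = B" using 1 Bs k3 by (intro subspace_eqI) auto
        moreover have "M' \<subseteq> M + l" unfolding eq using ls by (intro subset_plus1)
        hence "M + M' \<subseteq> M + l" using Ms ls subset_plus1[OF ls(1), of M]
          by (intro plus_subsetI subspace_plus) auto
        ultimately have "B \<subseteq> M + l" by simp
        hence "B = M + l" using familyD[OF plus(1)[OF M(1)]] Bs by (intro subspace_eqI) auto
        thus False using plus(2)[OF M(1)] lB by simp
      qed
      moreover have link: "M + l \<in> link l" "M' + l \<in> link l" using plus M by (auto simp: link_def)
      moreover have l2: "l \<in> between {0} (k - 1) UNIV" using ls k3 by (simp add: between_iff subspace_0)
      ultimately have "\<not> safe l (M + l)" using hyperplane_unsafe_iff by metis
      hence "full l" using unsafe_full[OF link(1) l2] by blast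
      moreover have "C \<in> between l k UNIV" using C ls by (simp add: between_iff)
      ultimately show ?thesis by (auto simp: full_def)
    qed
  qed
  moreover have "x \<in> pts {0} UNIV" using xs by (simp add: pts_iff subspace_0)
  ultimately show ?thesis by blast
qed

text \<open>A full point is enough: the k-spaces through it already number \<open>above k 1\<close>,
  so they are the whole family.\<close>

lemma extremal_is_star:
  assumes eq: "real (card \<F>) = above k 1" and n: "2 * k < dim UNIV"
  shows "is_star \<F>"
proof -
  have "\<exists>p\<in>pts {0} UNIV. full p"
  proof (cases "k \<le> 3")
    case True
    show ?thesis
    proof (cases "k = 2")
      case k: True
      show ?thesis by (rule ex_full_point_small[OF True _ eq]) (use extremal_even(2)[of 1] k eq in auto)
    next
      case False
      hence "k = 3" using True k_ge_2 by simp
      thus ?thesis by (intro ex_full_point_small[OF True _ eq]) (use extremal_odd(2)[of 1] eq in auto)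
    qed
  next
    case k4: False
    show ?thesis
    proof (cases "even k")
      case True
      then obtain i where i: "k = 2 * i" by blast
      show ?thesis
      proof (rule ex_full_point[of i])
        show "0 < i" "i + 1 < k" "3 * i + 1 < dim UNIV" using i k4 n by (auto simp del: dim_UNIV)
        fix D :: "'b set" assume D: "subspace D" "dim D = i - 1"
        have "\<exists>L\<in>pts E UNIV. full L" if "E \<in> pts D UNIV" for E
          using that D i k4 by (intro extremal_even(1)[OF i eq]) (auto simp: pts_iff)
        thus "\<exists>y. \<forall>E\<in>pts D UNIV. E \<noteq> y \<longrightarrow> (\<exists>L\<in>pts E UNIV. full L)" by blast
      qed
    next
      case False
      then obtain i where i: "k = 2 * i + 1" by (elim oddE)
      \<comment> \<open>For odd k the full spaces supplied over an i-space have dimension i + 2, one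
        more than for even k, hence this choice of e.\<close>
      show ?thesis
      proof (rule ex_full_point[of "i + 1"])
        show "0 < i + 1" "i + 1 + 1 < k" "3 * (i + 1) + 1 < dim UNIV" using i k4 n by (auto simp del: dim_UNIV)
        fix D :: "'b set" assume D: "subspace D" "dim D = i + 1 - 1"
        thus "\<exists>y. \<forall>E\<in>pts D UNIV. E \<noteq> y \<longrightarrow> (\<exists>L\<in>pts E UNIV. full L)"
          using extremal_odd(1)[OF i eq, of D] by auto
      qed
    qed
  qed
  then obtain p where p: "p \<in> pts {0} UNIV" "full p" by blast
  hence ps: "subspace p" "dim p = 1" by (auto simp: pts_iff)
  have "card (between p k UNIV) = card \<F>" using card_above[OF ps(1), of k] ps eq by simp
  hence "between p k UNIV = \<F>" using p(2) unfolding full_def by (intro card_subset_eq) auto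
  moreover have "p \<noteq> {0}" using ps by auto
  then obtain v where "v \<in> p" "v \<noteq> 0" using subspace_0[OF ps(1)] by blast
  ultimately show ?thesis unfolding is_star_def between_def by blast
qed

end

section \<open>Translation to q-factorials and conclusion\<close>

lemma (in finite_vector_space) gauss_binomial_eq_gb:
  assumes "j \<le> m" shows "gauss_binomial CARD('a) m j = gb m j"
proof -
  have fact: "q_fact CARD('a) i = (\<Prod>t=1..i. br t)" for i
    by (simp add: q_fact_def q_int_def br_closed q_def)
  have prod: "(\<Prod>t<i. br (l - t)) * q_fact CARD('a) (l - i) = q_fact CARD('a) l" if "i \<le> l" for i l
    using that
  proof (induction i)
    case (Suc i)
    hence "l - i = Suc (l - Suc i)" by simp
    hence "q_fact CARD('a) (l - i) = q_fact CARD('a) (l - Suc i) * br (l - i)"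
      unfolding fact by (simp add: prod.nat_ivl_Suc' mult.commute)
    thus ?case using Suc by (simp add: mult.commute mult.left_commute)
  qed simp
  have "q_fact CARD('a) 0 = 1" by (simp add: q_fact_def)
  hence "(\<Prod>t<j. br (j - t)) = q_fact CARD('a) j" using prod[of j j] by simp
  moreover have "q_fact CARD('a) i \<noteq> 0" for i unfolding fact by (simp add: prod_zero_iff)
  ultimately show ?thesis
    using prod[OF assms] by (simp add: gb_def gauss_binomial_def prod_dividef field_simps)
qed

theorem theoremA:
  fixes scale :: "'a::{field,finite} \<Rightarrow> 'b::ab_group_add \<Rightarrow> 'b"
    and n q k :: nat
    and \<F> :: "'b set set"
  assumes "n > 0"
    and "CARD('a) = q"
    and "vector_space scale"
    and "vector_space.dim scale (UNIV :: 'b set) = n"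
    and "2 \<le> k" and "real k \<le> real n / 2"
    and "\<F> \<subseteq> k_subspaces scale k"
    and "covering_triple_free scale k \<F>"
  shows "real (card \<F>) \<le> gauss_binomial q (n - 1) (k - 1) \<and>
    (real k < real n / 2 \<and> real (card \<F>) = gauss_binomial q (n - 1) (k - 1)
       \<longrightarrow> is_star \<F>)"
proof -
  interpret V: vector_space scale by fact
  interpret V: vector_space_over_finite_field scale by unfold_locales
  interpret V: finite_vector_space scale
    by unfold_locales (rule V.finite_UNIV_of_dim_pos, use assms in simp)
  have n: "2 * k \<le> V.dim UNIV" "1 \<le> k" using assms by (simp_all del: V.dim_UNIV)
  have "\<F> \<subseteq> V.between {0} k UNIV"
    using assms(7) V.subspace_0 by (auto simp: k_subspaces_def V.between_iff)
  then interpret covering_triple_free_family scale \<F> k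
    using assms n by unfold_locales auto
  have "gauss_binomial q (n - 1) (k - 1) = V.above k 1"
    using V.gauss_binomial_eq_gb[of "k - 1" "n - 1"] assms n by (simp add: V.above_def del: V.dim_UNIV)
  moreover have "2 * k < V.dim UNIV" if "real k < real n / 2" using that assms by (simp del: V.dim_UNIV)
  ultimately show ?thesis using card_family_le extremal_is_star by metis
qed

end
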